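(* Let $\mathcal{W}$ be a von Neumann algebra and let $\mathcal{A}\subset\mathcal{W}$ be a unital subalgebra. Then the following statements are equivalent. (i) The algebra $\mathcal{A}$ admits a Lebesgue decomposition relative to $\mathcal{W}$. (ii) There exists a central projection $\mathfrak{z}\in\mathcal{A}^{**}$ so that $\mathrm{AC}_{\mathcal{W}}(\mathcal{A})=\mathfrak{z}\mathcal{A}^*$. (iii) The space $\mathrm{AC}_{\mathcal{W}}(\mathcal{A})$ is (norm) closed in $\mathcal{A}^*$ and there exists a central projection $\mathfrak{z}\in\mathcal{A}^{**}$ so that $\mathrm{AC}_{\mathcal{W}}(\mathcal{A})^\perp=(I-\mathfrak{z})\mathcal{A}^{**}$. In this case, the projections in (ii) and (iii) agree, and $\mathrm{SG}_{\mathcal{W}}(\mathcal{A})=(I-\mathfrak{z})\mathcal{A}^*$. Moreover, the Lebesgue decomposition is given by $$\varphi=\mathfrak{z}\cdot\varphi+(I-\mathfrak{z})\cdot\varphi,\qquad\varphi\in\mathcal{A}^*.$$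
   Context: Subalgebras need not be self-adjoint; unital ones contain the identity of $\mathcal{W}$. A bounded linear functional on $\mathcal{A}$ is absolutely continuous (relative to $\mathcal{W}$) if it extends to a weak-$*$ continuous linear functional on $\mathcal{W}$; $\mathrm{AC}_{\mathcal{W}}(\mathcal{A})\subset\mathcal{A}^*$ is the space of these functionals, and $\mathrm{AC}_{\mathcal{W}}(\mathcal{A})^\perp\subset\mathcal{A}^{**}$ its annihilator. $\mathcal{A}$ admits a Lebesgue decomposition relative to $\mathcal{W}$ if there is a bounded linear idempotent $L:\mathcal{A}^*\to\mathcal{A}^*$ with $L\mathcal{A}^*=\mathrm{AC}_{\mathcal{W}}(\mathcal{A})$ and $\|\phi\|=\|L\phi\|+\|(I-L)\phi\|$ for all $\phi\in\mathcal{A}^*$. Then $\mathrm{SG}_{\mathcal{W}}(\mathcal{A}):=(I-L)\mathcal{A}^*$ is uniquely determined, and the Lebesgue decomposition of $\phi$ is $\phi=L\phi+(I-L)\phi$. The bidual $\mathcal{A}^{**}$ is an operator algebra with the Arens product (the separately weak-$*$ continuous extension of the product of $\mathcal{A}$), and $\mathcal{A}^*$ is an $\mathcal{A}^{**}$-bimodule: for $\Lambda\in\mathcal{A}^{**}$, $\phi\in\mathcal{A}^*$, $(\Lambda\cdot\phi)(a)=\Lambda(\phi a)$ where $(\phi a)(b)=\phi(ab)$, and $(\phi\cdot\Lambda)(a)=\Lambda(a\phi)$ where $(a\phi)(b)=\phi(ba)$. *)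

theory Defs
  imports "HOL-Analysis.Analysis" "HOL-Library.Function_Algebras"
begin

section \<open>Complex vector spaces and complex Hilbert spaces\<close>

class complex_vector = ab_group_add +
  fixes scaleC :: "complex \<Rightarrow> 'a \<Rightarrow> 'a"  (infixr \<open>*\<^sub>C\<close> 75)
  assumes scaleC_add_right: "c *\<^sub>C (x + y) = c *\<^sub>C x + c *\<^sub>C y"
    and scaleC_add_left: "(c + d) *\<^sub>C x = c *\<^sub>C x + d *\<^sub>C x"
    and scaleC_scaleC: "c *\<^sub>C d *\<^sub>C x = (c * d) *\<^sub>C x"
    and scaleC_one: "1 *\<^sub>C x = x"

class complex_normed_vector = complex_vector + real_normed_vector +
  assumes scaleR_scaleC: "r *\<^sub>R x = complex_of_real r *\<^sub>C x"
    and norm_scaleC: "norm (c *\<^sub>C x) = cmod c * norm x"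

text \<open>The inner product is linear in its first argument. Positive definiteness is a consequence of
  the last axiom, since \<^const>\<open>norm\<close> is a norm.\<close>

class complex_hilbert = complex_normed_vector + complete_space +
  fixes cinner :: "'a \<Rightarrow> 'a \<Rightarrow> complex"
  assumes cinner_commute: "cinner x y = cnj (cinner y x)"
    and cinner_add_left: "cinner (x + y) z = cinner x z + cinner y z"
    and cinner_scaleC_left: "cinner (c *\<^sub>C x) y = c * cinner x y"
    and cinner_self: "cinner x x = complex_of_real ((norm x)\<^sup>2)"

instantiation complex :: complex_hilbert
begin

definition scaleC_complex :: "complex \<Rightarrow> complex \<Rightarrow> complex" where
  "scaleC_complex c x = c * x"

definition cinner_complex :: "complex \<Rightarrow> complex \<Rightarrow> complex" where
  "cinner_complex x y = x * cnj y"

instance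
proof
  show "cinner x x = complex_of_real ((norm x)\<^sup>2)" for x :: complex
    unfolding cinner_complex_def by (rule complex_norm_square[symmetric])
qed (simp_all add: scaleC_complex_def cinner_complex_def distrib_left distrib_right
      scaleR_conv_of_real norm_mult mult.commute mult.assoc)

end

instantiation "fun" :: (type, complex_vector) complex_vector
begin

definition scaleC_fun :: "complex \<Rightarrow> ('a \<Rightarrow> 'b) \<Rightarrow> 'a \<Rightarrow> 'b" where
  "scaleC_fun c f = (\<lambda>x. c *\<^sub>C f x)"

instance
  by standard
    (simp_all add: scaleC_fun_def fun_eq_iff scaleC_add_right scaleC_add_left scaleC_scaleC
      scaleC_one)

end

lemma bounded_linear_scaleC: "bounded_linear (\<lambda>x::'a::complex_normed_vector. c *\<^sub>C x)"
  by (rule bounded_linear_intro[where K = "cmod c"])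
    (simp_all add: scaleC_add_right scaleR_scaleC scaleC_scaleC norm_scaleC mult.commute)

instantiation blinfun :: (real_normed_vector, complex_normed_vector) complex_normed_vector
begin

lift_definition scaleC_blinfun :: "complex \<Rightarrow> 'a \<Rightarrow>\<^sub>L 'b \<Rightarrow> 'a \<Rightarrow>\<^sub>L 'b" is "\<lambda>c f x. c *\<^sub>C f x"
  by (rule bounded_linear_compose[OF bounded_linear_scaleC])

instance
proof
  fix c d :: complex and r :: real and f g :: "'a \<Rightarrow>\<^sub>L 'b"
  show "c *\<^sub>C (f + g) = c *\<^sub>C f + c *\<^sub>C g"
    by transfer (simp add: fun_eq_iff scaleC_add_right)
  show "(c + d) *\<^sub>C f = c *\<^sub>C f + d *\<^sub>C f"
    by transfer (simp add: fun_eq_iff scaleC_add_left)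
  show "c *\<^sub>C d *\<^sub>C f = (c * d) *\<^sub>C f"
    by transfer (simp add: fun_eq_iff scaleC_scaleC)
  show "1 *\<^sub>C f = f"
    by transfer (simp add: fun_eq_iff scaleC_one)
  show "r *\<^sub>R f = complex_of_real r *\<^sub>C f"
    by transfer (simp add: fun_eq_iff scaleR_scaleC)
  show "norm (c *\<^sub>C f) = cmod c * norm f"
  proof (cases "c = 0")
    case True
    have "c *\<^sub>C f x = 0" for x
      using norm_scaleC[of c "f x"] True by simp
    then have "c *\<^sub>C f = 0"
      by (intro blinfun_eqI) (simp add: scaleC_blinfun.rep_eq)
    then show ?thesis
      using True by simp
  next
    case False
    have le: "norm (c *\<^sub>C f) \<le> cmod c * norm f" for c :: complex and f :: "'a \<Rightarrow>\<^sub>L 'b"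
    proof (rule norm_blinfun_bound)
      show "norm ((c *\<^sub>C f) x) \<le> cmod c * norm f * norm x" for x
        using mult_left_mono[OF norm_blinfun[of f x] norm_ge_zero[of c]]
        by (simp only: scaleC_blinfun.rep_eq norm_scaleC mult.assoc)
    qed (simp only: mult_nonneg_nonneg norm_ge_zero)
    have "f = inverse c *\<^sub>C c *\<^sub>C f"
      using False by transfer (simp add: fun_eq_iff scaleC_scaleC scaleC_one)
    then have "norm f \<le> inverse (cmod c) * norm (c *\<^sub>C f)"
      using le[of "inverse c" "c *\<^sub>C f"] by (simp add: norm_inverse)
    then have "cmod c * norm f \<le> norm (c *\<^sub>C f)"
      using False by (simp add: field_simps)
    with le show ?thesis
      by (simp add: order_antisym)
  qed
qed

end

definition clinear_on :: "'a::complex_vector set \<Rightarrow> ('a \<Rightarrow> 'b::complex_vector) \<Rightarrow> bool" where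
  "clinear_on V f \<longleftrightarrow>
     (\<forall>x\<in>V. \<forall>y\<in>V. f (x + y) = f x + f y) \<and> (\<forall>c. \<forall>x\<in>V. f (c *\<^sub>C x) = c *\<^sub>C f x)"


section \<open>Dual spaces\<close>

text \<open>For a complex subspace \<open>V\<close> with norm \<open>N\<close>, elements of the dual are represented by
  functions on the ambient type that vanish outside \<open>V\<close>; in this way equality and the vector space
  operations of the dual are those of functions. The norm is a parameter so that the construction
  can be iterated.\<close>

definition dual_space :: "'a::complex_vector set \<Rightarrow> ('a \<Rightarrow> real) \<Rightarrow> ('a \<Rightarrow> complex) set" where
  "dual_space V N =
     {f. clinear_on V f \<and> (\<exists>K. \<forall>x\<in>V. cmod (f x) \<le> K * N x) \<and> (\<forall>x. x \<notin> V \<longrightarrow> f x = 0)}"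

definition dual_norm :: "'a set \<Rightarrow> ('a \<Rightarrow> real) \<Rightarrow> ('a \<Rightarrow> complex) \<Rightarrow> real" where
  "dual_norm V N f = (SUP x\<in>{x\<in>V. N x \<le> 1}. cmod (f x))"

abbreviation dual :: "'a::complex_normed_vector set \<Rightarrow> ('a \<Rightarrow> complex) set" where
  "dual V \<equiv> dual_space V norm"

abbreviation bidual :: "'a::complex_normed_vector set \<Rightarrow> (('a \<Rightarrow> complex) \<Rightarrow> complex) set" where
  "bidual V \<equiv> dual_space (dual V) (dual_norm V norm)"

definition norm_closed_in_dual ::
    "'a::complex_normed_vector set \<Rightarrow> ('a \<Rightarrow> complex) set \<Rightarrow> bool" where
  "norm_closed_in_dual V S \<longleftrightarrow>
     (\<forall>\<phi>\<in>dual V. (\<forall>\<epsilon>>0. \<exists>\<psi>\<in>S. dual_norm V norm (\<phi> - \<psi>) < \<epsilon>) \<longrightarrow> \<phi> \<in> S)"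

definition annihilator ::
    "'a::complex_normed_vector set \<Rightarrow> ('a \<Rightarrow> complex) set \<Rightarrow> (('a \<Rightarrow> complex) \<Rightarrow> complex) set" where
  "annihilator V S = {\<Lambda>\<in>bidual V. \<forall>\<phi>\<in>S. \<Lambda> \<phi> = 0}"


section \<open>Von Neumann algebras and their unital subalgebras\<close>

type_synonym 'h op = "'h \<Rightarrow>\<^sub>L 'h"

text \<open>\<^typ>\<open>'h op\<close> consists of the real-linear bounded operators.\<close>

definition bounded_operators :: "'h::complex_hilbert op set" where
  "bounded_operators = {T. clinear_on UNIV (blinfun_apply T)}"

definition is_cadjoint :: "'h::complex_hilbert op \<Rightarrow> 'h op \<Rightarrow> bool" where
  "is_cadjoint T S \<longleftrightarrow> (\<forall>x y. cinner (T x) y = cinner x (S y))"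

definition cadjoint :: "'h::complex_hilbert op \<Rightarrow> 'h op" where
  "cadjoint T = (THE S. is_cadjoint T S)"

definition unital_subalgebra :: "'h::complex_hilbert op set \<Rightarrow> 'h op set \<Rightarrow> bool" where
  "unital_subalgebra A W \<longleftrightarrow>
     A \<subseteq> W \<and> module.subspace scaleC A \<and> (\<forall>S\<in>A. \<forall>T\<in>A. S o\<^sub>L T \<in> A) \<and> id_blinfun \<in> A"

definition von_neumann_algebra :: "'h::complex_hilbert op set \<Rightarrow> bool" where
  "von_neumann_algebra W \<longleftrightarrow>
     unital_subalgebra W bounded_operators \<and>
     (\<forall>T\<in>W. \<exists>S\<in>W. is_cadjoint T S) \<and>
     closedin strong_operator_topology W"

text \<open>The weak-* topology of B(H) as the dual of the trace class operators (the \<open>\<sigma>\<close>-weak topology)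
  is generated by the functionals mapping \<open>T\<close> to \<open>\<Sum>n. \<langle>T (x n), y n\<rangle>\<close> with square-summable \<open>x\<close>
  and \<open>y\<close>. The weak-* topology of a von Neumann algebra is the relative one.\<close>

definition square_summable :: "(nat \<Rightarrow> 'h::real_normed_vector) set" where
  "square_summable = {x. summable (\<lambda>n. (norm (x n))\<^sup>2)}"

definition weak_star_topology :: "'h::complex_hilbert op set \<Rightarrow> 'h op topology" where
  "weak_star_topology W =
     subtopology
       (pullback_topology UNIV
          (\<lambda>T. \<lambda>(x, y)\<in>square_summable \<times> square_summable. \<Sum>n. cinner (blinfun_apply T (x n)) (y n))
          (product_topology (\<lambda>_. euclidean) (square_summable \<times> square_summable)))
       W"


section \<open>Absolutely continuous functionals and Lebesgue decompositions\<close>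

definition AC :: "'h::complex_hilbert op set \<Rightarrow> 'h op set \<Rightarrow> ('h op \<Rightarrow> complex) set" where
  "AC W A =
     {\<phi>\<in>dual A. \<exists>\<psi>. clinear_on W \<psi> \<and> continuous_map (weak_star_topology W) euclidean \<psi> \<and>
                     (\<forall>a\<in>A. \<psi> a = \<phi> a)}"

definition lebesgue_projection :: "'h::complex_hilbert op set \<Rightarrow> 'h op set \<Rightarrow>
    (('h op \<Rightarrow> complex) \<Rightarrow> ('h op \<Rightarrow> complex)) \<Rightarrow> bool" where
  "lebesgue_projection W A L \<longleftrightarrow>
     L \<in> dual A \<rightarrow> dual A \<and>
     clinear_on (dual A) L \<and>
     (\<exists>K. \<forall>\<phi>\<in>dual A. dual_norm A norm (L \<phi>) \<le> K * dual_norm A norm \<phi>) \<and>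
     (\<forall>\<phi>\<in>dual A. L (L \<phi>) = L \<phi>) \<and>
     L ` dual A = AC W A \<and>
     (\<forall>\<phi>\<in>dual A. dual_norm A norm \<phi> = dual_norm A norm (L \<phi>) + dual_norm A norm (\<phi> - L \<phi>))"

definition admits_lebesgue_decomposition ::
    "'h::complex_hilbert op set \<Rightarrow> 'h op set \<Rightarrow> bool" where
  "admits_lebesgue_decomposition W A \<longleftrightarrow> (\<exists>L. lebesgue_projection W A L)"

text \<open>The space \<open>SG\<close> of singular functionals, computed from a given Lebesgue projection \<open>L\<close>.\<close>

definition SG :: "'h::complex_hilbert op set \<Rightarrow> (('h op \<Rightarrow> complex) \<Rightarrow> ('h op \<Rightarrow> complex)) \<Rightarrow>
    ('h op \<Rightarrow> complex) set" where
  "SG A L = (\<lambda>\<phi>. \<phi> - L \<phi>) ` dual A"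


section \<open>The bidual algebra and its action on the dual\<close>

text \<open>\<open>\<phi> a\<close>, i.e. the functional mapping \<open>b\<close> to \<open>\<phi> (a b)\<close>.\<close>

definition functional_mult ::
    "'h::complex_hilbert op set \<Rightarrow> ('h op \<Rightarrow> complex) \<Rightarrow> 'h op \<Rightarrow> ('h op \<Rightarrow> complex)" where
  "functional_mult A \<phi> a = (\<lambda>b. if b \<in> A then \<phi> (a o\<^sub>L b) else 0)"

text \<open>\<open>\<Lambda> \<cdot> \<phi>\<close>\<close>

definition bidual_action :: "'h::complex_hilbert op set \<Rightarrow> (('h op \<Rightarrow> complex) \<Rightarrow> complex) \<Rightarrow>
    ('h op \<Rightarrow> complex) \<Rightarrow> ('h op \<Rightarrow> complex)" where
  "bidual_action A \<Lambda> \<phi> = (\<lambda>a. if a \<in> A then \<Lambda> (functional_mult A \<phi> a) else 0)"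

definition arens_mult :: "'h::complex_hilbert op set \<Rightarrow> (('h op \<Rightarrow> complex) \<Rightarrow> complex) \<Rightarrow>
    (('h op \<Rightarrow> complex) \<Rightarrow> complex) \<Rightarrow> (('h op \<Rightarrow> complex) \<Rightarrow> complex)" where
  "arens_mult A \<Lambda> \<Gamma> = (\<lambda>\<phi>. if \<phi> \<in> dual A then \<Lambda> (bidual_action A \<Gamma> \<phi>) else 0)"

definition bidual_unit :: "'h::complex_hilbert op set \<Rightarrow> (('h op \<Rightarrow> complex) \<Rightarrow> complex)" where
  "bidual_unit A = (\<lambda>\<phi>. if \<phi> \<in> dual A then \<phi> id_blinfun else 0)"

text \<open>The involution of the C*-algebra W** is the bitranspose of that of \<open>W\<close>: with
  \<open>\<psi>\<^sup>*(T) = cnj (\<psi> (T\<^sup>*))\<close> one has \<open>\<Psi>\<^sup>*(\<psi>) = cnj (\<Psi> (\<psi>\<^sup>*))\<close>.\<close>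

definition functional_star ::
    "'h::complex_hilbert op set \<Rightarrow> ('h op \<Rightarrow> complex) \<Rightarrow> ('h op \<Rightarrow> complex)" where
  "functional_star W \<psi> = (\<lambda>T. if T \<in> W then cnj (\<psi> (cadjoint T)) else 0)"

definition bidual_star :: "'h::complex_hilbert op set \<Rightarrow> (('h op \<Rightarrow> complex) \<Rightarrow> complex) \<Rightarrow>
    (('h op \<Rightarrow> complex) \<Rightarrow> complex)" where
  "bidual_star W \<Psi> = (\<lambda>\<psi>. if \<psi> \<in> dual W then cnj (\<Psi> (functional_star W \<psi>)) else 0)"

text \<open>The canonical embedding of A** into W**: the bitranspose of the inclusion of \<open>A\<close> into \<open>W\<close>.\<close>

definition bidual_inclusion :: "'h::complex_hilbert op set \<Rightarrow> 'h op set \<Rightarrow>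
    (('h op \<Rightarrow> complex) \<Rightarrow> complex) \<Rightarrow> (('h op \<Rightarrow> complex) \<Rightarrow> complex)" where
  "bidual_inclusion W A \<Lambda> =
     (\<lambda>\<psi>. if \<psi> \<in> dual W then \<Lambda> (\<lambda>a. if a \<in> A then \<psi> a else 0) else 0)"

text \<open>A projection of the operator algebra A** is an idempotent that is self-adjoint in the
  C*-algebra W** containing it; central means commuting with all of A**.\<close>

definition central_projection :: "'h::complex_hilbert op set \<Rightarrow> 'h op set \<Rightarrow>
    (('h op \<Rightarrow> complex) \<Rightarrow> complex) \<Rightarrow> bool" where
  "central_projection W A z \<longleftrightarrow>
     z \<in> bidual A \<and>
     arens_mult A z z = z \<and>
     bidual_star W (bidual_inclusion W A z) = bidual_inclusion W A z \<and>
     (\<forall>\<Lambda>\<in>bidual A. arens_mult A z \<Lambda> = arens_mult A \<Lambda> z)"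

end

theory Submission
  imports Defs
begin

text \<open>The bidual of a C*-algebra is a von Neumann algebra, and a projection onto an
  \<open>\<ell>\<^sup>1\<close>-summand of the dual of an operator algebra should come from a central projection of the bidual.
  The proof reaches these facts without the universal representation. For a positive functional \<open>p\<close>
  on \<open>W\<close> the form \<open>p (x y\<^sup>\<star>)\<close> is a semi-inner product on \<open>W\<close>, and two approximation statements do the
  work of its Hilbert space completion: an almost minimiser of a quadratic functional almost represents
  a given functional (\<open>riesz_approx\<close>), and therefore an element of the bidual acts on the functionals
  bounded by the form almost like an element of \<open>W\<close> (\<open>bidual_approx\<close>). Every functional is
  dominated by a positive one, \<open>\<bar>\<phi> x\<bar>\<^sup>2 \<le> p (x x\<^sup>\<star>)\<close>, by the Hahn--Banach theorem
  (\<open>exists_dominating_positive\<close>). Together these give three properties of the bidual: an element that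
  vanishes at all positive functionals is zero (\<open>bidual_zero_of_positive\<close>), the two Arens products
  coincide (\<open>arens_regular\<close>), and \<open>\<parallel>\<Lambda>\<parallel>\<^sup>2 \<le> \<parallel>\<Lambda> \<Lambda>\<^sup>\<star>\<parallel>\<close> (\<open>cstar_inequality\<close>).

  A central projection \<open>z\<close> splits the norm: for contractions \<open>a\<close> and \<open>b\<close> in \<open>A\<close> the element
  \<open>F = z a + (1 - z) b\<close> satisfies \<open>F F\<^sup>\<star> = z a a\<^sup>\<star> + (1 - z) b b\<^sup>\<star>\<close>, which has the same form, so
  iterating the C*-inequality improves any bound for the norm of such elements to 1
  (\<open>norm_split_le_one\<close>). Evaluating \<open>F\<close> at a functional \<open>\<phi>\<close> and taking suprema over \<open>a\<close> and \<open>b\<close> gives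
  \<open>\<parallel>z \<phi>\<parallel> + \<parallel>\<phi> - z \<phi>\<parallel> \<le> \<parallel>\<phi>\<parallel>\<close>.

  Conversely let \<open>L\<close> be an idempotent with \<open>\<parallel>\<phi>\<parallel> = \<parallel>L \<phi>\<parallel> + \<parallel>\<phi> - L \<phi>\<parallel>\<close>, and put \<open>e \<phi> = (L \<phi>) 1\<close>. The
  restriction \<open>f\<close> of a positive functional attains its norm at 1, and since norms add up, so do \<open>L f\<close> and
  \<open>f - L f\<close>. A contraction of the bidual whose value at such a functional is the norm fixes the
  functional, on both sides (\<open>fixed_of_attains\<close>). Applied to \<open>e\<close> at \<open>L f\<close> and to \<open>1 - e\<close> at \<open>f - L f\<close>
  this gives \<open>e f = L f = f e\<close>. By density \<open>e \<phi> = L \<phi> = \<phi> e\<close> for all \<open>\<phi>\<close>, and Arens regularity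
  turns the equality of the two actions into centrality of \<open>e\<close>.

  The third condition of the theorem is the second one seen through annihilators, and Hahn--Banach
  separation recovers a closed space of functionals from its annihilator.\<close>

section \<open>Elementary inequalities\<close>

text \<open>The discriminant criterion; it is the last step of every perturbation argument below, where \<open>r\<close> is
  the size of the perturbation.\<close>

lemma quadratic_bound:
  fixes b d s :: real
  assumes "\<And>r. r \<ge> 0 \<Longrightarrow> 2 * r * d \<le> r\<^sup>2 * b + s" and "b \<ge> 0" and "s \<ge> 0" and "d \<ge> 0"
  shows "d\<^sup>2 \<le> s * b"
proof (cases "b = 0")
  case True
  have "d = 0"
  proof (rule ccontr)
    assume "d \<noteq> 0"
    then have "d > 0"
      using assms(4) by simp
    then have "2 * ((s + 1) / d) * d \<le> s"
      using assms(1)[of "(s + 1) / d"] assms(3) True by simp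
    with \<open>d > 0\<close> assms(3) show False
      by simp
  qed
  then show ?thesis
    using True by simp
next
  case False
  then have "b > 0"
    using assms(2) by simp
  have "2 * (d / b) * d \<le> (d / b)\<^sup>2 * b + s"
    using assms(1)[of "d / b"] assms(2,4) by simp
  with \<open>b > 0\<close> show ?thesis
    by (simp add: field_simps power2_eq_square)
qed

lemma bounded_doubling_sequence:
  fixes u :: "nat \<Rightarrow> real"
  assumes step: "\<And>n. (u n)\<^sup>2 \<le> a * u (Suc n)" and bound: "\<And>n. u n \<le> C" and "a \<ge> 0"
  shows "u 0 \<le> a"
proof (rule ccontr)
  assume "\<not> u 0 \<le> a"
  then have gt: "u 0 > a" by simp
  have "a \<noteq> 0"
    using step[of 0] gt by auto
  then have "a > 0"
    using assms(3) by simp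
  define r where "r = u 0 / a"
  have "r > 1"
    using gt \<open>a > 0\<close> by (simp add: r_def)
  have grow: "u n \<ge> a * r ^ (2 ^ n)" for n
  proof (induction n)
    case 0
    show ?case using \<open>a > 0\<close> by (simp add: r_def)
  next
    case (Suc n)
    have "(a * r ^ (2 ^ n))\<^sup>2 \<le> (u n)\<^sup>2"
      using Suc \<open>a > 0\<close> \<open>r > 1\<close> by (intro power_mono) auto
    also have "\<dots> \<le> a * u (Suc n)"
      by (rule step)
    finally have "a * (a * r ^ (2 ^ Suc n)) \<le> a * u (Suc n)"
      by (simp add: power2_eq_square mult_2 power_add mult_ac)
    with \<open>a > 0\<close> show ?case by simp
  qed
  obtain n where n: "C / a < r ^ n"
    using real_arch_pow[OF \<open>r > 1\<close>] by blast
  have "r ^ n \<le> r ^ (2 ^ n)"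
    using \<open>r > 1\<close> by (intro power_increasing) (auto simp: less_imp_le)
  then have "C < a * r ^ (2 ^ n)"
    using n \<open>a > 0\<close> by (simp add: field_simps) (smt (verit) mult_left_mono)
  with grow[of n] bound[of n] show False
    by simp
qed

lemma square_sum_le:
  fixes a b s t k l :: real
  assumes "a\<^sup>2 \<le> s * k" "b\<^sup>2 \<le> t * l" "0 \<le> s" "0 \<le> t" "0 \<le> k" "0 \<le> l"
  shows "(a + b)\<^sup>2 \<le> (s + t) * (k + l)"
proof -
  have "(2 * (a * b))\<^sup>2 = 4 * (a\<^sup>2 * b\<^sup>2)"
    by (simp add: power_mult_distrib)
  also have "\<dots> \<le> 4 * ((s * k) * (t * l))"
    using assms by (intro mult_left_mono mult_mono) auto
  also have "\<dots> \<le> (s * l + t * k)\<^sup>2"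
    using zero_le_power2[of "s * l - t * k"] by (simp add: power2_eq_square algebra_simps)
  finally have "2 * (a * b) \<le> s * l + t * k"
    by (rule power2_le_imp_le) (use assms in simp)
  with assms(1,2) show ?thesis
    by (simp add: power2_eq_square algebra_simps)
qed

lemma nonpos_of_le_eps:
  fixes a c :: real
  assumes "\<And>\<epsilon>. \<epsilon> > 0 \<Longrightarrow> a \<le> \<epsilon> * c" and "c \<ge> 0"
  shows "a \<le> 0"
proof (rule field_le_epsilon)
  fix \<eta> :: real assume "\<eta> > 0"
  have "a \<le> \<eta> / (c + 1) * c"
    using assms(1)[of "\<eta> / (c + 1)"] assms(2) \<open>\<eta> > 0\<close> by simp
  also have "\<dots> \<le> \<eta> / (c + 1) * (c + 1)"
    using assms \<open>\<eta> > 0\<close> by (intro mult_left_mono) auto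
  finally show "a \<le> 0 + \<eta>"
    using assms(2) by simp
qed

section \<open>The Hahn--Banach theorem\<close>

interpretation complex_vector: vector_space "scaleC :: complex \<Rightarrow> 'a \<Rightarrow> 'a::complex_vector"
  by unfold_locales (simp_all add: scaleC_add_right scaleC_add_left scaleC_scaleC scaleC_one)

abbreviation csubspace :: "'a::complex_vector set \<Rightarrow> bool" where
  "csubspace \<equiv> module.subspace scaleC"

definition sublinear_on :: "'a::complex_vector set \<Rightarrow> ('a \<Rightarrow> real) \<Rightarrow> bool" where
  "sublinear_on V q \<longleftrightarrow>
     (\<forall>x\<in>V. \<forall>y\<in>V. q (x + y) \<le> q x + q y) \<and>
     (\<forall>r>0. \<forall>x\<in>V. q (complex_of_real r *\<^sub>C x) = r * q x)"

text \<open>A pair \<open>(k, r)\<close> in the cone stands for the demand that a functional be at least \<open>r\<close> at \<open>k\<close>.\<close>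

definition cone_over :: "'a::complex_vector set \<Rightarrow> ('a \<times> real) set \<Rightarrow> bool" where
  "cone_over V K \<longleftrightarrow>
     K \<subseteq> V \<times> UNIV \<and> (0, 0) \<in> K \<and>
     (\<forall>k r l s. (k, r) \<in> K \<longrightarrow> (l, s) \<in> K \<longrightarrow> (k + l, r + s) \<in> K) \<and>
     (\<forall>t>0. \<forall>k r. (k, r) \<in> K \<longrightarrow> (complex_of_real t *\<^sub>C k, t * r) \<in> K)"

lemma sublinear_onD:
  assumes "sublinear_on V q"
  shows "x \<in> V \<Longrightarrow> y \<in> V \<Longrightarrow> q (x + y) \<le> q x + q y"
    and "r > 0 \<Longrightarrow> x \<in> V \<Longrightarrow> q (complex_of_real r *\<^sub>C x) = r * q x"
  using assms by (auto simp: sublinear_on_def)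

lemma sublinear_on_zero:
  assumes "csubspace V" "sublinear_on V q"
  shows "q 0 = 0"
  using sublinear_onD(2)[OF assms(2), of 2 0] complex_vector.subspace_0[OF assms(1)] by simp

lemma sublinear_on_lower:
  assumes "csubspace V" "sublinear_on V q" "x \<in> V"
  shows "- q (- x) \<le> q x"
  using sublinear_onD(1)[OF assms(2,3) complex_vector.subspace_neg[OF assms(1,3)]]
    sublinear_on_zero[OF assms(1,2)] by simp

text \<open>The functional \<open>m x = inf (q (x + k) - r)\<close> over \<open>(k, r)\<close> in the cone is sublinear; a linear
  functional below it satisfies all demands of the cone because of the last clause, the values at \<open>- k\<close>.\<close>

lemma sublinear_below_cone:
  assumes V: "csubspace V" and q: "sublinear_on V q" and K: "cone_over V K"
    and le: "\<And>k r. (k, r) \<in> K \<Longrightarrow> r \<le> q k"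
  shows "\<exists>m. sublinear_on V m \<and> (\<forall>x\<in>V. m x \<le> q x) \<and> (\<forall>(k, r)\<in>K. m (- k) \<le> - r)"
proof -
  define m where "m x = (INF kr\<in>K. q (x + fst kr) - snd kr)" for x
  note V_intros = complex_vector.subspace_add[OF V] complex_vector.subspace_scale[OF V]
    complex_vector.subspace_neg[OF V] complex_vector.subspace_0[OF V]
  have KV: "k \<in> V" if "(k, r) \<in> K" for k r
    using that K by (auto simp: cone_over_def)
  have K0: "(0, 0) \<in> K"
    using K by (auto simp: cone_over_def)
  have lower: "- q (- x) \<le> q (x + k) - r" if "x \<in> V" "(k, r) \<in> K" for x k r
  proof -
    have "q k \<le> q (x + k) + q (- x)"
      using sublinear_onD(1)[OF q, of "x + k" "- x"] that KV V_intros by simp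
    with le[OF that(2)] show ?thesis by simp
  qed
  have upper: "m x \<le> q (x + k) - r" if "x \<in> V" "(k, r) \<in> K" for x k r
    unfolding m_def
    by (rule cINF_lower2[OF _ that(2)]) (use lower[OF that(1)] in \<open>auto intro!: bdd_belowI2\<close>)
  have greatest: "C \<le> m x" if "\<And>k r. (k, r) \<in> K \<Longrightarrow> C \<le> q (x + k) - r" for C x
    unfolding m_def by (rule cINF_greatest) (use K0 that in auto)
  have "m (x + y) \<le> m x + m y" if "x \<in> V" "y \<in> V" for x y
  proof -
    have "m (x + y) - (q (y + l) - s) \<le> q (x + k) - r"
      if "(k, r) \<in> K" "(l, s) \<in> K" for k r l s
    proof -
      have "m (x + y) \<le> q ((x + y) + (k + l)) - (r + s)"
        using K that V_intros \<open>x \<in> V\<close> \<open>y \<in> V\<close> by (intro upper) (auto simp: cone_over_def)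
      also have "(x + y) + (k + l) = (x + k) + (y + l)"
        by simp
      also have "q \<dots> \<le> q (x + k) + q (y + l)"
        using KV that V_intros \<open>x \<in> V\<close> \<open>y \<in> V\<close> by (intro sublinear_onD(1)[OF q]) auto
      finally show ?thesis by simp
    qed
    then have "m (x + y) - (q (y + l) - s) \<le> m x" if "(l, s) \<in> K" for l s
      using that by (intro greatest) auto
    then have "m (x + y) - m x \<le> q (y + l) - s" if "(l, s) \<in> K" for l s
      using that by (smt (verit))
    then have "m (x + y) - m x \<le> m y"
      by (rule greatest)
    then show ?thesis by simp
  qed
  moreover have m_scale_le: "m (complex_of_real t *\<^sub>C x) \<le> t * m x" if "t > 0" "x \<in> V" for t x
  proof -
    have "m (complex_of_real t *\<^sub>C x) / t \<le> q (x + k) - r" if "(k, r) \<in> K" for k r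
    proof -
      have "m (complex_of_real t *\<^sub>C x) \<le> q (complex_of_real t *\<^sub>C x + complex_of_real t *\<^sub>C k) - t * r"
        using K that V_intros \<open>x \<in> V\<close> \<open>t > 0\<close> by (intro upper) (auto simp: cone_over_def)
      also have "\<dots> = t * (q (x + k) - r)"
        using sublinear_onD(2)[OF q \<open>t > 0\<close>, of "x + k"] KV that V_intros \<open>x \<in> V\<close>
        by (simp add: scaleC_add_right algebra_simps)
      finally show ?thesis
        using \<open>t > 0\<close> by (simp add: field_simps)
    qed
    then have "m (complex_of_real t *\<^sub>C x) / t \<le> m x"
      by (rule greatest)
    then show ?thesis
      using \<open>t > 0\<close> by (simp add: field_simps)
  qed
  moreover have "m (complex_of_real t *\<^sub>C x) = t * m x" if "t > 0" "x \<in> V" for t x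
  proof (rule antisym[OF m_scale_le[OF that]])
    have "m (complex_of_real (1 / t) *\<^sub>C complex_of_real t *\<^sub>C x) \<le> (1 / t) * m (complex_of_real t *\<^sub>C x)"
      using that V_intros by (intro m_scale_le) auto
    then show "t * m x \<le> m (complex_of_real t *\<^sub>C x)"
      using that by (simp add: scaleC_scaleC field_simps scaleC_one)
  qed
  ultimately have "sublinear_on V m"
    by (simp add: sublinear_on_def)
  moreover have "m x \<le> q x" if "x \<in> V" for x
    using upper[OF that K0] by simp
  moreover have "m (- k) \<le> - r" if "(k, r) \<in> K" for k r
    using upper[of "- k", OF _ that] V_intros KV[OF that] sublinear_on_zero[OF V q] by simp
  ultimately show ?thesis
    by (intro exI[of _ m]) auto
qed

text \<open>Zorn's lemma: the pointwise infimum of a chain is sublinear, and it is finite because a sublinear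
  \<open>m \<le> q\<close> satisfies \<open>m x \<ge> - m (- x) \<ge> - q (- x)\<close>. Cutting off outside \<open>V\<close> makes the pointwise order
  antisymmetric.\<close>

lemma exists_minimal_sublinear:
  assumes V: "csubspace V" and q: "sublinear_on V q"
  shows "\<exists>m. sublinear_on V m \<and> (\<forall>x\<in>V. m x \<le> q x) \<and>
           (\<forall>n. sublinear_on V n \<longrightarrow> (\<forall>x\<in>V. n x \<le> m x) \<longrightarrow> (\<forall>x\<in>V. n x = m x))"
proof -
  define S where "S = {m. sublinear_on V m \<and> (\<forall>x\<in>V. m x \<le> q x) \<and> (\<forall>x. x \<notin> V \<longrightarrow> m x = 0)}"
  define above :: "('a \<Rightarrow> real) \<Rightarrow> ('a \<Rightarrow> real) \<Rightarrow> bool" where "above m n \<longleftrightarrow> n \<le> m" for m n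
  define cut :: "('a \<Rightarrow> real) \<Rightarrow> 'a \<Rightarrow> real" where "cut m x = (if x \<in> V then m x else 0)" for m x
  note V_intros = complex_vector.subspace_add[OF V] complex_vector.subspace_scale[OF V]
    complex_vector.subspace_neg[OF V] complex_vector.subspace_0[OF V]
  have cut: "sublinear_on V (cut m)" if "sublinear_on V m" for m
    using that V_intros by (simp add: sublinear_on_def cut_def)
  have "cut q \<in> S"
    using cut[OF q] by (simp add: S_def) (simp add: cut_def)
  have "\<exists>m\<in>S. \<forall>n\<in>S. above m n \<longrightarrow> n = m"
  proof (rule predicate_Zorn)
    show "partial_order_on S (relation_of above S)"
      by (rule partial_order_on_relation_ofI) (auto simp: above_def)
    fix C assume "C \<in> Chains (relation_of above S)"
    then have CS: "C \<subseteq> S" and chain: "\<And>m n. m \<in> C \<Longrightarrow> n \<in> C \<Longrightarrow> m \<le> n \<or> n \<le> m"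
      by (auto simp: Chains_def relation_of_def above_def)
    show "\<exists>u\<in>S. \<forall>m\<in>C. above m u"
    proof (cases "C = {}")
      case True
      with \<open>cut q \<in> S\<close> show ?thesis by auto
    next
      case False
      define u where "u x = (INF m\<in>C. m x)" for x
      have lower: "- q (- x) \<le> m x" if "m \<in> C" "x \<in> V" for m x
      proof -
        have "m \<in> S"
          using that CS by auto
        then have "- m (- x) \<le> m x" and "m (- x) \<le> q (- x)"
          using sublinear_on_lower[OF V, of m x] that V_intros by (auto simp: S_def)
        then show ?thesis by simp
      qed
      have u_le: "u x \<le> m x" if "m \<in> C" "x \<in> V" for m x
        unfolding u_def
        by (rule cINF_lower[OF _ that(1)]) (use lower that in \<open>auto intro!: bdd_belowI2\<close>)
      have greatest: "c \<le> u x" if "\<And>m. m \<in> C \<Longrightarrow> c \<le> m x" for c x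
        unfolding u_def by (rule cINF_greatest) (use False that in auto)
      have u_out: "u x = 0" if "x \<notin> V" for x
      proof -
        have "m x = 0" if "m \<in> C" for m
          using that CS \<open>x \<notin> V\<close> by (auto simp: S_def)
        then have "u x = (INF m\<in>C. 0)"
          unfolding u_def by (intro INF_cong) auto
        then show ?thesis
          using False by simp
      qed
      have "u (x + y) \<le> u x + u y" if "x \<in> V" "y \<in> V" for x y
      proof -
        have "u (x + y) - n y \<le> m x" if "m \<in> C" "n \<in> C" for m n
        proof -
          obtain k where k: "k \<in> C" "k \<le> m" "k \<le> n"
            using chain[OF \<open>m \<in> C\<close> \<open>n \<in> C\<close>] \<open>m \<in> C\<close> \<open>n \<in> C\<close> by auto
          have "u (x + y) \<le> k (x + y)"
            using k(1) V_intros \<open>x \<in> V\<close> \<open>y \<in> V\<close> by (intro u_le) auto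
          also have "\<dots> \<le> k x + k y"
            using k(1) CS \<open>x \<in> V\<close> \<open>y \<in> V\<close> by (intro sublinear_onD(1)[of V]) (auto simp: S_def)
          also have "\<dots> \<le> m x + n y"
            using k by (intro add_mono) (auto simp: le_fun_def)
          finally show ?thesis by simp
        qed
        then have "u (x + y) - n y \<le> u x" if "n \<in> C" for n
          using that by (intro greatest) auto
        then have "u (x + y) - u x \<le> n y" if "n \<in> C" for n
          using that by (smt (verit))
        then have "u (x + y) - u x \<le> u y"
          by (rule greatest)
        then show ?thesis by simp
      qed
      moreover have "u (complex_of_real t *\<^sub>C x) = t * u x" if "t > 0" "x \<in> V" for t x
      proof -
        have scale: "m (complex_of_real t *\<^sub>C x) = t * m x" if "m \<in> C" for m
          using that CS \<open>t > 0\<close> \<open>x \<in> V\<close> by (intro sublinear_onD(2)[of V]) (auto simp: S_def)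
        show ?thesis
        proof (rule antisym)
          have "u (complex_of_real t *\<^sub>C x) / t \<le> m x" if "m \<in> C" for m
            using u_le[OF that, of "complex_of_real t *\<^sub>C x"] scale[OF that] V_intros
              \<open>t > 0\<close> \<open>x \<in> V\<close> by (simp add: field_simps)
          then have "u (complex_of_real t *\<^sub>C x) / t \<le> u x"
            by (rule greatest)
          then show "u (complex_of_real t *\<^sub>C x) \<le> t * u x"
            using that by (simp add: field_simps)
          have "t * u x \<le> m (complex_of_real t *\<^sub>C x)" if "m \<in> C" for m
            using u_le[OF that \<open>x \<in> V\<close>] scale[OF that] \<open>t > 0\<close> by simp
          then show "t * u x \<le> u (complex_of_real t *\<^sub>C x)"
            by (rule greatest)
        qed
      qed
      moreover have "u x \<le> q x" if "x \<in> V" for x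
      proof -
        obtain m where "m \<in> C"
          using False by blast
        then show ?thesis
          using u_le[of m x] that CS by (fastforce simp: S_def)
      qed
      ultimately have "u \<in> S"
        using u_out by (simp add: S_def sublinear_on_def)
      moreover have "above m u" if "m \<in> C" for m
      proof -
        have "m \<in> S"
          using that CS by auto
        then have "u x \<le> m x" for x
          using u_le[OF that, of x] u_out[of x] by (cases "x \<in> V") (auto simp: S_def)
        then show ?thesis
          by (simp add: above_def le_fun_def)
      qed
      ultimately show ?thesis by blast
    qed
  qed
  then obtain m where m: "m \<in> S" and min: "\<And>n. n \<in> S \<Longrightarrow> n \<le> m \<Longrightarrow> n = m"
    unfolding above_def by blast
  have "n x = m x" if n: "sublinear_on V n" "\<forall>x\<in>V. n x \<le> m x" and "x \<in> V" for n x
  proof -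
    have "cut n \<in> S"
      using cut[OF n(1)] n(2) m by (simp add: S_def) (fastforce simp: cut_def)
    moreover have "cut n \<le> m"
      using n(2) m by (auto simp: le_fun_def cut_def S_def)
    ultimately have "cut n = m"
      by (rule min)
    with \<open>x \<in> V\<close> show ?thesis
      by (auto simp: cut_def)
  qed
  with m show ?thesis
    by (intro exI[of _ m]) (auto simp: S_def)
qed

text \<open>A minimal sublinear functional \<open>m\<close> is additive: pushing it down along the ray
  \<open>{(t a, t m(a))}\<close> cannot change it, so \<open>m (x + a) \<ge> m x + m a\<close>.\<close>

theorem hahn_banach_sandwich:
  assumes V: "csubspace V" and q: "sublinear_on V q" and K: "cone_over V K"
    and le: "\<And>k r. (k, r) \<in> K \<Longrightarrow> r \<le> q k"
  shows "\<exists>F. (\<forall>x\<in>V. \<forall>y\<in>V. F (x + y) = F x + F y) \<and>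
             (\<forall>t. \<forall>x\<in>V. F (complex_of_real t *\<^sub>C x) = t * F x) \<and>
             (\<forall>x\<in>V. F x \<le> q x) \<and> (\<forall>(k, r)\<in>K. r \<le> F k)"
proof -
  note V_intros = complex_vector.subspace_add[OF V] complex_vector.subspace_scale[OF V]
    complex_vector.subspace_neg[OF V] complex_vector.subspace_0[OF V]
  obtain m0 where m0: "sublinear_on V m0" "\<forall>x\<in>V. m0 x \<le> q x" "\<forall>(k, r)\<in>K. m0 (- k) \<le> - r"
    using sublinear_below_cone[OF V q K le] by blast
  obtain m where m: "sublinear_on V m" and "\<forall>x\<in>V. m x \<le> m0 x"
    and min: "\<And>n. sublinear_on V n \<Longrightarrow> \<forall>x\<in>V. n x \<le> m x \<Longrightarrow> \<forall>x\<in>V. n x = m x"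
    using exists_minimal_sublinear[OF V m0(1)] by blast
  have add: "m (x + a) = m x + m a" if "x \<in> V" "a \<in> V" for x a
  proof -
    define R where "R = (\<lambda>t. (complex_of_real t *\<^sub>C a, t * m a)) ` {0..}"
    have "(complex_of_real t *\<^sub>C a, t * m a) \<in> R" if "t \<ge> 0" for t
      using that by (auto simp: R_def)
    note in_R = this
    have "cone_over V R"
      unfolding cone_over_def
    proof (intro conjI allI impI)
      show "R \<subseteq> V \<times> UNIV"
        using V_intros \<open>a \<in> V\<close> by (auto simp: R_def)
      show "(0, 0) \<in> R"
        using in_R[of 0] by simp
      show "(k + l, r + s) \<in> R" if "(k, r) \<in> R" "(l, s) \<in> R" for k r l s
      proof -
        from that obtain t u where "t \<ge> 0" "k = complex_of_real t *\<^sub>C a" "r = t * m a"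
          "u \<ge> 0" "l = complex_of_real u *\<^sub>C a" "s = u * m a"
          by (auto simp: R_def)
        then show ?thesis
          using in_R[of "t + u"] by (simp add: scaleC_add_left distrib_right)
      qed
      show "(complex_of_real t *\<^sub>C k, t * r) \<in> R" if "t > 0" "(k, r) \<in> R" for t k r
      proof -
        from that(2) obtain u where "u \<ge> 0" "k = complex_of_real u *\<^sub>C a" "r = u * m a"
          by (auto simp: R_def)
        then show ?thesis
          using in_R[of "t * u"] \<open>t > 0\<close> by (simp add: scaleC_scaleC mult.assoc)
      qed
    qed
    moreover have "r \<le> m k" if "(k, r) \<in> R" for k r
    proof -
      from that obtain t where t: "t \<ge> 0" "k = complex_of_real t *\<^sub>C a" "r = t * m a"
        by (auto simp: R_def)
      then show ?thesis
        using sublinear_onD(2)[OF m _ \<open>a \<in> V\<close>, of t] sublinear_on_zero[OF V m]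
        by (cases "t = 0") auto
    qed
    ultimately obtain n where n: "sublinear_on V n" "\<forall>x\<in>V. n x \<le> m x" "\<forall>(k, r)\<in>R. n (- k) \<le> - r"
      using sublinear_below_cone[OF V m, of R] by blast
    have "(a, m a) \<in> R"
      using in_R[of 1] by (simp add: scaleC_one)
    then have "n (- a) \<le> - m a"
      using n(3) by auto
    moreover have "n (- a) = m (- a)"
      using min[OF n(1,2)] V_intros(3)[OF \<open>a \<in> V\<close>] by blast
    ultimately have "m (- a) \<le> - m a"
      by simp
    then have "m x + m a \<le> m (x + a)"
      using sublinear_onD(1)[OF m, of "x + a" "- a"] V_intros that by simp
    with sublinear_onD(1)[OF m that] show ?thesis by simp
  qed
  have neg: "m (- x) = - m x" if "x \<in> V" for x
    using add[OF that, of "- x"] V_intros that sublinear_on_zero[OF V m] by simp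
  have "m (complex_of_real t *\<^sub>C x) = t * m x" if "x \<in> V" for t x
  proof (cases t "0 :: real" rule: linorder_cases)
    case less
    then have "m (complex_of_real (- t) *\<^sub>C x) = - t * m x"
      using that by (intro sublinear_onD(2)[OF m]) auto
    moreover have "m (- (complex_of_real t *\<^sub>C x)) = - m (complex_of_real t *\<^sub>C x)"
      using that by (intro neg V_intros(2))
    ultimately show ?thesis
      by simp
  next
    case equal
    then show ?thesis
      using sublinear_on_zero[OF V m] by simp
  next
    case greater
    then show ?thesis
      using that by (intro sublinear_onD(2)[OF m])
  qed
  moreover have "m x \<le> q x" if "x \<in> V" for x
    using that m0(2) \<open>\<forall>x\<in>V. m x \<le> m0 x\<close> order_trans by blast
  moreover have "r \<le> m k" if "(k, r) \<in> K" for k r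
  proof -
    have "k \<in> V"
      using that K by (auto simp: cone_over_def)
    then have "m (- k) \<le> m0 (- k)" and "m (- k) = - m k"
      using \<open>\<forall>x\<in>V. m x \<le> m0 x\<close> neg V_intros(3) by blast+
    moreover have "m0 (- k) \<le> - r"
      using m0(3) that by auto
    ultimately show ?thesis
      by simp
  qed
  ultimately show ?thesis
    using add by (intro exI[of _ m]) auto
qed

section \<open>Seminorms and dual norms\<close>

definition seminormed :: "'a::complex_vector set \<Rightarrow> ('a \<Rightarrow> real) \<Rightarrow> bool" where
  "seminormed V N \<longleftrightarrow> csubspace V \<and> (\<forall>x\<in>V. \<forall>y\<in>V. N (x + y) \<le> N x + N y) \<and>
     (\<forall>c. \<forall>x\<in>V. N (c *\<^sub>C x) = cmod c * N x)"

lemma seminormedD: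
  assumes "seminormed V N"
  shows "csubspace V" "x \<in> V \<Longrightarrow> y \<in> V \<Longrightarrow> N (x + y) \<le> N x + N y"
    "x \<in> V \<Longrightarrow> N (c *\<^sub>C x) = cmod c * N x"
    "0 \<in> V" "x \<in> V \<Longrightarrow> y \<in> V \<Longrightarrow> x + y \<in> V" "x \<in> V \<Longrightarrow> c *\<^sub>C x \<in> V"
    "x \<in> V \<Longrightarrow> y \<in> V \<Longrightarrow> x - y \<in> V" "x \<in> V \<Longrightarrow> - x \<in> V"
  using assms complex_vector.subspace_0 complex_vector.subspace_add complex_vector.subspace_scale
    complex_vector.subspace_diff complex_vector.subspace_neg
  by (auto simp: seminormed_def)

lemma seminormed_zero: "seminormed V N \<Longrightarrow> N 0 = 0"
  using seminormedD(3)[of V N 0 0] seminormedD(4)[of V N] by simp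

lemma seminormed_neg: "seminormed V N \<Longrightarrow> x \<in> V \<Longrightarrow> N (- x) = N x"
  using seminormedD(3)[of V N x "- 1"] by (simp add: scaleC_one)

lemma seminormed_nonneg: "seminormed V N \<Longrightarrow> x \<in> V \<Longrightarrow> 0 \<le> N x"
  using seminormedD(2)[of V N x "- x"] seminormedD(8)[of V N x]
  by (simp add: seminormed_neg seminormed_zero)

lemma seminormed_norm: "csubspace V \<Longrightarrow> seminormed V (norm :: 'a::complex_normed_vector \<Rightarrow> real)"
  by (simp add: seminormed_def norm_scaleC norm_triangle_ineq)

lemma scaleC_complex [simp]: "c *\<^sub>C (x :: complex) = c * x"
  by (simp add: scaleC_complex_def)

lemma scaleC_fun_apply [simp]: "(c *\<^sub>C f) x = c *\<^sub>C f x"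
  by (simp add: scaleC_fun_def)

lemma clinear_onD:
  assumes "clinear_on V f"
  shows "x \<in> V \<Longrightarrow> y \<in> V \<Longrightarrow> f (x + y) = f x + f y"
    and "x \<in> V \<Longrightarrow> f (c *\<^sub>C x) = c *\<^sub>C f x"
  using assms by (auto simp: clinear_on_def)

lemma clinear_on_zero: "csubspace V \<Longrightarrow> clinear_on V f \<Longrightarrow> f 0 = 0"
  using clinear_onD(2)[of V f 0 0] complex_vector.subspace_0[of V] by simp

lemma clinear_on_diff:
  assumes "csubspace V" "clinear_on V f" "x \<in> V" "y \<in> V"
  shows "f (x - y) = f x - f y"
proof -
  have "f (x + (- 1) *\<^sub>C y) = f x + (- 1) *\<^sub>C f y"
    using assms complex_vector.subspace_scale[OF assms(1) assms(4)]
    by (simp only: clinear_onD)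
  then show ?thesis
    by (simp add: scaleC_one)
qed

lemma exists_unimodular: "\<exists>u. cmod u = 1 \<and> u * z = complex_of_real (cmod z)"
proof (cases "z = 0")
  case True
  then show ?thesis by (intro exI[of _ 1]) simp
next
  case False
  then show ?thesis
    using complex_norm_square[of z]
    by (intro exI[of _ "cnj z / complex_of_real (cmod z)"])
       (auto simp: norm_divide power2_eq_square mult.commute divide_simps)
qed

text \<open>Multiplying the argument by a complex number of modulus 1 rotates the value onto the
  positive real axis.\<close>

lemma norm_le_of_Re_le:
  assumes lin: "clinear_on V f" and N: "seminormed V N" and Re: "\<And>x. x \<in> V \<Longrightarrow> Re (f x) \<le> N x"
    and "x \<in> V"
  shows "cmod (f x) \<le> N x"
proof -
  obtain u where u: "cmod u = 1" "u * f x = complex_of_real (cmod (f x))"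
    using exists_unimodular by blast
  have "cmod (f x) = Re (f (u *\<^sub>C x))"
    using clinear_onD(2)[OF lin \<open>x \<in> V\<close>, of u] u by simp
  also have "\<dots> \<le> N (u *\<^sub>C x)"
    using seminormedD(6)[OF N \<open>x \<in> V\<close>] by (rule Re)
  also have "\<dots> = N x"
    using seminormedD(3)[OF N \<open>x \<in> V\<close>] u by simp
  finally show ?thesis .
qed

text \<open>The complex functional with real part \<open>F\<close> is \<open>F x - \<i> F (\<i> x)\<close>.\<close>

theorem hahn_banach_complex:
  assumes N: "seminormed V N" and K: "cone_over V K" and le: "\<And>k r. (k, r) \<in> K \<Longrightarrow> r \<le> N k"
  shows "\<exists>G. clinear_on V G \<and> (\<forall>x\<in>V. cmod (G x) \<le> N x) \<and> (\<forall>(k, r)\<in>K. r \<le> Re (G k))"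
proof -
  note V = seminormedD(1)[OF N]
  have "sublinear_on V N"
    using seminormedD(2,3)[OF N] by (simp add: sublinear_on_def)
  then obtain F where add: "\<And>x y. x \<in> V \<Longrightarrow> y \<in> V \<Longrightarrow> F (x + y) = F x + F y"
    and scale: "\<And>t x. x \<in> V \<Longrightarrow> F (complex_of_real t *\<^sub>C x) = t * F x"
    and FN: "\<And>x. x \<in> V \<Longrightarrow> F x \<le> N x" and FK: "\<forall>(k, r)\<in>K. r \<le> F k"
    using hahn_banach_sandwich[OF V _ K, of N] le by blast
  define G where "G x = Complex (F x) (- F (\<i> *\<^sub>C x))" for x
  have "clinear_on V G"
    unfolding clinear_on_def
  proof (intro conjI ballI allI)
    show "G (x + y) = G x + G y" if "x \<in> V" "y \<in> V" for x y
      using that seminormedD(6)[OF N] by (simp add: G_def add scaleC_add_right complex_eq_iff)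
    show "G (c *\<^sub>C x) = c *\<^sub>C G x" if "x \<in> V" for c x
    proof -
      have decomp: "d *\<^sub>C x = complex_of_real (Re d) *\<^sub>C x + complex_of_real (Im d) *\<^sub>C \<i> *\<^sub>C x" for d
        by (simp add: scaleC_scaleC flip: scaleC_add_left) (simp add: complex_eq_iff)
      have F: "F (d *\<^sub>C x) = Re d * F x + Im d * F (\<i> *\<^sub>C x)" for d
        by (subst decomp[of d]) (use that seminormedD(6)[OF N] in \<open>simp only: add scale\<close>)
      have "F (\<i> *\<^sub>C c *\<^sub>C x) = - Im c * F x + Re c * F (\<i> *\<^sub>C x)"
        using F[of "\<i> * c"] by (simp only: scaleC_scaleC) simp
      then show ?thesis
        using F[of c] by (simp add: G_def complex_eq_iff)
    qed
  qed
  moreover have "cmod (G x) \<le> N x" if "x \<in> V" for x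
    by (rule norm_le_of_Re_le[OF calculation N _ that]) (simp add: G_def FN)
  ultimately show ?thesis
    using FK by (intro exI[of _ G]) (simp add: G_def)
qed

text \<open>Elements of a dual vanish outside the subspace, so a functional given by a formula has to be cut off.\<close>

definition cutoff :: "'a set \<Rightarrow> ('a \<Rightarrow> complex) \<Rightarrow> 'a \<Rightarrow> complex" where
  "cutoff V f = (\<lambda>x. if x \<in> V then f x else 0)"

lemma cutoff_apply: "x \<in> V \<Longrightarrow> cutoff V f x = f x"
  by (simp add: cutoff_def)

lemma dual_spaceI:
  assumes "clinear_on V f" and "\<And>x. x \<in> V \<Longrightarrow> cmod (f x) \<le> K * N x"
    and "\<And>x. x \<notin> V \<Longrightarrow> f x = 0"
  shows "f \<in> dual_space V N"
  using assms by (auto simp: dual_space_def)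

lemma cutoff_in_dual_space:
  assumes "seminormed V N" and "clinear_on V f" and "\<And>x. x \<in> V \<Longrightarrow> cmod (f x) \<le> K * N x"
  shows "cutoff V f \<in> dual_space V N"
proof (rule dual_spaceI[of _ _ K])
  show "clinear_on V (cutoff V f)"
    using assms(2) seminormedD(5,6)[OF assms(1)] by (simp add: clinear_on_def cutoff_def)
qed (use assms(3) in \<open>auto simp: cutoff_def\<close>)

lemma dual_space_linear:
  assumes "f \<in> dual_space V N"
  shows "clinear_on V f" "x \<in> V \<Longrightarrow> y \<in> V \<Longrightarrow> f (x + y) = f x + f y"
    "x \<in> V \<Longrightarrow> f (c *\<^sub>C x) = c * f x"
  using assms by (auto simp: dual_space_def clinear_on_def)

lemma dual_space_diff:
  "seminormed V N \<Longrightarrow> f \<in> dual_space V N \<Longrightarrow> x \<in> V \<Longrightarrow> y \<in> V \<Longrightarrow> f (x - y) = f x - f y"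
  by (rule clinear_on_diff[of V]) (auto simp: dual_space_def seminormedD(1))

lemma dual_space_zero: "seminormed V N \<Longrightarrow> f \<in> dual_space V N \<Longrightarrow> f 0 = 0"
  by (rule clinear_on_zero[of V]) (auto simp: dual_space_def seminormedD(1))

lemma dual_space_outside: "f \<in> dual_space V N \<Longrightarrow> x \<notin> V \<Longrightarrow> f x = 0"
  by (simp add: dual_space_def)

lemma dual_space_eqI:
  assumes "f \<in> dual_space V N" "g \<in> dual_space V N" "\<And>x. x \<in> V \<Longrightarrow> f x = g x"
  shows "f = g"
proof
  show "f x = g x" for x
    using assms(3) dual_space_outside[OF assms(1)] dual_space_outside[OF assms(2)]
    by (cases "x \<in> V") auto
qed

lemma dual_norm_le:
  assumes "seminormed V N" and "0 \<le> C" and "\<And>x. x \<in> V \<Longrightarrow> cmod (f x) \<le> C * N x"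
  shows "dual_norm V N f \<le> C"
  unfolding dual_norm_def
proof (rule cSUP_least)
  show "{x \<in> V. N x \<le> 1} \<noteq> {}"
    using seminormedD(4)[OF assms(1)] seminormed_zero[OF assms(1)] by force
  show "cmod (f x) \<le> C" if "x \<in> {x \<in> V. N x \<le> 1}" for x
    using that assms(3)[of x] mult_left_le[of "N x" C] assms(2) by auto
qed

lemma le_dual_norm:
  assumes N: "seminormed V N" and f: "f \<in> dual_space V N" and "x \<in> V"
  shows "cmod (f x) \<le> dual_norm V N f * N x"
proof -
  obtain K where K: "\<And>x. x \<in> V \<Longrightarrow> cmod (f x) \<le> K * N x"
    using f by (auto simp: dual_space_def)
  have bdd: "bdd_above ((\<lambda>x. cmod (f x)) ` {x \<in> V. N x \<le> 1})"
  proof (rule bdd_aboveI2)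
    show "cmod (f x) \<le> \<bar>K\<bar>" if "x \<in> {x \<in> V. N x \<le> 1}" for x
    proof -
      have "K * N x \<le> \<bar>K\<bar> * N x"
        using seminormed_nonneg[OF N] that by (intro mult_right_mono) auto
      also have "\<dots> \<le> \<bar>K\<bar>"
        using that by (auto intro: mult_left_le)
      finally show ?thesis
        using K[of x] that by simp
    qed
  qed
  show ?thesis
  proof (cases "N x = 0")
    case True
    then show ?thesis
      using K[OF \<open>x \<in> V\<close>] by simp
  next
    case False
    then have pos: "N x > 0"
      using seminormed_nonneg[OF N \<open>x \<in> V\<close>] by simp
    let ?y = "complex_of_real (1 / N x) *\<^sub>C x"
    have "N ?y = 1"
      using seminormedD(3)[OF N \<open>x \<in> V\<close>, of "complex_of_real (1 / N x)"] pos
      by (simp add: norm_divide)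
    then have le: "cmod (f ?y) \<le> dual_norm V N f"
      unfolding dual_norm_def using seminormedD(6)[OF N \<open>x \<in> V\<close>]
      by (intro cSUP_upper[OF _ bdd]) auto
    have "f ?y = complex_of_real (1 / N x) * f x"
      using f \<open>x \<in> V\<close> by (rule dual_space_linear(3))
    then have "cmod (f ?y) = cmod (f x) / N x"
      using pos by (simp only: norm_mult) (simp add: norm_divide)
    with le have "cmod (f x) / N x \<le> dual_norm V N f"
      by simp
    then show ?thesis
      using pos by (simp add: pos_divide_le_eq)
  qed
qed

lemma dual_norm_nonneg:
  assumes N: "seminormed V N" and f: "f \<in> dual_space V N"
  shows "0 \<le> dual_norm V N f"
proof (cases "\<exists>x\<in>V. N x > 0")
  case True
  then obtain x where "x \<in> V" "N x > 0" by blast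
  then have "0 \<le> dual_norm V N f * N x"
    using le_dual_norm[OF assms \<open>x \<in> V\<close>] norm_ge_zero[of "f x"] by linarith
  then show ?thesis
    using \<open>N x > 0\<close> by (simp add: zero_le_mult_iff)
next
  case False
  then have "N x = 0" if "x \<in> V" for x
    using seminormed_nonneg[OF N that] that by force
  then have "f x = 0" if "x \<in> V" for x
    using le_dual_norm[OF assms that] that by simp
  then have "dual_norm V N f = (SUP x\<in>{x \<in> V. N x \<le> 1}. 0)"
    unfolding dual_norm_def by (intro SUP_cong) auto
  moreover have "{x \<in> V. N x \<le> 1} \<noteq> {}"
    using seminormedD(4)[OF N] seminormed_zero[OF N] by force
  ultimately show ?thesis by simp
qed

lemma dual_norm_bound:
  "seminormed V N \<Longrightarrow> f \<in> dual_space V N \<Longrightarrow> dual_norm V N f \<le> C \<Longrightarrow> x \<in> V \<Longrightarrow> cmod (f x) \<le> C * N x"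
  using le_dual_norm[of V N f x] seminormed_nonneg[of V N x] by (meson mult_right_mono order_trans)

lemma dual_norm_le_unit_ball:
  assumes "seminormed V N" and "\<And>x. x \<in> V \<Longrightarrow> N x \<le> 1 \<Longrightarrow> cmod (f x) \<le> C"
  shows "dual_norm V N f \<le> C"
  unfolding dual_norm_def
proof (rule cSUP_least)
  show "{x \<in> V. N x \<le> 1} \<noteq> {}"
    using seminormedD(4)[OF assms(1)] seminormed_zero[OF assms(1)] by force
qed (use assms(2) in auto)

text \<open>The dual form of the maximum norm on pairs: rotating \<open>x\<close> and \<open>y\<close> separately makes both values
  nonnegative, and the suprema over \<open>x\<close> and \<open>y\<close> are then taken one after the other.\<close>

lemma dual_norm_add_le:
  assumes N: "seminormed V N" and f: "clinear_on V f" and g: "clinear_on V g"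
    and le: "\<And>x y. x \<in> V \<Longrightarrow> N x \<le> 1 \<Longrightarrow> y \<in> V \<Longrightarrow> N y \<le> 1 \<Longrightarrow> cmod (f x + g y) \<le> C"
  shows "dual_norm V N f + dual_norm V N g \<le> C"
proof -
  have "cmod (f x) + cmod (g y) \<le> C" if x: "x \<in> V" "N x \<le> 1" and y: "y \<in> V" "N y \<le> 1" for x y
  proof -
    obtain u v where u: "cmod u = 1" "u * f x = complex_of_real (cmod (f x))"
      and v: "cmod v = 1" "v * g y = complex_of_real (cmod (g y))"
      using exists_unimodular by metis
    have "cmod (f (u *\<^sub>C x) + g (v *\<^sub>C y)) \<le> C"
      using x y u v seminormedD(3,6)[OF N] by (intro le) auto
    moreover have "f (u *\<^sub>C x) + g (v *\<^sub>C y) = complex_of_real (cmod (f x) + cmod (g y))"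
      using clinear_onD(2)[OF f x(1), of u] clinear_onD(2)[OF g y(1), of v] u v by simp
    ultimately have "\<bar>cmod (f x) + cmod (g y)\<bar> \<le> C"
      by (simp only: norm_of_real)
    then show ?thesis by linarith
  qed
  then have "dual_norm V N g \<le> C - cmod (f x)" if "x \<in> V" "N x \<le> 1" for x
    using that by (intro dual_norm_le_unit_ball[OF N]) (simp add: le_diff_eq add.commute)
  then have "dual_norm V N f \<le> C - dual_norm V N g"
    by (intro dual_norm_le_unit_ball[OF N]) (simp add: le_diff_eq add.commute)
  then show ?thesis by simp
qed

text \<open>The source of membership in duals and biduals: all translates of functionals, all module actions, the
  Arens products and the inclusion of biduals are transposes of bounded linear maps.\<close>

lemma transpose_in_dual:
  assumes N: "seminormed U N" and M: "seminormed V M" and f: "f \<in> dual_space V M"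
    and T: "clinear_on U T" "\<And>x. x \<in> U \<Longrightarrow> T x \<in> V" "\<And>x. x \<in> U \<Longrightarrow> M (T x) \<le> C * N x" and "0 \<le> C"
  shows "cutoff U (\<lambda>x. f (T x)) \<in> dual_space U N"
    and "dual_norm U N (cutoff U (\<lambda>x. f (T x))) \<le> dual_norm V M f * C"
proof -
  note pos = dual_norm_nonneg[OF M f]
  have le: "cmod (f (T x)) \<le> (dual_norm V M f * C) * N x" if "x \<in> U" for x
    using order_trans[OF le_dual_norm[OF M f T(2)[OF that]] mult_left_mono[OF T(3)[OF that] pos]]
    by (simp add: mult.assoc)
  have "clinear_on U (\<lambda>x. f (T x))"
    using clinear_onD[OF T(1)] T(2) by (simp add: clinear_on_def dual_space_linear[OF f])
  then show "cutoff U (\<lambda>x. f (T x)) \<in> dual_space U N"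
    by (rule cutoff_in_dual_space[OF N _ le])
  show "dual_norm U N (cutoff U (\<lambda>x. f (T x))) \<le> dual_norm V M f * C"
    by (rule dual_norm_le[OF N]) (use le pos \<open>0 \<le> C\<close> in \<open>auto simp: cutoff_def\<close>)
qed

lemma csubspace_dual_space:
  assumes N: "seminormed V N"
  shows "csubspace (dual_space V N)"
proof (rule complex_vector.subspaceI)
  show "0 \<in> dual_space V N"
    using seminormed_nonneg[OF N] by (intro dual_spaceI[of _ _ 0]) (auto simp: clinear_on_def)
  fix f g assume fg: "f \<in> dual_space V N" "g \<in> dual_space V N"
  show "f + g \<in> dual_space V N"
  proof (rule dual_spaceI[of _ _ "dual_norm V N f + dual_norm V N g"])
    show "cmod ((f + g) x) \<le> (dual_norm V N f + dual_norm V N g) * N x" if "x \<in> V" for x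
      using le_dual_norm[OF N fg(1) that] le_dual_norm[OF N fg(2) that]
        norm_triangle_ineq[of "f x" "g x"] by (simp add: distrib_right)
  qed (use fg in \<open>auto simp: clinear_on_def dual_space_def distrib_left\<close>)
next
  fix c f assume f: "f \<in> dual_space V N"
  show "c *\<^sub>C f \<in> dual_space V N"
  proof (rule dual_spaceI[of _ _ "cmod c * dual_norm V N f"])
    show "cmod ((c *\<^sub>C f) x) \<le> cmod c * dual_norm V N f * N x" if "x \<in> V" for x
      using mult_left_mono[OF le_dual_norm[OF N f that], of "cmod c"]
      by (simp add: norm_mult mult.assoc)
  qed (use f in \<open>auto simp: clinear_on_def dual_space_def distrib_left\<close>)
qed

lemma seminormed_dual:
  assumes N: "seminormed V N"
  shows "seminormed (dual_space V N) (dual_norm V N)"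
  unfolding seminormed_def
proof (intro conjI ballI allI)
  show sub: "csubspace (dual_space V N)"
    by (rule csubspace_dual_space[OF N])
  show "dual_norm V N (f + g) \<le> dual_norm V N f + dual_norm V N g"
    if "f \<in> dual_space V N" "g \<in> dual_space V N" for f g
  proof (rule dual_norm_le[OF N])
    show "cmod ((f + g) x) \<le> (dual_norm V N f + dual_norm V N g) * N x" if "x \<in> V" for x
      using le_dual_norm[OF N \<open>f \<in> _\<close> that] le_dual_norm[OF N \<open>g \<in> _\<close> that]
        norm_triangle_ineq[of "f x" "g x"] by (simp add: distrib_right)
  qed (use that dual_norm_nonneg[OF N] in auto)
  have le: "dual_norm V N (c *\<^sub>C f) \<le> cmod c * dual_norm V N f" if "f \<in> dual_space V N" for c f
  proof (rule dual_norm_le[OF N])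
    show "cmod ((c *\<^sub>C f) x) \<le> cmod c * dual_norm V N f * N x" if "x \<in> V" for x
      using mult_left_mono[OF le_dual_norm[OF N \<open>f \<in> _\<close> that], of "cmod c"]
      by (simp add: norm_mult mult.assoc)
  qed (use that dual_norm_nonneg[OF N] in auto)
  show "dual_norm V N (c *\<^sub>C f) = cmod c * dual_norm V N f" if f: "f \<in> dual_space V N" for c f
  proof (rule antisym[OF le[OF f]])
    show "cmod c * dual_norm V N f \<le> dual_norm V N (c *\<^sub>C f)"
    proof (cases "c = 0")
      case True
      then show ?thesis
        using dual_norm_nonneg[OF N complex_vector.subspace_scale[OF sub f], of 0] by simp
    next
      case False
      then have "dual_norm V N f \<le> cmod (inverse c) * dual_norm V N (c *\<^sub>C f)"
        using le[of "c *\<^sub>C f" "inverse c"] complex_vector.subspace_scale[OF sub f]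
        by (simp add: scaleC_scaleC scaleC_one)
      then show ?thesis
        using False by (simp add: norm_divide norm_inverse field_simps)
    qed
  qed
qed

theorem hahn_banach_extension:
  assumes N: "seminormed V N" and M: "csubspace M" "M \<subseteq> V" and lin: "clinear_on M f"
    and bound: "\<And>x. x \<in> M \<Longrightarrow> cmod (f x) \<le> C * N x" and "C \<ge> 0"
  shows "\<exists>G\<in>dual_space V N. (\<forall>x\<in>M. G x = f x) \<and> (\<forall>x\<in>V. cmod (G x) \<le> C * N x)"
proof -
  define K where "K = (\<lambda>m. (m, Re (f m))) ` M"
  have N': "seminormed V (\<lambda>x. C * N x)"
    unfolding seminormed_def
  proof (intro conjI ballI allI)
    show "C * N (x + y) \<le> C * N x + C * N y" if "x \<in> V" "y \<in> V" for x y
      using mult_left_mono[OF seminormedD(2)[OF N that] \<open>C \<ge> 0\<close>] by (simp add: distrib_left)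
  qed (use seminormedD(1,3)[OF N] in auto)
  have "cone_over V K"
    using M lin complex_vector.subspace_0[OF M(1)] complex_vector.subspace_add[OF M(1)]
      complex_vector.subspace_scale[OF M(1)] clinear_on_zero[OF M(1) lin]
    by (auto simp: cone_over_def K_def clinear_on_def image_iff)
  moreover have "r \<le> C * N k" if "(k, r) \<in> K" for k r
    using that bound complex_Re_le_cmod order_trans by (fastforce simp: K_def)
  ultimately obtain G where G: "clinear_on V G" "\<And>x. x \<in> V \<Longrightarrow> cmod (G x) \<le> C * N x"
    "\<forall>(k, r)\<in>K. r \<le> Re (G k)"
    using hahn_banach_complex[OF N', of K] by blast
  have le: "Re (f m) \<le> Re (G m)" if "m \<in> M" for m
    using G(3) that by (auto simp: K_def)
  \<comment> \<open>The real part of \<open>G - f\<close> is nonnegative on a complex subspace, so \<open>G - f\<close> vanishes there.\<close>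
  have "G m = f m" if "m \<in> M" for m
  proof -
    have "Re (c * f m) \<le> Re (c * G m)" for c
      using le[of "c *\<^sub>C m"] complex_vector.subspace_scale[OF M(1) that, of c] that M(2)
        clinear_onD(2)[OF lin that, of c] clinear_onD(2)[OF G(1), of m c] by auto
    from this[of 1] this[of "- 1"] this[of \<i>] this[of "- \<i>"] show ?thesis
      by (simp add: complex_eq_iff)
  qed
  then show ?thesis
    using cutoff_in_dual_space[OF N G(1,2)] G(2) M(2)
    by (intro bexI[of _ "cutoff V G"]) (auto simp: cutoff_def)
qed

text \<open>The demands are \<open>Re (G (s + t x0)) \<ge> t d\<close> for \<open>s \<in> S\<close> and \<open>t \<ge> 0\<close>; they are admissible since
  \<open>N (s + t x0) = t N (x0 + s / t)\<close> for \<open>t > 0\<close>. The case \<open>t = 0\<close> makes \<open>G\<close> vanish on \<open>S\<close>.\<close>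

theorem hahn_banach_separation:
  assumes N: "seminormed V N" and S: "csubspace S" "S \<subseteq> V" and x0: "x0 \<in> V" and "d > 0"
    and dist: "\<And>s. s \<in> S \<Longrightarrow> d \<le> N (x0 - s)"
  shows "\<exists>G\<in>dual_space V N. (\<forall>s\<in>S. G s = 0) \<and> G x0 \<noteq> 0"
proof -
  define K where "K = {(s + complex_of_real t *\<^sub>C x0, t * d) | s t. s \<in> S \<and> t \<ge> 0}"
  note S_intros = complex_vector.subspace_0[OF S(1)] complex_vector.subspace_add[OF S(1)]
    complex_vector.subspace_scale[OF S(1)]
  have in_K: "(s + complex_of_real t *\<^sub>C x0, t * d) \<in> K" if "s \<in> S" "t \<ge> 0" for s t
    using that by (auto simp: K_def)
  have "cone_over V K"
    unfolding cone_over_def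
  proof (intro conjI allI impI)
    show "K \<subseteq> V \<times> UNIV"
      using S(2) x0 seminormedD(5,6)[OF N] by (auto simp: K_def)
    show "(0, 0) \<in> K"
      using in_K[of 0 0] S_intros by simp
    show "(k + l, r + s) \<in> K" if "(k, r) \<in> K" "(l, s) \<in> K" for k r l s
    proof -
      from that obtain a t b u where "k = a + complex_of_real t *\<^sub>C x0" "r = t * d" "a \<in> S" "t \<ge> 0"
        and "l = b + complex_of_real u *\<^sub>C x0" "s = u * d" "b \<in> S" "u \<ge> 0"
        by (auto simp: K_def)
      then show ?thesis
        using in_K[of "a + b" "t + u"] S_intros by (simp add: scaleC_add_left algebra_simps)
    qed
    show "(complex_of_real c *\<^sub>C k, c * r) \<in> K" if "c > 0" "(k, r) \<in> K" for c k r
    proof -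
      from that obtain a t where "k = a + complex_of_real t *\<^sub>C x0" "r = t * d" "a \<in> S" "t \<ge> 0"
        by (auto simp: K_def)
      then show ?thesis
        using in_K[of "complex_of_real c *\<^sub>C a" "c * t"] S_intros \<open>c > 0\<close>
        by (simp add: scaleC_add_right scaleC_scaleC mult.assoc)
    qed
  qed
  moreover have "r \<le> N k" if "(k, r) \<in> K" for k r
  proof -
    from that obtain s t where st: "k = s + complex_of_real t *\<^sub>C x0" "r = t * d" "s \<in> S" "t \<ge> 0"
      by (auto simp: K_def)
    show ?thesis
    proof (cases "t = 0")
      case True
      then show ?thesis
        using st S(2) seminormed_nonneg[OF N] by auto
    next
      case False
      define m where "m = complex_of_real (- 1 / t) *\<^sub>C s"
      have m: "m \<in> S"
        unfolding m_def using st(3) by (rule S_intros(3))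
      have "complex_of_real t * complex_of_real (- 1 / t) = - 1"
        using False by simp
      then have "complex_of_real t *\<^sub>C m = - s"
        unfolding m_def scaleC_scaleC by (simp add: scaleC_one)
      then have "complex_of_real t *\<^sub>C (x0 - m) = k"
        using st(1) by (simp add: complex_vector.scale_right_diff_distrib)
      moreover have "x0 - m \<in> V"
        using m S(2) x0 seminormedD(7)[OF N] by auto
      ultimately have "N k = t * N (x0 - m)"
        using seminormedD(3)[OF N, of "x0 - m" "complex_of_real t"] st(4) by simp
      moreover have "d \<le> N (x0 - m)"
        using m by (rule dist)
      ultimately show ?thesis
        using st(2,4) by (simp add: mult_left_mono)
    qed
  qed
  ultimately obtain G where G: "clinear_on V G" "\<And>x. x \<in> V \<Longrightarrow> cmod (G x) \<le> 1 * N x"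
    and GK: "\<forall>(k, r)\<in>K. r \<le> Re (G k)"
    using hahn_banach_complex[OF N, of K] by auto
  have "G s = 0" if "s \<in> S" for s
  proof -
    have "0 \<le> Re (c * G s)" for c
    proof -
      have "(c *\<^sub>C s, 0) \<in> K"
        using in_K[of "c *\<^sub>C s" 0] S_intros(3)[OF that] by simp
      then have "0 \<le> Re (G (c *\<^sub>C s))"
        using GK by auto
      moreover have "G (c *\<^sub>C s) = c * G s"
        using clinear_onD(2)[OF G(1), of s c] that S(2) by auto
      ultimately show ?thesis
        by (simp only:)
    qed
    from this[of 1] this[of "- 1"] this[of \<i>] this[of "- \<i>"] show ?thesis
      by (simp add: complex_eq_iff)
  qed
  moreover have "d \<le> Re (G x0)"
    using GK in_K[of 0 1] S_intros by (auto simp: scaleC_one)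
  then have "G x0 \<noteq> 0"
    using \<open>d > 0\<close> by auto
  ultimately show ?thesis
    using cutoff_in_dual_space[OF N G] S(2) x0 by (intro bexI[of _ "cutoff V G"]) (auto simp: cutoff_def)
qed

section \<open>Positive sesquilinear forms\<close>

locale semi_inner_form =
  fixes V :: "'a::complex_vector set" and B :: "'a \<Rightarrow> 'a \<Rightarrow> complex"
  assumes subspace: "csubspace V"
    and left_add: "x \<in> V \<Longrightarrow> y \<in> V \<Longrightarrow> z \<in> V \<Longrightarrow> B (x + y) z = B x z + B y z"
    and left_scale: "x \<in> V \<Longrightarrow> z \<in> V \<Longrightarrow> B (c *\<^sub>C x) z = c * B x z"
    and right_add: "x \<in> V \<Longrightarrow> y \<in> V \<Longrightarrow> z \<in> V \<Longrightarrow> B z (x + y) = B z x + B z y"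
    and right_scale: "x \<in> V \<Longrightarrow> z \<in> V \<Longrightarrow> B z (c *\<^sub>C x) = cnj c * B z x"
    and nonneg: "x \<in> V \<Longrightarrow> B x x \<in> \<real>\<^sub>\<ge>\<^sub>0"
begin

lemmas V_intros = complex_vector.subspace_add[OF subspace] complex_vector.subspace_scale[OF subspace]

definition len :: "'a \<Rightarrow> real" where
  "len x = sqrt (Re (B x x))"

lemma form_self: "x \<in> V \<Longrightarrow> B x x = complex_of_real ((len x)\<^sup>2)"
  using nonneg[of x] by (auto simp: len_def nonneg_Reals_def complex_eq_iff)

lemma len_nonneg: "x \<in> V \<Longrightarrow> 0 \<le> len x"
  using nonneg[of x] by (auto simp: len_def nonneg_Reals_def)

lemma form_expand:
  assumes "u \<in> V" "y \<in> V"
  shows "B (u + c *\<^sub>C y) (u + c *\<^sub>C y) =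
           B u u + (c * B y u + cnj c * B u y) + complex_of_real ((cmod c)\<^sup>2) * B y y"
  using assms V_intros complex_norm_square[of c]
  by (simp add: left_add left_scale right_add right_scale algebra_simps)

lemma form_commute:
  assumes "u \<in> V" "y \<in> V"
  shows "B u y = cnj (B y u)"
proof -
  have Im0: "Im (B x x) = 0" if "x \<in> V" for x
    using form_self[OF that] by simp
  have "Im (c * B y u + cnj c * B u y) = 0" for c
    using arg_cong[OF form_expand[OF assms, of c], of Im] Im0 assms V_intros by simp
  from this[of 1] this[of \<i>] show ?thesis
    by (simp add: complex_eq_iff)
qed

lemma len_expand:
  assumes "u \<in> V" "y \<in> V"
  shows "(len (u + c *\<^sub>C y))\<^sup>2 = (len u)\<^sup>2 + 2 * Re (c * B y u) + (cmod c)\<^sup>2 * (len y)\<^sup>2"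
proof -
  have "cnj c * B u y = cnj (c * B y u)"
    using form_commute[OF assms] by simp
  then have "c * B y u + cnj c * B u y = complex_of_real (2 * Re (c * B y u))"
    using complex_add_cnj by metis
  then show ?thesis
    using arg_cong[OF form_expand[OF assms, of c], of Re] assms V_intros
    by (simp add: form_self)
qed

lemma cauchy_schwarz:
  assumes "x \<in> V" "y \<in> V"
  shows "cmod (B x y) \<le> len x * len y"
proof -
  obtain w where w: "cmod w = 1" "w * B x y = complex_of_real (cmod (B x y))"
    using exists_unimodular by blast
  have "2 * r * cmod (B x y) \<le> r\<^sup>2 * (len x)\<^sup>2 + (len y)\<^sup>2" if "r \<ge> 0" for r
  proof -
    let ?c = "- complex_of_real r * w"
    have "?c * B x y = complex_of_real (- r * cmod (B x y))"
      using w(2) by (simp add: mult.assoc)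
    then have Re: "Re (?c * B x y) = - r * cmod (B x y)"
      by (simp only: Re_complex_of_real)
    have c: "cmod ?c = r"
      using w(1) that by (simp add: norm_mult)
    have "0 \<le> (len (y + ?c *\<^sub>C x))\<^sup>2"
      by simp
    then show ?thesis
      unfolding len_expand[OF assms(2,1)] Re c by simp
  qed
  then have "(cmod (B x y))\<^sup>2 \<le> (len y)\<^sup>2 * (len x)\<^sup>2"
    by (intro quadratic_bound) auto
  then have "(cmod (B x y))\<^sup>2 \<le> (len x * len y)\<^sup>2"
    by (simp add: power_mult_distrib mult.commute)
  then show ?thesis
    by (rule power2_le_imp_le) (simp add: len_nonneg assms)
qed

text \<open>Without completeness, the Riesz representation theorem holds up to an arbitrarily small
  error: if \<open>f\<close> minimises \<open>(len f)\<^sup>2 - 2 Re (g f)\<close> up to \<open>\<epsilon>\<^sup>2\<close>, then perturbing \<open>f\<close> in the direction \<open>x\<close>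
  shows that \<open>g x\<close> and \<open>B x f\<close> differ by at most \<open>\<epsilon> len x\<close>.\<close>

lemma riesz_approx:
  assumes g: "clinear_on V g" and bound: "\<And>x. x \<in> V \<Longrightarrow> cmod (g x) \<le> C * len x" and "\<epsilon> > 0"
  shows "\<exists>f\<in>V. \<forall>x\<in>V. cmod (g x - B x f) \<le> \<epsilon> * len x"
proof -
  define J where "J f = (len f)\<^sup>2 - 2 * Re (g f)" for f
  have J_lower: "- C\<^sup>2 \<le> J f" if "f \<in> V" for f
  proof -
    have "Re (g f) \<le> C * len f"
      using bound[OF that] complex_Re_le_cmod order_trans by blast
    moreover have "0 \<le> (len f)\<^sup>2 - 2 * (C * len f) + C\<^sup>2"
      using zero_le_power2[of "len f - C"] by (simp add: power2_diff mult_ac)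
    ultimately show ?thesis
      unfolding J_def by linarith
  qed
  have V0: "V \<noteq> {}"
    using complex_vector.subspace_0[OF subspace] by auto
  have bdd: "bdd_below (J ` V)"
    using J_lower by (rule bdd_belowI2)
  have "\<exists>f\<in>V. J f < Inf (J ` V) + \<epsilon>\<^sup>2"
    using cINF_less_iff[OF V0 bdd, of "Inf (J ` V) + \<epsilon>\<^sup>2"] \<open>\<epsilon> > 0\<close> by simp
  then obtain f where f: "f \<in> V" "J f < Inf (J ` V) + \<epsilon>\<^sup>2"
    by blast
  have min: "J f \<le> J y + \<epsilon>\<^sup>2" if "y \<in> V" for y
    using f(2) cINF_lower[OF bdd that] by simp
  have "cmod (g x - B x f) \<le> \<epsilon> * len x" if "x \<in> V" for x
  proof -
    let ?d = "g x - B x f"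
    obtain w where w: "cmod w = 1" "w * ?d = complex_of_real (cmod ?d)"
      using exists_unimodular by blast
    have "2 * r * cmod ?d \<le> r\<^sup>2 * (len x)\<^sup>2 + \<epsilon>\<^sup>2" if "r \<ge> 0" for r
    proof -
      let ?c = "complex_of_real r * w"
      have "?c * ?d = complex_of_real (r * cmod ?d)"
        using w(2) by (simp add: mult.assoc)
      then have "Re (?c * g x - ?c * B x f) = r * cmod ?d"
        by (simp only: right_diff_distrib[symmetric] Re_complex_of_real)
      then have Re: "Re (?c * g x) - Re (?c * B x f) = r * cmod ?d"
        by (simp only: minus_complex.sel)
      have c: "cmod ?c = r"
        using w(1) that by (simp add: norm_mult)
      have "g (f + ?c *\<^sub>C x) = g f + ?c * g x"
        using clinear_onD[OF g] f(1) \<open>x \<in> V\<close> V_intros by simp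
      then have "Re (g (f + ?c *\<^sub>C x)) = Re (g f) + Re (?c * g x)"
        by (simp only: plus_complex.sel)
      moreover have "J f \<le> J (f + ?c *\<^sub>C x) + \<epsilon>\<^sup>2"
        using f(1) \<open>x \<in> V\<close> V_intros by (intro min) auto
      ultimately show ?thesis
        using Re unfolding J_def len_expand[OF f(1) \<open>x \<in> V\<close>] c by linarith
    qed
    then have "(cmod ?d)\<^sup>2 \<le> \<epsilon>\<^sup>2 * (len x)\<^sup>2"
      by (intro quadratic_bound) auto
    then have "(cmod ?d)\<^sup>2 \<le> (\<epsilon> * len x)\<^sup>2"
      by (simp add: power_mult_distrib)
    then show ?thesis
      by (rule power2_le_imp_le) (use len_nonneg[OF \<open>x \<in> V\<close>] \<open>\<epsilon> > 0\<close> in simp)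
  qed
  with f(1) show ?thesis by blast
qed

text \<open>The case of equality in the Riesz representation: comparing \<open>\<bar>g (u + c y)\<bar>\<^sup>2\<close> with its bound
  \<open>(len u)\<^sup>2 (len (u + c y))\<^sup>2\<close>, the constant terms agree, so the terms linear in \<open>c\<close> have to agree too.\<close>

lemma eq_form_of_attains:
  assumes g: "clinear_on V g" and "u \<in> V" and bound: "\<And>y. y \<in> V \<Longrightarrow> cmod (g y) \<le> len u * len y"
    and attains: "g u = B u u" and "y \<in> V"
  shows "g y = B y u"
proof (cases "len u = 0")
  case True
  then have "g y = 0" "B y u = 0"
    using bound[OF \<open>y \<in> V\<close>] cauchy_schwarz[OF \<open>y \<in> V\<close> \<open>u \<in> V\<close>] by simp_all
  then show ?thesis by simp
next
  case False
  let ?b = "(len u)\<^sup>2" and ?d = "g y - B y u"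
  obtain w where w: "cmod w = 1" "w * ?d = complex_of_real (cmod ?d)"
    using exists_unimodular by blast
  have "2 * r * (?b * cmod ?d) \<le> r\<^sup>2 * (?b * (len y)\<^sup>2) + 0" if "r \<ge> 0" for r
  proof -
    let ?c = "complex_of_real r * w"
    let ?v = "u + ?c *\<^sub>C y"
    have v: "?v \<in> V"
      using \<open>u \<in> V\<close> \<open>y \<in> V\<close> V_intros by simp
    define p q where "p = Re (?c * g y)" and "q = Re (?c * B y u)"
    have c: "cmod ?c = r"
      using w(1) that by (simp add: norm_mult)
    have "?c * ?d = complex_of_real (r * cmod ?d)"
      using w(2) by (simp add: mult.assoc)
    then have "Re (?c * g y - ?c * B y u) = r * cmod ?d"
      by (simp only: right_diff_distrib[symmetric] Re_complex_of_real)
    then have p: "p = q + r * cmod ?d"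
      by (simp only: minus_complex.sel p_def q_def)
    have "g ?v = complex_of_real ?b + ?c * g y"
      using clinear_onD[OF g] \<open>u \<in> V\<close> \<open>y \<in> V\<close> V_intros attains by (simp add: form_self)
    then have Re: "Re (g ?v) = ?b + p"
      by (simp only: plus_complex.sel p_def Re_complex_of_real)
    have "?b\<^sup>2 + 2 * ?b * p \<le> (?b + p)\<^sup>2"
      by (simp add: power2_sum)
    also have "\<dots> \<le> (cmod (g ?v))\<^sup>2"
      unfolding cmod_power2 Re by simp
    also have "(cmod (g ?v))\<^sup>2 \<le> (len u * len ?v)\<^sup>2"
      by (rule power_mono[OF bound[OF v]]) simp
    also have "(len u * len ?v)\<^sup>2 = ?b\<^sup>2 + 2 * ?b * q + ?b * (r\<^sup>2 * (len y)\<^sup>2)"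
      unfolding power_mult_distrib len_expand[OF \<open>u \<in> V\<close> \<open>y \<in> V\<close>] c q_def[symmetric]
      by (simp add: algebra_simps power2_eq_square)
    finally show ?thesis
      unfolding p by (simp add: algebra_simps)
  qed
  then have "(?b * cmod ?d)\<^sup>2 \<le> 0 * (?b * (len y)\<^sup>2)"
    by (rule quadratic_bound) auto
  then show ?thesis
    using False by simp
qed

end

locale bounded_form = semi_inner_form +
  fixes N :: "'a::complex_vector \<Rightarrow> real" and K :: real
  assumes form_seminormed: "seminormed V N" and K_nonneg: "0 \<le> K"
    and len_le: "x \<in> V \<Longrightarrow> len x \<le> K * N x"
begin

lemma dual_of_len_bound:
  assumes "clinear_on V h" and "\<And>x. x \<in> V \<Longrightarrow> cmod (h x) \<le> c * len x" and "c \<ge> 0"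
  shows "cutoff V h \<in> dual_space V N" and "dual_norm V N (cutoff V h) \<le> c * K"
proof -
  have *: "cmod (h x) \<le> (c * K) * N x" if "x \<in> V" for x
    using assms(2)[OF that] mult_left_mono[OF len_le[OF that] \<open>c \<ge> 0\<close>] by (simp add: mult.assoc)
  show "cutoff V h \<in> dual_space V N"
    by (rule cutoff_in_dual_space[OF form_seminormed assms(1) *])
  show "dual_norm V N (cutoff V h) \<le> c * K"
    by (rule dual_norm_le[OF form_seminormed]) (use * K_nonneg \<open>c \<ge> 0\<close> in \<open>auto simp: cutoff_def\<close>)
qed

definition rep :: "'a \<Rightarrow> 'a \<Rightarrow> complex" where
  "rep y = cutoff V (\<lambda>x. B x y)"

lemma rep_linear: "y \<in> V \<Longrightarrow> clinear_on V (\<lambda>x. B x y)"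
  by (simp add: clinear_on_def left_add left_scale)

lemma rep_dual:
  assumes "y \<in> V"
  shows "rep y \<in> dual_space V N" and "dual_norm V N (rep y) \<le> len y * K"
  using dual_of_len_bound[OF rep_linear[OF assms], of "len y"] cauchy_schwarz[OF _ assms]
    len_nonneg[OF assms] by (auto simp: rep_def mult.commute)

lemma rep_add: "x \<in> V \<Longrightarrow> y \<in> V \<Longrightarrow> rep (x + y) = rep x + rep y"
  by (auto simp: rep_def cutoff_def right_add fun_eq_iff)

lemma rep_scale: "x \<in> V \<Longrightarrow> rep (c *\<^sub>C x) = cnj c *\<^sub>C rep x"
  by (auto simp: rep_def cutoff_def right_scale fun_eq_iff)

lemma bidual_of_rep:
  assumes \<Lambda>: "\<Lambda> \<in> dual_space (dual_space V N) (dual_norm V N)"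
  defines "M \<equiv> dual_norm (dual_space V N) (dual_norm V N) \<Lambda>"
  shows "clinear_on V (\<lambda>y. cnj (\<Lambda> (rep y)))"
    and "y \<in> V \<Longrightarrow> cmod (cnj (\<Lambda> (rep y))) \<le> (M * K) * len y"
proof -
  note N' = seminormed_dual[OF form_seminormed]
  show "clinear_on V (\<lambda>y. cnj (\<Lambda> (rep y)))"
    using dual_space_linear(2,3)[OF \<Lambda>] rep_dual(1)
    by (simp add: clinear_on_def rep_add rep_scale)
  show "cmod (cnj (\<Lambda> (rep y))) \<le> (M * K) * len y" if "y \<in> V"
  proof -
    have "cmod (\<Lambda> (rep y)) \<le> M * dual_norm V N (rep y)"
      unfolding M_def by (rule le_dual_norm[OF N' \<Lambda> rep_dual(1)[OF that]])
    also have "\<dots> \<le> M * (len y * K)"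
      using rep_dual(2)[OF that] dual_norm_nonneg[OF N' \<Lambda>]
      by (intro mult_left_mono) (auto simp: M_def)
    finally show ?thesis
      by (simp add: mult_ac)
  qed
qed

text \<open>In the Hilbert space completion, \<open>\<Lambda>\<close> acts on the functionals bounded by the form as a vector,
  and \<open>f\<close> is an approximation of that vector. Concretely, \<open>f\<close> almost represents the conjugate of
  \<open>y \<mapsto> \<Lambda> (rep y)\<close>, and \<open>h\<close> is almost of the form \<open>rep v\<close>, so both \<open>\<Lambda> h\<close> and \<open>h f\<close> are close to \<open>B f v\<close>.
  The choice of \<open>f\<close> does not depend on \<open>h\<close>.\<close>

lemma bidual_approx:
  assumes \<Lambda>: "\<Lambda> \<in> dual_space (dual_space V N) (dual_norm V N)" and "\<epsilon> > 0"
  shows "\<exists>f\<in>V. \<forall>h\<in>dual_space V N. \<forall>c\<ge>0. (\<forall>x\<in>V. cmod (h x) \<le> c * len x) \<longrightarrow>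
           cmod (\<Lambda> h - h f) \<le> \<epsilon> * c"
proof -
  note N' = seminormed_dual[OF form_seminormed]
  define M where "M = dual_norm (dual_space V N) (dual_norm V N) \<Lambda>"
  have "M \<ge> 0"
    unfolding M_def by (rule dual_norm_nonneg[OF N' \<Lambda>])
  obtain f where f: "f \<in> V" "\<And>y. y \<in> V \<Longrightarrow> cmod (cnj (\<Lambda> (rep y)) - B y f) \<le> \<epsilon> * len y"
    using riesz_approx[OF bidual_of_rep[OF \<Lambda>] \<open>\<epsilon> > 0\<close>] by blast
  have "cmod (\<Lambda> h - h f) \<le> \<epsilon> * c"
    if h: "h \<in> dual_space V N" "c \<ge> 0" "\<forall>x\<in>V. cmod (h x) \<le> c * len x" for h c
  proof (rule field_le_epsilon)
    fix \<eta> :: real assume "\<eta> > 0"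
    define \<delta> where "\<delta> = \<eta> / (M * K + \<epsilon> + len f + 1)"
    have den: "0 < M * K + \<epsilon> + len f + 1"
      using \<open>M \<ge> 0\<close> K_nonneg \<open>\<epsilon> > 0\<close> len_nonneg[OF f(1)] by (intro add_nonneg_pos add_nonneg_nonneg) auto
    have "\<delta> > 0"
      using den \<open>\<eta> > 0\<close> by (simp add: \<delta>_def)
    obtain v where v: "v \<in> V" "\<And>x. x \<in> V \<Longrightarrow> cmod (h x - B x v) \<le> \<delta> * len x"
      using riesz_approx[OF dual_space_linear(1)[OF h(1)] _ \<open>\<delta> > 0\<close>] h(3) by blast
    have len_v: "len v \<le> c + \<delta>"
    proof (cases "len v = 0")
      case False
      have "(len v)\<^sup>2 = cmod (B v v)"
        using form_self[OF v(1)] by (simp add: norm_power)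
      also have "\<dots> \<le> cmod (h v) + cmod (h v - B v v)"
        using norm_triangle_ineq4[of "h v" "h v - B v v"] by simp
      also have "\<dots> \<le> c * len v + \<delta> * len v"
        using v h(3) by (intro add_mono) auto
      finally have "len v * len v \<le> (c + \<delta>) * len v"
        by (simp add: power2_eq_square distrib_right)
      with False len_nonneg[OF v(1)] show ?thesis by simp
    qed (use \<open>c \<ge> 0\<close> \<open>\<delta> > 0\<close> in simp)
    have "cmod (\<Lambda> (h - rep v)) \<le> M * dual_norm V N (h - rep v)"
      unfolding M_def using h(1) rep_dual(1)[OF v(1)]
      by (intro le_dual_norm[OF N' \<Lambda>] seminormedD(7)[OF N'])
    also have "\<dots> \<le> M * (\<delta> * K)"
    proof (rule mult_left_mono[OF dual_norm_le[OF form_seminormed] \<open>M \<ge> 0\<close>])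
      show "cmod ((h - rep v) x) \<le> \<delta> * K * N x" if "x \<in> V" for x
        using order_trans[OF v(2)[OF \<open>x \<in> V\<close>] mult_left_mono[OF len_le[OF \<open>x \<in> V\<close>], of \<delta>]]
          \<open>\<delta> > 0\<close> \<open>x \<in> V\<close> by (simp add: rep_def cutoff_def mult.assoc)
    qed (use \<open>\<delta> > 0\<close> K_nonneg in simp)
    finally have 1: "cmod (\<Lambda> h - \<Lambda> (rep v)) \<le> M * (\<delta> * K)"
      using dual_space_diff[OF N' \<Lambda> h(1) rep_dual(1)[OF v(1)]] by simp
    have 2: "cmod (\<Lambda> (rep v) - B f v) \<le> \<epsilon> * (c + \<delta>)"
    proof -
      have "cmod (\<Lambda> (rep v) - B f v) = cmod (cnj (\<Lambda> (rep v)) - B v f)"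
        unfolding form_commute[OF f(1) v(1)] by (metis complex_cnj_cnj complex_cnj_diff complex_mod_cnj)
      also have "\<dots> \<le> \<epsilon> * len v"
        by (rule f(2)[OF v(1)])
      also have "\<dots> \<le> \<epsilon> * (c + \<delta>)"
        using len_v \<open>\<epsilon> > 0\<close> by simp
      finally show ?thesis .
    qed
    have 3: "cmod (h f - B f v) \<le> \<delta> * len f"
      by (rule v(2)[OF f(1)])
    have split: "\<Lambda> h - h f = (\<Lambda> h - \<Lambda> (rep v)) + (\<Lambda> (rep v) - B f v) - (h f - B f v)"
      by simp
    have "cmod (\<Lambda> h - h f) \<le> M * (\<delta> * K) + \<epsilon> * (c + \<delta>) + \<delta> * len f"
      unfolding split
      using 1 2 3 norm_triangle_ineq4[of "(\<Lambda> h - \<Lambda> (rep v)) + (\<Lambda> (rep v) - B f v)" "h f - B f v"]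
        norm_triangle_ineq[of "\<Lambda> h - \<Lambda> (rep v)" "\<Lambda> (rep v) - B f v"] by linarith
    also have "\<dots> = \<epsilon> * c + \<delta> * (M * K + \<epsilon> + len f)"
      by (simp add: algebra_simps)
    also have "\<dots> \<le> \<epsilon> * c + \<delta> * (M * K + \<epsilon> + len f + 1)"
      using \<open>\<delta> > 0\<close> by simp
    also have "\<dots> = \<epsilon> * c + \<eta>"
      using den by (simp add: \<delta>_def)
    finally show "cmod (\<Lambda> h - h f) \<le> \<epsilon> * c + \<eta>" .
  qed
  with f(1) show ?thesis by blast
qed

text \<open>With \<open>f\<close> approximating \<open>\<Lambda>\<close> as in \<open>bidual_approx\<close>, the left side is close to \<open>\<bar>\<phi> f\<bar>\<^sup>2 \<le> (len f)\<^sup>2\<close>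
  and the right side is close to \<open>\<bar>B f f\<bar> = (len f)\<^sup>2\<close>.\<close>

lemma bidual_cauchy_schwarz:
  assumes \<Lambda>: "\<Lambda> \<in> dual_space (dual_space V N) (dual_norm V N)"
    and \<phi>: "\<phi> \<in> dual_space V N" "\<And>x. x \<in> V \<Longrightarrow> cmod (\<phi> x) \<le> len x"
  shows "(cmod (\<Lambda> \<phi>))\<^sup>2 \<le> cmod (\<Lambda> (cutoff V (\<lambda>y. cnj (\<Lambda> (rep y)))))"
proof -
  note N' = seminormed_dual[OF form_seminormed]
  define M where "M = dual_norm (dual_space V N) (dual_norm V N) \<Lambda> * K"
  define g where "g = (\<lambda>y. cnj (\<Lambda> (rep y)))"
  have "M \<ge> 0"
    unfolding M_def using dual_norm_nonneg[OF N' \<Lambda>] K_nonneg by simp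
  have g: "clinear_on V g" "\<And>y. y \<in> V \<Longrightarrow> cmod (g y) \<le> M * len y"
    using bidual_of_rep[OF \<Lambda>] by (auto simp: g_def M_def)
  have "(cmod (\<Lambda> \<phi>))\<^sup>2 \<le> cmod (\<Lambda> (cutoff V g)) + \<epsilon> * (4 * M + 4)" if "0 < \<epsilon>" "\<epsilon> \<le> 1" for \<epsilon>
  proof -
    obtain f where f: "f \<in> V" and approx: "\<And>h c. h \<in> dual_space V N \<Longrightarrow> c \<ge> 0 \<Longrightarrow>
        (\<And>x. x \<in> V \<Longrightarrow> cmod (h x) \<le> c * len x) \<Longrightarrow> cmod (\<Lambda> h - h f) \<le> \<epsilon> * c"
      using bidual_approx[OF \<Lambda> \<open>0 < \<epsilon>\<close>] by metis
    have 1: "cmod (\<Lambda> (cutoff V g) - g f) \<le> \<epsilon> * M"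
      using approx[OF dual_of_len_bound(1)[OF g \<open>M \<ge> 0\<close>] \<open>M \<ge> 0\<close>] g(2) f by (auto simp: cutoff_def)
    have "cmod (\<Lambda> (rep f) - rep f f) \<le> \<epsilon> * len f"
      using f cauchy_schwarz[OF _ f] len_nonneg[OF f]
      by (intro approx rep_dual) (auto simp: rep_def cutoff_def mult.commute)
    moreover have "g f - B f f = cnj (\<Lambda> (rep f) - rep f f)"
      using form_self[OF f] f by (simp add: g_def rep_def cutoff_def)
    ultimately have 2: "cmod (g f - B f f) \<le> \<epsilon> * len f"
      by (simp only: complex_mod_cnj)
    have sq: "(len f)\<^sup>2 = cmod (B f f)"
      using form_self[OF f] by (simp add: norm_power)
    have len_f: "len f \<le> M + 1"
    proof (cases "len f = 0")
      case False
      have "(len f)\<^sup>2 \<le> cmod (g f) + cmod (g f - B f f)"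
        unfolding sq using norm_triangle_ineq4[of "g f" "g f - B f f"] by simp
      also have "\<dots> \<le> M * len f + 1 * len f"
        using 2 g(2)[OF f] mult_right_mono[OF that(2) len_nonneg[OF f]] by linarith
      finally have "len f * len f \<le> (M + 1) * len f"
        by (simp add: power2_eq_square distrib_right)
      with False len_nonneg[OF f] show ?thesis by simp
    qed (use \<open>M \<ge> 0\<close> in simp)
    have "cmod (B f f) \<le> cmod (\<Lambda> (cutoff V g)) + cmod (\<Lambda> (cutoff V g) - g f) + cmod (g f - B f f)"
      using norm_triangle_ineq4[of "\<Lambda> (cutoff V g)" "\<Lambda> (cutoff V g) - B f f"]
        norm_triangle_ineq[of "\<Lambda> (cutoff V g) - g f" "g f - B f f"] by simp
    also have "\<dots> \<le> cmod (\<Lambda> (cutoff V g)) + \<epsilon> * M + \<epsilon> * (M + 1)"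
      using 1 2 mult_left_mono[OF len_f, of \<epsilon>] that by linarith
    finally have len_sq: "(len f)\<^sup>2 \<le> cmod (\<Lambda> (cutoff V g)) + \<epsilon> * M + \<epsilon> * (M + 1)"
      by (simp add: sq)
    have "cmod (\<Lambda> \<phi> - \<phi> f) \<le> \<epsilon> * 1"
      using \<phi> by (intro approx) auto
    then have "cmod (\<Lambda> \<phi>) \<le> len f + \<epsilon>"
      using \<phi>(2)[OF f] norm_triangle_ineq[of "\<phi> f" "\<Lambda> \<phi> - \<phi> f"] by simp
    then have "(cmod (\<Lambda> \<phi>))\<^sup>2 \<le> (len f + \<epsilon>)\<^sup>2"
      by (intro power_mono) auto
    also have "\<dots> = (len f)\<^sup>2 + \<epsilon> * (2 * len f + \<epsilon>)"
      by (simp add: power2_eq_square algebra_simps)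
    also have "\<dots> \<le> (len f)\<^sup>2 + \<epsilon> * (2 * (M + 1) + 1)"
      using len_f that by simp
    finally show ?thesis
      using len_sq by (simp add: algebra_simps)
  qed
  note eps = this
  show ?thesis
    unfolding g_def[symmetric]
  proof (rule field_le_epsilon)
    fix \<eta> :: real assume "\<eta> > 0"
    define \<epsilon> where "\<epsilon> = min 1 (\<eta> / (4 * M + 4))"
    have "0 < \<epsilon>" "\<epsilon> \<le> 1"
      using \<open>\<eta> > 0\<close> \<open>M \<ge> 0\<close> by (auto simp: \<epsilon>_def)
    have "\<epsilon> \<le> \<eta> / (4 * M + 4)"
      by (simp add: \<epsilon>_def)
    then have "\<epsilon> * (4 * M + 4) \<le> \<eta>"
      using \<open>M \<ge> 0\<close> by (simp add: pos_le_divide_eq)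
    with eps[OF \<open>0 < \<epsilon>\<close> \<open>\<epsilon> \<le> 1\<close>] show "(cmod (\<Lambda> \<phi>))\<^sup>2 \<le> cmod (\<Lambda> (cutoff V g)) + \<eta>"
      by simp
  qed
qed

text \<open>The case of equality for the functional conjugate to \<open>y \<mapsto> \<Lambda> (rep y)\<close>.\<close>

lemma bidual_rep_of_attains:
  assumes \<Lambda>: "\<Lambda> \<in> dual_space (dual_space V N) (dual_norm V N)" and "u \<in> V" "y \<in> V"
    and norm: "dual_norm (dual_space V N) (dual_norm V N) \<Lambda> * K \<le> len u"
    and attains: "\<Lambda> (rep u) = B u u"
  shows "\<Lambda> (rep y) = B u y"
proof -
  have "cnj (\<Lambda> (rep y)) = B y u"
  proof (rule eq_form_of_attains[OF bidual_of_rep(1)[OF \<Lambda>] \<open>u \<in> V\<close> _ _ \<open>y \<in> V\<close>])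
    show "cmod (cnj (\<Lambda> (rep y))) \<le> len u * len y" if "y \<in> V" for y
      using bidual_of_rep(2)[OF \<Lambda> that] mult_right_mono[OF norm len_nonneg[OF that]] by (rule order_trans)
    show "cnj (\<Lambda> (rep u)) = B u u"
      unfolding attains using form_self[OF \<open>u \<in> V\<close>] by simp
  qed
  then show ?thesis
    using form_commute[OF \<open>u \<in> V\<close> \<open>y \<in> V\<close>] by (metis complex_cnj_cnj)
qed

end

section \<open>The Arens product\<close>

lemma scaleC_compose_left: "(c *\<^sub>C S) o\<^sub>L T = c *\<^sub>C (S o\<^sub>L T)"
  by (rule blinfun_eqI) (simp add: scaleC_blinfun.rep_eq)

lemma scaleC_compose_right: "S \<in> bounded_operators \<Longrightarrow> S o\<^sub>L (c *\<^sub>C T) = c *\<^sub>C (S o\<^sub>L T)"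
  by (rule blinfun_eqI) (simp add: scaleC_blinfun.rep_eq bounded_operators_def clinear_on_def)

lemma compose_assoc: "(R o\<^sub>L S) o\<^sub>L T = R o\<^sub>L (S o\<^sub>L T)"
  and compose_id: "id_blinfun o\<^sub>L T = T" "T o\<^sub>L id_blinfun = T"
  by (rule blinfun_eqI; simp)+

lemmas compose_add_left = bounded_bilinear.add_left[OF bounded_bilinear_blinfun_compose]
  and compose_add_right = bounded_bilinear.add_right[OF bounded_bilinear_blinfun_compose]

abbreviation norm1 :: "'a::complex_normed_vector set \<Rightarrow> ('a \<Rightarrow> complex) \<Rightarrow> real" where
  "norm1 A \<equiv> dual_norm A norm"

abbreviation norm2 :: "'a::complex_normed_vector set \<Rightarrow> (('a \<Rightarrow> complex) \<Rightarrow> complex) \<Rightarrow> real" where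
  "norm2 A \<equiv> dual_norm (dual A) (dual_norm A norm)"

definition evaluation :: "'h::complex_hilbert op set \<Rightarrow> 'h op \<Rightarrow> (('h op \<Rightarrow> complex) \<Rightarrow> complex)" where
  "evaluation A a = cutoff (dual A) (\<lambda>\<phi>. \<phi> a)"

lemma bidual_unit_eq: "bidual_unit A = evaluation A id_blinfun"
  by (simp add: bidual_unit_def evaluation_def cutoff_def)

locale operator_algebra =
  fixes A :: "'h::complex_hilbert op set"
  assumes unital: "unital_subalgebra A bounded_operators"
begin

lemma bounded: "a \<in> A \<Longrightarrow> a \<in> bounded_operators"
  and cspace: "csubspace A"
  and mult_closed: "a \<in> A \<Longrightarrow> b \<in> A \<Longrightarrow> a o\<^sub>L b \<in> A"
  and id_in: "id_blinfun \<in> A"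
  using unital by (auto simp: unital_subalgebra_def)

lemma seminormed: "seminormed A norm"
  by (rule seminormed_norm[OF cspace])

lemma seminormed1: "seminormed (dual A) (norm1 A)"
  by (rule seminormed_dual[OF seminormed])

lemma seminormed2: "seminormed (bidual A) (norm2 A)"
  by (rule seminormed_dual[OF seminormed1])

lemmas A_intros = seminormedD(5-8)[OF seminormed] mult_closed id_in
lemmas dual_intros = seminormedD(5-8)[OF seminormed1]
lemmas bidual_intros = seminormedD(5-8)[OF seminormed2]

lemma dual_apply_bound: "\<phi> \<in> dual A \<Longrightarrow> a \<in> A \<Longrightarrow> cmod (\<phi> a) \<le> norm1 A \<phi> * norm a"
  by (rule le_dual_norm[OF seminormed])

lemma bidual_apply_bound: "\<Lambda> \<in> bidual A \<Longrightarrow> \<phi> \<in> dual A \<Longrightarrow> cmod (\<Lambda> \<phi>) \<le> norm2 A \<Lambda> * norm1 A \<phi>"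
  by (rule le_dual_norm[OF seminormed1])

lemmas dual_lin = dual_space_linear(2,3) dual_space_diff[OF seminormed]
lemmas bidual_lin = dual_space_linear(2,3)[where V = "dual A"] dual_space_diff[OF seminormed1]

lemma functional_mult_in_dual:
  assumes \<phi>: "\<phi> \<in> dual A" and a: "a \<in> A"
  shows "functional_mult A \<phi> a \<in> dual A" and "norm1 A (functional_mult A \<phi> a) \<le> norm1 A \<phi> * norm a"
proof -
  have "functional_mult A \<phi> a = cutoff A (\<lambda>b. \<phi> (a o\<^sub>L b))"
    by (simp add: functional_mult_def cutoff_def)
  moreover have "clinear_on A (\<lambda>b. a o\<^sub>L b)"
    by (simp add: clinear_on_def compose_add_right scaleC_compose_right[OF bounded[OF a]])
  ultimately show "functional_mult A \<phi> a \<in> dual A" "norm1 A (functional_mult A \<phi> a) \<le> norm1 A \<phi> * norm a"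
    using transpose_in_dual[OF seminormed seminormed \<phi>, of "\<lambda>b. a o\<^sub>L b" "norm a"]
    by (simp_all add: mult_closed a norm_blinfun_compose)
qed

lemma functional_mult_add_right:
  "\<phi> \<in> dual A \<Longrightarrow> a \<in> A \<Longrightarrow> b \<in> A \<Longrightarrow>
     functional_mult A \<phi> (a + b) = functional_mult A \<phi> a + functional_mult A \<phi> b"
  using A_intros by (simp add: fun_eq_iff functional_mult_def compose_add_left dual_lin)

lemma functional_mult_scale_right:
  "\<phi> \<in> dual A \<Longrightarrow> a \<in> A \<Longrightarrow> functional_mult A \<phi> (c *\<^sub>C a) = c *\<^sub>C functional_mult A \<phi> a"
  using A_intros by (simp add: fun_eq_iff functional_mult_def scaleC_compose_left dual_lin)

lemma functional_mult_add_left: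
  "functional_mult A (\<phi> + \<psi>) a = functional_mult A \<phi> a + functional_mult A \<psi> a"
  and functional_mult_scale_left: "functional_mult A (c *\<^sub>C \<phi>) a = c *\<^sub>C functional_mult A \<phi> a"
  by (auto simp: functional_mult_def fun_eq_iff)

lemma functional_mult_assoc:
  "b \<in> A \<Longrightarrow> functional_mult A (functional_mult A \<phi> a) b = functional_mult A \<phi> (a o\<^sub>L b)"
  using A_intros by (auto simp: functional_mult_def fun_eq_iff compose_assoc)

lemma functional_mult_id: "\<phi> \<in> dual A \<Longrightarrow> functional_mult A \<phi> id_blinfun = \<phi>"
  by (auto simp: functional_mult_def fun_eq_iff dual_space_outside compose_id)

lemma action_apply: "a \<in> A \<Longrightarrow> bidual_action A \<Lambda> \<phi> a = \<Lambda> (functional_mult A \<phi> a)"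
  by (simp add: bidual_action_def)

lemma action_in_dual:
  assumes \<Lambda>: "\<Lambda> \<in> bidual A" and \<phi>: "\<phi> \<in> dual A"
  shows "bidual_action A \<Lambda> \<phi> \<in> dual A" and "norm1 A (bidual_action A \<Lambda> \<phi>) \<le> norm2 A \<Lambda> * norm1 A \<phi>"
proof -
  have "bidual_action A \<Lambda> \<phi> = cutoff A (\<lambda>a. \<Lambda> (functional_mult A \<phi> a))"
    by (simp add: bidual_action_def cutoff_def)
  moreover have "clinear_on A (functional_mult A \<phi>)"
    by (simp add: clinear_on_def functional_mult_add_right[OF \<phi>] functional_mult_scale_right[OF \<phi>])
  ultimately show "bidual_action A \<Lambda> \<phi> \<in> dual A" "norm1 A (bidual_action A \<Lambda> \<phi>) \<le> norm2 A \<Lambda> * norm1 A \<phi>"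
    using transpose_in_dual[OF seminormed seminormed1 \<Lambda>, of "functional_mult A \<phi>" "norm1 A \<phi>"]
    by (simp_all add: functional_mult_in_dual[OF \<phi>] dual_norm_nonneg[OF seminormed \<phi>])
qed

lemma action_add:
  "\<Lambda> \<in> bidual A \<Longrightarrow> \<phi> \<in> dual A \<Longrightarrow> \<psi> \<in> dual A \<Longrightarrow>
     bidual_action A \<Lambda> (\<phi> + \<psi>) = bidual_action A \<Lambda> \<phi> + bidual_action A \<Lambda> \<psi>"
  by (auto simp: fun_eq_iff bidual_action_def functional_mult_add_left functional_mult_in_dual bidual_lin)

lemma action_scale:
  "\<Lambda> \<in> bidual A \<Longrightarrow> \<phi> \<in> dual A \<Longrightarrow> bidual_action A \<Lambda> (c *\<^sub>C \<phi>) = c *\<^sub>C bidual_action A \<Lambda> \<phi>"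
  by (auto simp: fun_eq_iff bidual_action_def functional_mult_scale_left functional_mult_in_dual bidual_lin)

lemma action_linear: "\<Lambda> \<in> bidual A \<Longrightarrow> clinear_on (dual A) (bidual_action A \<Lambda>)"
  by (simp add: clinear_on_def action_add action_scale)

lemma action_diff:
  "\<Lambda> \<in> bidual A \<Longrightarrow> \<phi> \<in> dual A \<Longrightarrow> \<psi> \<in> dual A \<Longrightarrow>
     bidual_action A \<Lambda> (\<phi> - \<psi>) = bidual_action A \<Lambda> \<phi> - bidual_action A \<Lambda> \<psi>"
  by (rule clinear_on_diff[OF seminormedD(1)[OF seminormed1] action_linear])

lemma action_add_left: "bidual_action A (\<Lambda> + \<Gamma>) \<phi> = bidual_action A \<Lambda> \<phi> + bidual_action A \<Gamma> \<phi>"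
  and action_diff_left: "bidual_action A (\<Lambda> - \<Gamma>) \<phi> = bidual_action A \<Lambda> \<phi> - bidual_action A \<Gamma> \<phi>"
  by (auto simp: fun_eq_iff bidual_action_def)

lemma functional_mult_action:
  assumes "a \<in> A"
  shows "functional_mult A (bidual_action A \<Lambda> \<phi>) a = bidual_action A \<Lambda> (functional_mult A \<phi> a)"
proof
  show "functional_mult A (bidual_action A \<Lambda> \<phi>) a b = bidual_action A \<Lambda> (functional_mult A \<phi> a) b" for b
  proof (cases "b \<in> A")
    case True
    then have "functional_mult A (bidual_action A \<Lambda> \<phi>) a b = bidual_action A \<Lambda> \<phi> (a o\<^sub>L b)"
      by (simp add: functional_mult_def)
    with True assms A_intros show ?thesis
      by (simp add: action_apply functional_mult_assoc)
  qed (simp add: functional_mult_def bidual_action_def)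
qed

lemma action_id: "\<phi> \<in> dual A \<Longrightarrow> bidual_action A \<Lambda> \<phi> id_blinfun = \<Lambda> \<phi>"
  by (simp add: action_apply id_in functional_mult_id)

lemma evaluation_in_bidual:
  assumes "a \<in> A"
  shows "evaluation A a \<in> bidual A" and "norm2 A (evaluation A a) \<le> norm a"
proof -
  have le: "cmod (\<phi> a) \<le> norm a * norm1 A \<phi>" if "\<phi> \<in> dual A" for \<phi>
    using dual_apply_bound[OF that assms] by (simp add: mult.commute)
  show "evaluation A a \<in> bidual A"
    unfolding evaluation_def
    by (rule cutoff_in_dual_space[OF seminormed1 _ le]) (auto simp: clinear_on_def)
  show "norm2 A (evaluation A a) \<le> norm a"
    by (rule dual_norm_le[OF seminormed1]) (use le in \<open>auto simp: evaluation_def cutoff_def\<close>)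
qed

lemma evaluation_apply: "\<phi> \<in> dual A \<Longrightarrow> evaluation A a \<phi> = \<phi> a"
  by (simp add: evaluation_def cutoff_def)

lemma arens_apply: "\<phi> \<in> dual A \<Longrightarrow> arens_mult A \<Lambda> \<Gamma> \<phi> = \<Lambda> (bidual_action A \<Gamma> \<phi>)"
  by (simp add: arens_mult_def)

lemma arens_in_bidual:
  assumes \<Lambda>: "\<Lambda> \<in> bidual A" and \<Gamma>: "\<Gamma> \<in> bidual A"
  shows "arens_mult A \<Lambda> \<Gamma> \<in> bidual A" and "norm2 A (arens_mult A \<Lambda> \<Gamma>) \<le> norm2 A \<Lambda> * norm2 A \<Gamma>"
proof -
  have "arens_mult A \<Lambda> \<Gamma> = cutoff (dual A) (\<lambda>\<phi>. \<Lambda> (bidual_action A \<Gamma> \<phi>))"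
    by (simp add: arens_mult_def cutoff_def)
  then show "arens_mult A \<Lambda> \<Gamma> \<in> bidual A" "norm2 A (arens_mult A \<Lambda> \<Gamma>) \<le> norm2 A \<Lambda> * norm2 A \<Gamma>"
    using transpose_in_dual[OF seminormed1 seminormed1 \<Lambda> action_linear[OF \<Gamma>], of "norm2 A \<Gamma>"]
    by (simp_all add: action_in_dual[OF \<Gamma>] dual_norm_nonneg[OF seminormed1 \<Gamma>])
qed

lemma action_arens:
  assumes "\<Gamma> \<in> bidual A" "\<phi> \<in> dual A"
  shows "bidual_action A (arens_mult A \<Lambda> \<Gamma>) \<phi> = bidual_action A \<Lambda> (bidual_action A \<Gamma> \<phi>)"
  using assms by (auto simp: fun_eq_iff bidual_action_def[of _ "arens_mult _ _ _"]
      bidual_action_def[of _ \<Lambda>] arens_apply functional_mult_in_dual functional_mult_action)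

lemma arens_assoc:
  assumes "\<Gamma> \<in> bidual A" "\<Delta> \<in> bidual A"
  shows "arens_mult A (arens_mult A \<Lambda> \<Gamma>) \<Delta> = arens_mult A \<Lambda> (arens_mult A \<Gamma> \<Delta>)"
proof
  show "arens_mult A (arens_mult A \<Lambda> \<Gamma>) \<Delta> \<phi> = arens_mult A \<Lambda> (arens_mult A \<Gamma> \<Delta>) \<phi>" for \<phi>
    using action_in_dual(1)[OF assms(2), of \<phi>] action_arens[OF assms(2), of \<phi> \<Gamma>]
    by (cases "\<phi> \<in> dual A") (simp_all add: arens_mult_def)
qed

lemma arens_add_left: "arens_mult A (\<Lambda> + \<Lambda>') \<Gamma> = arens_mult A \<Lambda> \<Gamma> + arens_mult A \<Lambda>' \<Gamma>"
  and arens_diff_left: "arens_mult A (\<Lambda> - \<Lambda>') \<Gamma> = arens_mult A \<Lambda> \<Gamma> - arens_mult A \<Lambda>' \<Gamma>"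
  by (auto simp: fun_eq_iff arens_mult_def)

lemma arens_add_right:
  assumes "\<Lambda> \<in> bidual A" "\<Gamma> \<in> bidual A" "\<Gamma>' \<in> bidual A"
  shows "arens_mult A \<Lambda> (\<Gamma> + \<Gamma>') = arens_mult A \<Lambda> \<Gamma> + arens_mult A \<Lambda> \<Gamma>'"
  using assms by (auto simp: fun_eq_iff arens_mult_def action_add_left bidual_lin action_in_dual)

lemma arens_diff_right:
  assumes "\<Lambda> \<in> bidual A" "\<Gamma> \<in> bidual A" "\<Gamma>' \<in> bidual A"
  shows "arens_mult A \<Lambda> (\<Gamma> - \<Gamma>') = arens_mult A \<Lambda> \<Gamma> - arens_mult A \<Lambda> \<Gamma>'"
  using assms by (auto simp: fun_eq_iff arens_mult_def action_diff_left bidual_lin action_in_dual)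

lemma action_unit: "\<phi> \<in> dual A \<Longrightarrow> bidual_action A (bidual_unit A) \<phi> = \<phi>"
proof -
  assume \<phi>: "\<phi> \<in> dual A"
  have "bidual_action A (bidual_unit A) \<phi> a = \<phi> a" for a
    using functional_mult_in_dual(1)[OF \<phi>, of a] id_in
    by (cases "a \<in> A") (auto simp: bidual_action_def bidual_unit_def functional_mult_def[of A \<phi> a]
        dual_space_outside[OF \<phi>] compose_id)
  then show ?thesis by auto
qed

lemma bidual_unit_in: "bidual_unit A \<in> bidual A"
  unfolding bidual_unit_eq by (rule evaluation_in_bidual(1)[OF id_in])

lemma arens_unit_left: "\<Lambda> \<in> bidual A \<Longrightarrow> arens_mult A (bidual_unit A) \<Lambda> = \<Lambda>"
  by (auto simp: fun_eq_iff arens_mult_def bidual_unit_def action_in_dual action_id dual_space_outside)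

lemma arens_unit_right: "\<Lambda> \<in> bidual A \<Longrightarrow> arens_mult A \<Lambda> (bidual_unit A) = \<Lambda>"
  by (auto simp: fun_eq_iff arens_mult_def action_unit dual_space_outside)

lemma evaluation_mult: "a \<in> A \<Longrightarrow> b \<in> A \<Longrightarrow> arens_mult A (evaluation A a) (evaluation A b) = evaluation A (a o\<^sub>L b)"
proof
  assume ab: "a \<in> A" "b \<in> A"
  show "arens_mult A (evaluation A a) (evaluation A b) \<phi> = evaluation A (a o\<^sub>L b) \<phi>" for \<phi>
    using functional_mult_in_dual(1)[of \<phi> a] action_in_dual(1)[OF evaluation_in_bidual(1)[OF ab(2)], of \<phi>] ab
    by (cases "\<phi> \<in> dual A")
       (simp_all add: arens_apply evaluation_apply action_apply, simp_all add: functional_mult_def arens_mult_def evaluation_def cutoff_def)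
qed

lemma evaluation_arens_apply:
  assumes "\<Lambda> \<in> bidual A" "\<phi> \<in> dual A" "a \<in> A"
  shows "arens_mult A (evaluation A a) \<Lambda> \<phi> = bidual_action A \<Lambda> \<phi> a"
  using assms by (simp add: arens_apply evaluation_apply action_in_dual)

end

section \<open>Adjoints\<close>

lemma semi_inner_form_cinner: "semi_inner_form (UNIV :: 'h::complex_hilbert set) cinner"
proof
  show "cinner x x \<in> \<real>\<^sub>\<ge>\<^sub>0" for x :: 'h
    by (simp add: cinner_self)
  show "cinner z (x + y) = cinner z x + cinner z y" for x y z :: 'h
    by (subst (1 2 3) cinner_commute) (simp add: cinner_add_left)
  show "cinner z (c *\<^sub>C x) = cnj c * cinner z x" for c and x z :: 'h
    by (subst (1 2) cinner_commute) (simp add: cinner_scaleC_left)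
qed (auto simp: cinner_add_left cinner_scaleC_left complex_vector.subspace_UNIV)

interpretation cinner: semi_inner_form UNIV cinner
  by (rule semi_inner_form_cinner)

lemma len_cinner: "cinner.len x = norm x"
  by (simp add: cinner.len_def cinner_self)

lemma cinner_cauchy_schwarz: "cmod (cinner x y) \<le> norm x * norm y"
  using cinner.cauchy_schwarz[of x y] by (simp add: len_cinner)

lemma cinner_diff_right: "cinner x (y - z) = cinner x y - cinner x z"
  using cinner.right_add[of "y - z" z x] by simp

lemma cinner_zero_left: "cinner 0 x = 0"
  using cinner_scaleC_left[of 0 0 x] by simp

lemma cinner_ext_right:
  assumes "\<And>x. cinner x y = cinner x z"
  shows "y = z"
proof -
  have "cinner (y - z) (y - z) = 0"
    unfolding cinner_diff_right[of "y - z"] using assms by simp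
  then show ?thesis
    by (simp add: cinner_self)
qed

lemma cadjoint_eqI:
  assumes "is_cadjoint T S"
  shows "cadjoint T = S"
  unfolding cadjoint_def
proof (rule the_equality)
  show "S' = S" if "is_cadjoint T S'" for S'
  proof (rule blinfun_eqI, rule cinner_ext_right)
    show "cinner x (S' y) = cinner x (S y)" for x y
      using assms that unfolding is_cadjoint_def by simp
  qed
qed (rule assms)

locale star_operator_algebra = operator_algebra W for W :: "'h::complex_hilbert op set" +
  assumes adjoint_exists: "T \<in> W \<Longrightarrow> \<exists>S\<in>W. is_cadjoint T S"
begin

notation cadjoint ("_\<^sup>\<star>" [1000] 1000)

lemma star_in: "x \<in> W \<Longrightarrow> x\<^sup>\<star> \<in> W"
  using adjoint_exists[of x] cadjoint_eqI by auto

lemma is_adjoint: "x \<in> W \<Longrightarrow> is_cadjoint x (x\<^sup>\<star>)"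
  using adjoint_exists[of x] cadjoint_eqI by auto

lemma cinner_star_right: "x \<in> W \<Longrightarrow> cinner (x v) w = cinner v (x\<^sup>\<star> w)"
  using is_adjoint[of x] by (simp add: is_cadjoint_def)

lemma cinner_star_left: "x \<in> W \<Longrightarrow> cinner (x\<^sup>\<star> v) w = cinner v (x w)"
  using cinner_star_right[of x w v] cinner_commute by metis

lemma star_star: "x \<in> W \<Longrightarrow> x\<^sup>\<star>\<^sup>\<star> = x"
  by (rule cadjoint_eqI) (simp add: is_cadjoint_def cinner_star_left)

lemma star_add: "x \<in> W \<Longrightarrow> y \<in> W \<Longrightarrow> (x + y)\<^sup>\<star> = x\<^sup>\<star> + y\<^sup>\<star>"
  by (rule cadjoint_eqI)
     (simp add: is_cadjoint_def blinfun.add_left cinner_add_left cinner.right_add cinner_star_right)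

lemma star_scale: "x \<in> W \<Longrightarrow> (c *\<^sub>C x)\<^sup>\<star> = cnj c *\<^sub>C x\<^sup>\<star>"
  by (rule cadjoint_eqI)
     (simp add: is_cadjoint_def scaleC_blinfun.rep_eq cinner_scaleC_left cinner.right_scale cinner_star_right)

lemma star_zero: "(0 :: 'h op)\<^sup>\<star> = 0"
  by (rule cadjoint_eqI) (simp add: is_cadjoint_def cinner_zero_left cinner_diff_right[of _ 0 0, simplified])

lemma star_mult: "x \<in> W \<Longrightarrow> y \<in> W \<Longrightarrow> (x o\<^sub>L y)\<^sup>\<star> = y\<^sup>\<star> o\<^sub>L x\<^sup>\<star>"
  by (rule cadjoint_eqI) (simp add: is_cadjoint_def cinner_star_right)

lemma star_id: "id_blinfun\<^sup>\<star> = (id_blinfun :: 'h op)"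
  by (rule cadjoint_eqI) (simp add: is_cadjoint_def)

text \<open>\<open>\<parallel>x v\<parallel>\<^sup>2 = \<langle>v, x\<^sup>\<star> (x v)\<rangle> \<le> \<parallel>v\<parallel> \<parallel>x\<^sup>\<star>\<parallel> \<parallel>x v\<parallel>\<close>.\<close>

lemma norm_le_norm_star:
  assumes "x \<in> W"
  shows "norm x \<le> norm (x\<^sup>\<star>)"
proof (rule norm_blinfun_bound)
  show "norm (x v) \<le> norm (x\<^sup>\<star>) * norm v" for v
  proof (cases "x v = 0")
    case False
    have "(norm (x v))\<^sup>2 = cmod (cinner (x v) (x v))"
      by (simp add: cinner_self norm_power)
    also have "\<dots> = cmod (cinner v (x\<^sup>\<star> (x v)))"
      by (simp only: cinner_star_right[OF assms])
    also have "\<dots> \<le> norm v * norm (x\<^sup>\<star> (x v))"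
      by (rule cinner_cauchy_schwarz)
    also have "\<dots> \<le> norm v * (norm (x\<^sup>\<star>) * norm (x v))"
      by (intro mult_left_mono norm_blinfun) simp
    finally have "norm (x v) * norm (x v) \<le> (norm (x\<^sup>\<star>) * norm v) * norm (x v)"
      by (simp add: power2_eq_square mult_ac)
    with False show ?thesis by simp
  qed simp
qed simp

lemma norm_star: "x \<in> W \<Longrightarrow> norm (x\<^sup>\<star>) = norm x"
  using norm_le_norm_star[of x] norm_le_norm_star[of "x\<^sup>\<star>"] star_in star_star by fastforce

lemma norm_mult_star_le: "x \<in> W \<Longrightarrow> norm x \<le> 1 \<Longrightarrow> norm (x o\<^sub>L x\<^sup>\<star>) \<le> 1"
  using norm_blinfun_compose[of x "x\<^sup>\<star>"] norm_star[of x] mult_le_one[of "norm x" "norm x"] by auto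

lemmas W_intros = A_intros star_in

end

section \<open>Positive functionals\<close>

context star_operator_algebra
begin

definition positive :: "('h op \<Rightarrow> complex) \<Rightarrow> bool" where
  "positive p \<longleftrightarrow> p \<in> dual W \<and> (\<forall>x\<in>W. p (x o\<^sub>L x\<^sup>\<star>) \<in> \<real>\<^sub>\<ge>\<^sub>0)"

lemma positive_dual: "positive p \<Longrightarrow> p \<in> dual W"
  by (simp add: positive_def)

lemma positive_form:
  assumes "positive p"
  shows "semi_inner_form W (\<lambda>x y. p (x o\<^sub>L y\<^sup>\<star>))"
proof
  show "csubspace W" by (rule cspace)
  note p = dual_lin[OF positive_dual[OF assms]]
  fix x y assume x: "x \<in> W" and y: "y \<in> W"
  show "p (x o\<^sub>L x\<^sup>\<star>) \<in> \<real>\<^sub>\<ge>\<^sub>0"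
    using assms x by (simp add: positive_def)
  show "p ((c *\<^sub>C x) o\<^sub>L y\<^sup>\<star>) = c * p (x o\<^sub>L y\<^sup>\<star>)" for c
    using x y W_intros by (simp add: scaleC_compose_left p)
  show "p (y o\<^sub>L (c *\<^sub>C x)\<^sup>\<star>) = cnj c * p (y o\<^sub>L x\<^sup>\<star>)" for c
    using x y W_intros by (simp add: star_scale scaleC_compose_right[OF bounded] p)
  fix z assume z: "z \<in> W"
  show "p ((x + y) o\<^sub>L z\<^sup>\<star>) = p (x o\<^sub>L z\<^sup>\<star>) + p (y o\<^sub>L z\<^sup>\<star>)"
    using x y z W_intros by (simp add: compose_add_left p)
  show "p (z o\<^sub>L (x + y)\<^sup>\<star>) = p (z o\<^sub>L x\<^sup>\<star>) + p (z o\<^sub>L y\<^sup>\<star>)"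
    using x y z W_intros by (simp add: star_add compose_add_right p)
qed

lemma positive_bounded_form:
  assumes "positive p"
  shows "bounded_form W (\<lambda>x y. p (x o\<^sub>L y\<^sup>\<star>)) norm (sqrt (norm1 W p))"
proof -
  interpret semi_inner_form W "\<lambda>x y. p (x o\<^sub>L y\<^sup>\<star>)"
    by (rule positive_form[OF assms])
  note pd = positive_dual[OF assms]
  have pos: "0 \<le> norm1 W p"
    by (rule dual_norm_nonneg[OF seminormed pd])
  have "len x \<le> sqrt (norm1 W p) * norm x" if "x \<in> W" for x
  proof (rule power2_le_imp_le)
    have "(len x)\<^sup>2 = cmod (p (x o\<^sub>L x\<^sup>\<star>))"
      using form_self[OF that] by (simp add: norm_power)
    also have "\<dots> \<le> norm1 W p * norm (x o\<^sub>L x\<^sup>\<star>)"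
      using that W_intros by (intro dual_apply_bound[OF pd]) auto
    also have "\<dots> \<le> norm1 W p * (norm x)\<^sup>2"
      using norm_blinfun_compose[of x "x\<^sup>\<star>"] norm_star[OF that] pos
      by (intro mult_left_mono) (auto simp: power2_eq_square)
    also have "\<dots> = (sqrt (norm1 W p) * norm x)\<^sup>2"
      using pos by (simp add: power_mult_distrib)
    finally show "(len x)\<^sup>2 \<le> (sqrt (norm1 W p) * norm x)\<^sup>2" .
  qed (use pos in simp)
  then show ?thesis
    by unfold_locales (use pos seminormed in auto)
qed

text \<open>The form \<open>p (y\<^sup>\<star> x)\<close> controls left multiplication of functionals just as \<open>p (x y\<^sup>\<star>)\<close> controls right
  multiplication; it is nonnegative because \<open>x\<^sup>\<star> x\<close> is of the form \<open>u u\<^sup>\<star>\<close> with \<open>u = x\<^sup>\<star>\<close>.\<close>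

lemma positive_opposite_form:
  assumes p: "positive p"
  shows "bounded_form W (\<lambda>x y. p (y\<^sup>\<star> o\<^sub>L x)) norm (sqrt (norm1 W p))"
proof -
  interpret F: bounded_form W "\<lambda>x y. p (x o\<^sub>L y\<^sup>\<star>)" norm "sqrt (norm1 W p)"
    by (rule positive_bounded_form[OF p])
  have swap: "p (y\<^sup>\<star> o\<^sub>L x) = p (y\<^sup>\<star> o\<^sub>L x\<^sup>\<star>\<^sup>\<star>)" if "x \<in> W" for x y
    using that by (simp add: star_star)
  note pd = dual_lin[OF positive_dual[OF p]]
  interpret G: semi_inner_form W "\<lambda>x y. p (y\<^sup>\<star> o\<^sub>L x)"
  proof
    show "p (x\<^sup>\<star> o\<^sub>L x) \<in> \<real>\<^sub>\<ge>\<^sub>0" if "x \<in> W" for x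
      using F.nonneg[OF star_in[OF that]] that by (simp add: star_star)
  qed (use W_intros in \<open>simp_all add: cspace star_add star_scale compose_add_left compose_add_right
      scaleC_compose_left scaleC_compose_right[OF bounded] pd\<close>)
  show ?thesis
  proof
    show "G.len x \<le> sqrt (norm1 W p) * norm x" if "x \<in> W" for x
      using F.len_le[OF star_in[OF that]] that by (simp add: F.len_def G.len_def star_star norm_star)
  qed (use F.form_seminormed F.K_nonneg in auto)
qed

lemma positive_star: "positive p \<Longrightarrow> x \<in> W \<Longrightarrow> p (x\<^sup>\<star>) = cnj (p x)"
  using semi_inner_form.form_commute[OF positive_form, of p id_blinfun x] id_in
  by (simp add: compose_id star_id)

lemma positive_id:
  assumes "positive p"
  shows "p id_blinfun = complex_of_real (Re (p id_blinfun))" "0 \<le> Re (p id_blinfun)"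
proof -
  have "p (id_blinfun o\<^sub>L id_blinfun\<^sup>\<star>) \<in> \<real>\<^sub>\<ge>\<^sub>0"
    using assms id_in by (simp only: positive_def)
  then show "p id_blinfun = complex_of_real (Re (p id_blinfun))" "0 \<le> Re (p id_blinfun)"
    by (auto simp: star_id compose_id nonneg_Reals_def)
qed

text \<open>Iterating \<open>\<bar>p (y)\<bar>\<^sup>2 \<le> p (1) p (y y\<^sup>\<star>)\<close> turns any bound of \<open>p\<close> into the optimal one.\<close>

lemma positive_bound:
  assumes p: "positive p" and "x \<in> W"
  shows "cmod (p x) \<le> Re (p id_blinfun) * norm x"
proof -
  interpret semi_inner_form W "\<lambda>x y. p (x o\<^sub>L y\<^sup>\<star>)"
    by (rule positive_form[OF p])
  have contraction: "cmod (p x) \<le> Re (p id_blinfun)" if "x \<in> W" "norm x \<le> 1" for x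
  proof -
    define s where "s n = ((\<lambda>y. y o\<^sub>L y\<^sup>\<star>) ^^ n) x" for n
    have s: "s n \<in> W \<and> norm (s n) \<le> 1" for n
      by (induction n) (auto simp: s_def that intro: W_intros norm_mult_star_le)
    have step: "(cmod (p (s n)))\<^sup>2 \<le> Re (p id_blinfun) * cmod (p (s (Suc n)))" for n
    proof -
      have "cmod (p (s n)) \<le> len (s n) * len id_blinfun"
        using cauchy_schwarz[of "s n" id_blinfun] s id_in by (simp add: star_id compose_id)
      then have "(cmod (p (s n)))\<^sup>2 \<le> (len (s n) * len id_blinfun)\<^sup>2"
        by (intro power_mono) auto
      also have "\<dots> = cmod (p (s n o\<^sub>L (s n)\<^sup>\<star>)) * cmod (p (id_blinfun o\<^sub>L id_blinfun\<^sup>\<star>))"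
        using form_self[of "s n"] form_self[OF id_in] s
        by (simp only: power_mult_distrib norm_of_real abs_power2)
      also have "cmod (p (id_blinfun o\<^sub>L id_blinfun\<^sup>\<star>)) = Re (p id_blinfun)"
        using positive_id[OF p] by (simp add: star_id compose_id) (metis abs_of_nonneg norm_of_real)
      finally show ?thesis
        by (simp add: s_def mult.commute)
    qed
    have "cmod (p (s 0)) \<le> Re (p id_blinfun)"
    proof (rule bounded_doubling_sequence[where u = "\<lambda>n. cmod (p (s n))", OF step])
      show "cmod (p (s n)) \<le> norm1 W p" for n
        using dual_apply_bound[OF positive_dual[OF p], of "s n"] s[of n]
          mult_left_le[of "norm (s n)" "norm1 W p"] dual_norm_nonneg[OF seminormed positive_dual[OF p]]
        by linarith
    qed (rule positive_id[OF p])
    then show ?thesis by (simp add: s_def)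
  qed
  show ?thesis
  proof (cases "x = 0")
    case True
    then show ?thesis
      using dual_space_zero[OF seminormed positive_dual[OF p]] by simp
  next
    case False
    let ?c = "complex_of_real (1 / norm x)"
    have "cmod (p (?c *\<^sub>C x)) \<le> Re (p id_blinfun)"
      using \<open>x \<in> W\<close> W_intros False
      by (intro contraction) (auto simp: norm_scaleC norm_divide)
    moreover have "cmod (p (?c *\<^sub>C x)) = cmod (p x) / norm x"
      unfolding dual_lin(2)[OF positive_dual[OF p] \<open>x \<in> W\<close>] by (simp add: norm_mult norm_divide)
    ultimately show ?thesis
      using False by (simp add: pos_divide_le_eq)
  qed
qed

lemma functional_star_in_dual:
  assumes "\<psi> \<in> dual W"
  shows "functional_star W \<psi> \<in> dual W" and "norm1 W (functional_star W \<psi>) \<le> norm1 W \<psi>"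
proof -
  have le: "cmod (functional_star W \<psi> x) \<le> norm1 W \<psi> * norm x" if "x \<in> W" for x
    using dual_apply_bound[OF assms star_in[OF that]] that by (simp add: functional_star_def norm_star)
  show "functional_star W \<psi> \<in> dual W"
  proof (rule dual_spaceI[of _ _ "norm1 W \<psi>"])
    show "clinear_on W (functional_star W \<psi>)"
      using W_intros dual_lin[OF assms]
      by (simp add: clinear_on_def functional_star_def star_add star_scale)
  qed (use le in \<open>auto simp: functional_star_def\<close>)
  show "norm1 W (functional_star W \<psi>) \<le> norm1 W \<psi>"
    by (rule dual_norm_le[OF seminormed]) (use le dual_norm_nonneg[OF seminormed assms] in auto)
qed

text \<open>It suffices to find a functional \<open>G\<close> of norm at most \<open>M\<^sup>2\<close> with \<open>Re (G (x x\<^sup>\<star>)) \<ge> 2 Re (\<phi> x) - 1\<close>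
  for all \<open>x\<close>, since scaling \<open>x\<close> improves this to \<open>\<bar>\<phi> x\<bar>\<^sup>2\<close>. These demands generate a cone that is
  described by the pairs \<open>(k, 2 Re (\<phi> y) - t)\<close> with \<open>\<parallel>y\<^sup>\<star> v\<parallel>\<^sup>2 \<le> t \<langle>k v, v\<rangle>\<close> for all vectors \<open>v\<close>. This
  condition is stable under sums by the Cauchy--Schwarz inequality; it holds for \<open>k = x x\<^sup>\<star>\<close>, \<open>y = x\<close>,
  \<open>t = 1\<close>; and it implies \<open>\<parallel>y\<parallel>\<^sup>2 \<le> t \<parallel>k\<parallel>\<close>, which bounds the demand by \<open>M\<^sup>2 \<parallel>k\<parallel>\<close>.\<close>

theorem exists_dominating_positive:
  assumes \<phi>: "\<phi> \<in> dual W" and bound: "\<And>x. x \<in> W \<Longrightarrow> cmod (\<phi> x) \<le> M * norm x" and "M \<ge> 0"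
  shows "\<exists>p. positive p \<and> norm1 W p \<le> M\<^sup>2 \<and> (\<forall>x\<in>W. (cmod (\<phi> x))\<^sup>2 \<le> Re (p (x o\<^sub>L x\<^sup>\<star>)))"
proof -
  define dominated where "dominated k y t \<longleftrightarrow> k \<in> W \<and> y \<in> W \<and> 0 \<le> t \<and>
    (\<forall>v. 0 \<le> Re (cinner (k v) v) \<and> (norm (y\<^sup>\<star> v))\<^sup>2 \<le> t * Re (cinner (k v) v))" for k y t
  define K where "K = {(k, r). \<exists>y t. dominated k y t \<and> r = 2 * Re (\<phi> y) - t}"
  have seminormed': "seminormed W (\<lambda>x. M\<^sup>2 * norm x)"
    unfolding seminormed_def
  proof (intro conjI ballI allI)
    show "M\<^sup>2 * norm (x + y) \<le> M\<^sup>2 * norm x + M\<^sup>2 * norm y" for x y :: "'h op"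
      using mult_left_mono[OF norm_triangle_ineq, of "M\<^sup>2"] by (simp add: distrib_left)
  qed (use cspace in \<open>auto simp: norm_scaleC\<close>)
  have "cone_over W K"
    unfolding cone_over_def
  proof (intro conjI allI impI)
    show "K \<subseteq> W \<times> UNIV"
      by (auto simp: K_def dominated_def)
    have "dominated 0 0 0"
      using seminormedD(4)[OF seminormed] by (simp add: dominated_def star_zero cinner_zero_left)
    then show "(0, 0) \<in> K"
      using dual_space_zero[OF seminormed \<phi>] by (auto simp: K_def intro!: exI[of _ 0])
    show "(k + l, r + s) \<in> K" if K: "(k, r) \<in> K" "(l, s) \<in> K" for k r l s
    proof -
      from K obtain y t z u where 1: "dominated k y t" "r = 2 * Re (\<phi> y) - t"
        and 2: "dominated l z u" "s = 2 * Re (\<phi> z) - u"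
        by (auto simp: K_def)
      have "(norm ((y + z)\<^sup>\<star> v))\<^sup>2 \<le> (t + u) * Re (cinner ((k + l) v) v)" for v
      proof -
        have "(norm ((y + z)\<^sup>\<star> v))\<^sup>2 \<le> (norm (y\<^sup>\<star> v) + norm (z\<^sup>\<star> v))\<^sup>2"
          using 1 2 by (intro power_mono)
            (auto simp: dominated_def star_add blinfun.add_left norm_triangle_ineq)
        also have "\<dots> \<le> (t + u) * (Re (cinner (k v) v) + Re (cinner (l v) v))"
          using 1 2 by (intro square_sum_le) (auto simp: dominated_def)
        finally show ?thesis
          by (simp add: blinfun.add_left cinner_add_left)
      qed
      then have "dominated (k + l) (y + z) (t + u)"
        using 1(1) 2(1) W_intros by (simp add: dominated_def blinfun.add_left cinner_add_left)
      moreover have "r + s = 2 * Re (\<phi> (y + z)) - (t + u)"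
        using 1 2 dual_lin(1)[OF \<phi>, of y z] by (simp add: dominated_def)
      ultimately show ?thesis
        by (auto simp: K_def)
    qed
    show "(complex_of_real c *\<^sub>C k, c * r) \<in> K" if "c > 0" and K: "(k, r) \<in> K" for c k r
    proof -
      from K obtain y t where 1: "dominated k y t" "r = 2 * Re (\<phi> y) - t"
        by (auto simp: K_def)
      have "(norm ((complex_of_real c *\<^sub>C y)\<^sup>\<star> v))\<^sup>2 \<le> c * t * Re (cinner ((complex_of_real c *\<^sub>C k) v) v)" for v
        using 1(1) \<open>c > 0\<close>
        by (simp add: dominated_def star_scale scaleC_blinfun.rep_eq cinner_scaleC_left norm_scaleC
            power_mult_distrib power2_eq_square mult_ac)
      then have "dominated (complex_of_real c *\<^sub>C k) (complex_of_real c *\<^sub>C y) (c * t)"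
        using 1(1) \<open>c > 0\<close> W_intros
        by (simp add: dominated_def scaleC_blinfun.rep_eq cinner_scaleC_left)
      moreover have "c * r = 2 * Re (\<phi> (complex_of_real c *\<^sub>C y)) - c * t"
        using 1 dual_lin(2)[OF \<phi>, of y "complex_of_real c"] by (simp add: dominated_def right_diff_distrib)
      ultimately show ?thesis
        by (auto simp: K_def)
    qed
  qed
  moreover have "r \<le> M\<^sup>2 * norm k" if "(k, r) \<in> K" for k r
  proof -
    from that obtain y t where y: "dominated k y t" "r = 2 * Re (\<phi> y) - t"
      by (auto simp: K_def)
    then have "y \<in> W" "t \<ge> 0"
      by (auto simp: dominated_def)
    have "norm (y\<^sup>\<star>) \<le> sqrt (t * norm k)"
    proof (rule norm_blinfun_bound)
      show "norm (y\<^sup>\<star> v) \<le> sqrt (t * norm k) * norm v" for v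
      proof (rule power2_le_imp_le)
        have "Re (cinner (k v) v) \<le> norm (k v) * norm v"
          using complex_Re_le_cmod cinner_cauchy_schwarz order_trans by blast
        also have "\<dots> \<le> (norm k * norm v) * norm v"
          by (intro mult_right_mono norm_blinfun) simp
        finally have "t * Re (cinner (k v) v) \<le> t * (norm k * (norm v)\<^sup>2)"
          using \<open>t \<ge> 0\<close> by (intro mult_left_mono) (auto simp: power2_eq_square mult_ac)
        then show "(norm (y\<^sup>\<star> v))\<^sup>2 \<le> (sqrt (t * norm k) * norm v)\<^sup>2"
          using y(1) \<open>t \<ge> 0\<close> by (simp add: dominated_def power_mult_distrib mult.assoc)
             (meson order_trans)
      qed (use \<open>t \<ge> 0\<close> in simp)
    qed (use \<open>t \<ge> 0\<close> in simp)
    then have "Re (\<phi> y) \<le> M * sqrt (t * norm k)"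
      using bound[OF \<open>y \<in> W\<close>] complex_Re_le_cmod[of "\<phi> y"] norm_star[OF \<open>y \<in> W\<close>]
        mult_left_mono[of "norm y" "sqrt (t * norm k)" M] \<open>M \<ge> 0\<close> by linarith
    moreover have "2 * (M * sqrt (t * norm k)) \<le> M\<^sup>2 * norm k + t"
      using zero_le_power2[of "M * sqrt (norm k) - sqrt t"] \<open>t \<ge> 0\<close>
      by (simp add: power2_diff power_mult_distrib real_sqrt_mult mult_ac)
    ultimately show ?thesis
      using y(2) by linarith
  qed
  ultimately obtain G where G: "clinear_on W G" "\<And>x. x \<in> W \<Longrightarrow> cmod (G x) \<le> M\<^sup>2 * norm x"
    and GK: "\<forall>(k, r)\<in>K. r \<le> Re (G k)"
    using hahn_banach_complex[OF seminormed', of K] by blast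
  have lower: "2 * Re (\<phi> x) - 1 \<le> Re (G (x o\<^sub>L x\<^sup>\<star>))" if "x \<in> W" for x
  proof -
    have "cinner ((x o\<^sub>L x\<^sup>\<star>) v) v = complex_of_real ((norm (x\<^sup>\<star> v))\<^sup>2)" for v
      using cinner_star_right[OF that, of "x\<^sup>\<star> v" v] cinner_self by simp
    then have "dominated (x o\<^sub>L x\<^sup>\<star>) x 1"
      using that W_intros by (simp add: dominated_def)
    then have "(x o\<^sub>L x\<^sup>\<star>, 2 * Re (\<phi> x) - 1) \<in> K"
      by (auto simp: K_def)
    then show ?thesis
      using GK by auto
  qed
  have dom: "(cmod (\<phi> x))\<^sup>2 \<le> Re (G (x o\<^sub>L x\<^sup>\<star>)) \<and> 0 \<le> Re (G (x o\<^sub>L x\<^sup>\<star>))" if "x \<in> W" for x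
  proof -
    obtain w where w: "cmod w = 1" "w * \<phi> x = complex_of_real (cmod (\<phi> x))"
      using exists_unimodular by blast
    have scaled: "2 * r * cmod (\<phi> x) \<le> r\<^sup>2 * Re (G (x o\<^sub>L x\<^sup>\<star>)) + 1" for r
    proof -
      let ?c = "complex_of_real r * w"
      have "\<phi> (?c *\<^sub>C x) = complex_of_real (r * cmod (\<phi> x))"
        using dual_lin(2)[OF \<phi> that, of ?c] w(2) by (simp add: mult.assoc)
      moreover have "(?c *\<^sub>C x) o\<^sub>L (?c *\<^sub>C x)\<^sup>\<star> = complex_of_real (r\<^sup>2) *\<^sub>C (x o\<^sub>L x\<^sup>\<star>)"
        using that w(1) complex_norm_square[of ?c]
        by (simp add: star_scale scaleC_compose_left scaleC_compose_right[OF bounded] scaleC_scaleC norm_mult)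
      moreover have "G (complex_of_real (r\<^sup>2) *\<^sub>C (x o\<^sub>L x\<^sup>\<star>)) = complex_of_real (r\<^sup>2) * G (x o\<^sub>L x\<^sup>\<star>)"
        using clinear_onD(2)[OF G(1)] that W_intros by simp
      ultimately show ?thesis
        using lower[of "?c *\<^sub>C x"] that W_intros by simp
    qed
    have pos: "0 \<le> Re (G (x o\<^sub>L x\<^sup>\<star>))"
    proof (rule ccontr)
      assume neg: "\<not> 0 \<le> Re (G (x o\<^sub>L x\<^sup>\<star>))"
      \<comment> \<open>Any \<open>r\<close> with \<open>r\<^sup>2 Re (G (x x\<^sup>\<star>)) < - 1\<close> contradicts the scaled inequality.\<close>
      define r where "r = sqrt (2 / - Re (G (x o\<^sub>L x\<^sup>\<star>)))"
      have "r\<^sup>2 = 2 / - Re (G (x o\<^sub>L x\<^sup>\<star>))" "r \<ge> 0"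
        using neg by (auto simp: r_def)
      then have "r\<^sup>2 * Re (G (x o\<^sub>L x\<^sup>\<star>)) = - 2"
        using neg by (simp add: field_simps)
      moreover have "0 \<le> 2 * r * cmod (\<phi> x)"
        using \<open>r \<ge> 0\<close> by simp
      ultimately show False
        using scaled[of r] by linarith
    qed
    have "(cmod (\<phi> x))\<^sup>2 \<le> 1 * Re (G (x o\<^sub>L x\<^sup>\<star>))"
      by (rule quadratic_bound) (use scaled pos in auto)
    with pos show ?thesis by simp
  qed
  \<comment> \<open>The hermitian part of \<open>G\<close> has the same values on the elements \<open>x x\<^sup>\<star>\<close>, but without imaginary part.\<close>
  define p where "p = cutoff W (\<lambda>x. (1/2) * (G x + cnj (G (x\<^sup>\<star>))))"
  have p_bound: "cmod ((1/2) * (G x + cnj (G (x\<^sup>\<star>)))) \<le> M\<^sup>2 * norm x" if "x \<in> W" for x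
    using G(2)[OF that] G(2)[OF star_in[OF that]] norm_triangle_ineq[of "G x" "cnj (G (x\<^sup>\<star>))"]
    by (simp add: norm_mult norm_star[OF that])
  have "clinear_on W (\<lambda>x. (1/2) * (G x + cnj (G (x\<^sup>\<star>))))"
    using clinear_onD[OF G(1)] W_intros
    by (simp add: clinear_on_def star_add star_scale algebra_simps add_divide_distrib)
  then have pd: "p \<in> dual W"
    unfolding p_def by (rule cutoff_in_dual_space[OF seminormed _ p_bound])
  have p_self: "p (x o\<^sub>L x\<^sup>\<star>) = complex_of_real (Re (G (x o\<^sub>L x\<^sup>\<star>)))" if "x \<in> W" for x
    using that W_intros complex_add_cnj[of "G (x o\<^sub>L x\<^sup>\<star>)"]
    by (simp add: p_def cutoff_def star_mult star_star)
  have "norm1 W p \<le> M\<^sup>2"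
    by (rule dual_norm_le[OF seminormed]) (use p_bound in \<open>auto simp: p_def cutoff_def\<close>)
  moreover have "positive p"
    using pd p_self dom by (simp add: positive_def)
  ultimately show ?thesis
    using p_self dom by auto
qed

text \<open>A numerical range argument. For \<open>c\<close> on the line \<open>2 Re c = \<parallel>x\<parallel>\<^sup>2\<close> the element \<open>x x\<^sup>\<star> - c\<close> has norm at
  most \<open>\<bar>c\<bar>\<close>, because the spectrum of \<open>x x\<^sup>\<star>\<close> lies between 0 and \<open>\<parallel>x\<parallel>\<^sup>2\<close>. So \<open>q (x x\<^sup>\<star>)\<close> lies in all the
  discs with centre \<open>c M\<close> that have 0 on the boundary, and these meet only in nonnegative real numbers.\<close>

lemma positive_of_attains_at_id:
  assumes q: "q \<in> dual W" and bound: "\<And>x. x \<in> W \<Longrightarrow> cmod (q x) \<le> M * norm x" and "M \<ge> 0"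
    and attains: "q id_blinfun = complex_of_real M"
  shows "positive q"
  unfolding positive_def
proof (intro conjI ballI)
  fix x assume x: "x \<in> W"
  define h s where "h = x o\<^sub>L x\<^sup>\<star>" and "s = (norm x)\<^sup>2"
  have h: "h \<in> W"
    using x W_intros by (simp add: h_def)
  have norm_le: "norm (h - c *\<^sub>C id_blinfun) \<le> cmod c" if c: "2 * Re c = s" for c
  proof (rule norm_blinfun_bound)
    show "norm ((h - c *\<^sub>C id_blinfun) v) \<le> cmod c * norm v" for v
    proof (rule power2_le_imp_le)
      have hv: "cinner (h v) v = complex_of_real ((norm (x\<^sup>\<star> v))\<^sup>2)"
        using cinner_star_right[OF x, of "x\<^sup>\<star> v" v] cinner_self by (simp add: h_def)
      have "norm (h v) \<le> norm x * norm (x\<^sup>\<star> v)"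
        using norm_blinfun[of x "x\<^sup>\<star> v"] by (simp add: h_def)
      then have "(norm (h v))\<^sup>2 \<le> s * (norm (x\<^sup>\<star> v))\<^sup>2"
        unfolding s_def power_mult_distrib[symmetric] by (intro power_mono) auto
      moreover have "(norm (h v + (- c) *\<^sub>C v))\<^sup>2
          = (norm (h v))\<^sup>2 + 2 * Re (- c * cinner v (h v)) + (cmod c)\<^sup>2 * (norm v)\<^sup>2"
        using cinner.len_expand[of "h v" v "- c"] by (simp add: len_cinner)
      moreover have "cinner v (h v) = complex_of_real ((norm (x\<^sup>\<star> v))\<^sup>2)"
        using hv cinner_commute[of v "h v"] by simp
      then have "2 * Re (- c * cinner v (h v)) = - (s * (norm (x\<^sup>\<star> v))\<^sup>2)"
        by (simp flip: c)
      moreover have "(h - c *\<^sub>C id_blinfun) v = h v + (- c) *\<^sub>C v"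
        by (simp add: blinfun.diff_left scaleC_blinfun.rep_eq)
      ultimately show "(norm ((h - c *\<^sub>C id_blinfun) v))\<^sup>2 \<le> (cmod c * norm v)\<^sup>2"
        by (simp add: power_mult_distrib)
    qed simp
  qed simp
  have disc: "(cmod (q h))\<^sup>2 \<le> M * (s * Re (q h)) + M * (2 * t * Im (q h))" for t
  proof -
    define c where "c = Complex (s / 2) t"
    have "cmod (q (h - c *\<^sub>C id_blinfun)) \<le> M * cmod c"
      using bound[of "h - c *\<^sub>C id_blinfun"] norm_le[of c] h W_intros \<open>M \<ge> 0\<close>
        mult_left_mono[of "norm (h - c *\<^sub>C id_blinfun)" "cmod c" M] by (simp add: c_def)
    moreover have "q (h - c *\<^sub>C id_blinfun) = q h - c * complex_of_real M"
      using dual_lin(2,3)[OF q] h W_intros attains by simp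
    ultimately have "(cmod (q h - c * complex_of_real M))\<^sup>2 \<le> (M * cmod c)\<^sup>2"
      by (simp add: power_mono)
    then show ?thesis
      by (simp add: cmod_power2 power_mult_distrib c_def power2_diff) (simp add: algebra_simps power2_eq_square)
  qed
  have "Im (q h) = 0"
  proof (rule ccontr)
    assume nz: "Im (q h) \<noteq> 0"
    then have "(cmod (q h))\<^sup>2 > 0"
      by auto
    show False
    proof (cases "M = 0")
      case True
      then show False
        using disc[of 0] \<open>(cmod (q h))\<^sup>2 > 0\<close> by simp
    next
      case False
      let ?t = "- (s * Re (q h)) / (2 * Im (q h))"
      have "s * Re (q h) + 2 * ?t * Im (q h) = 0"
        using nz by simp
      then show False
        using disc[of ?t] \<open>(cmod (q h))\<^sup>2 > 0\<close>
        by (metis distrib_left mult_zero_right not_le)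
    qed
  qed
  moreover have "0 \<le> Re (q h)"
  proof (rule ccontr)
    assume "\<not> 0 \<le> Re (q h)"
    moreover from this have "M * (s * Re (q h)) \<le> 0"
      using \<open>M \<ge> 0\<close> by (intro mult_nonneg_nonpos) (auto simp: s_def mult_nonneg_nonpos)
    ultimately have "(cmod (q h))\<^sup>2 \<le> 0"
      using disc[of 0] by (simp only: mult_zero_left mult_zero_right add_0_right)
    then have "q h = 0"
      by simp
    with \<open>\<not> 0 \<le> Re (q h)\<close> show False
      by simp
  qed
  ultimately show "q (x o\<^sub>L x\<^sup>\<star>) \<in> \<real>\<^sub>\<ge>\<^sub>0"
    by (auto simp: h_def complex_nonneg_Reals_iff)
qed (rule q)

end

section \<open>The second Arens product\<close>

definition right_mult ::
    "'h::complex_hilbert op set \<Rightarrow> ('h op \<Rightarrow> complex) \<Rightarrow> 'h op \<Rightarrow> ('h op \<Rightarrow> complex)" where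
  "right_mult A \<phi> a = cutoff A (\<lambda>b. \<phi> (b o\<^sub>L a))"

text \<open>The other module action \<open>\<phi> \<cdot> \<Lambda>\<close>. The second Arens product of \<open>\<Lambda>\<close> and \<open>\<Gamma>\<close> maps \<open>\<phi>\<close> to \<open>\<Gamma> (\<phi> \<cdot> \<Lambda>)\<close>.\<close>

definition right_action :: "'h::complex_hilbert op set \<Rightarrow> ('h op \<Rightarrow> complex) \<Rightarrow>
    (('h op \<Rightarrow> complex) \<Rightarrow> complex) \<Rightarrow> ('h op \<Rightarrow> complex)" where
  "right_action A \<phi> \<Lambda> = cutoff A (\<lambda>a. \<Lambda> (right_mult A \<phi> a))"

context operator_algebra
begin

lemma right_mult_in_dual:
  assumes \<phi>: "\<phi> \<in> dual A" and a: "a \<in> A"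
  shows "right_mult A \<phi> a \<in> dual A" and "norm1 A (right_mult A \<phi> a) \<le> norm1 A \<phi> * norm a"
proof -
  have le: "norm (b o\<^sub>L a) \<le> norm a * norm b" for b
    using norm_blinfun_compose[of b a] by (simp add: mult.commute)
  have "clinear_on A (\<lambda>b. b o\<^sub>L a)"
    by (simp add: clinear_on_def compose_add_left scaleC_compose_left)
  note transpose = transpose_in_dual[OF seminormed seminormed \<phi> this, where C = "norm a"]
  show "right_mult A \<phi> a \<in> dual A"
    unfolding right_mult_def by (rule transpose(1)) (simp_all add: mult_closed a le)
  show "norm1 A (right_mult A \<phi> a) \<le> norm1 A \<phi> * norm a"
    unfolding right_mult_def by (rule transpose(2)) (simp_all add: mult_closed a le)
qed

lemma right_action_in_dual:
  assumes \<Lambda>: "\<Lambda> \<in> bidual A" and \<phi>: "\<phi> \<in> dual A"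
  shows "right_action A \<phi> \<Lambda> \<in> dual A" and "norm1 A (right_action A \<phi> \<Lambda>) \<le> norm2 A \<Lambda> * norm1 A \<phi>"
proof -
  have "right_mult A \<phi> (a + b) = right_mult A \<phi> a + right_mult A \<phi> b" if "a \<in> A" "b \<in> A" for a b
    using that A_intros by (auto simp: fun_eq_iff right_mult_def cutoff_def compose_add_right dual_lin[OF \<phi>])
  moreover have "right_mult A \<phi> (c *\<^sub>C a) = c *\<^sub>C right_mult A \<phi> a" if "a \<in> A" for a c
    using that A_intros
    by (auto simp: fun_eq_iff right_mult_def cutoff_def scaleC_compose_right[OF bounded] dual_lin[OF \<phi>])
  ultimately have "clinear_on A (right_mult A \<phi>)"
    by (simp only: clinear_on_def) blast
  then show "right_action A \<phi> \<Lambda> \<in> dual A" "norm1 A (right_action A \<phi> \<Lambda>) \<le> norm2 A \<Lambda> * norm1 A \<phi>"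
    unfolding right_action_def
    using transpose_in_dual[OF seminormed seminormed1 \<Lambda>, of "right_mult A \<phi>" "norm1 A \<phi>"]
    by (simp_all add: right_mult_in_dual[OF \<phi>] dual_norm_nonneg[OF seminormed \<phi>])
qed

lemma right_action_linear:
  assumes \<Lambda>: "\<Lambda> \<in> bidual A"
  shows "clinear_on (dual A) (\<lambda>\<phi>. right_action A \<phi> \<Lambda>)"
proof -
  have add: "right_mult A (\<phi> + \<psi>) a = right_mult A \<phi> a + right_mult A \<psi> a" for \<phi> \<psi> a
    by (auto simp: fun_eq_iff right_mult_def cutoff_def)
  have scale: "right_mult A (c *\<^sub>C \<phi>) a = c *\<^sub>C right_mult A \<phi> a" for c \<phi> a
    by (auto simp: fun_eq_iff right_mult_def cutoff_def)
  show ?thesis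
    unfolding clinear_on_def right_action_def
    by (intro conjI ballI allI ext)
       (simp_all add: cutoff_def add scale right_mult_in_dual bidual_lin[OF \<Lambda>])
qed

lemma right_action_diff_right: "right_action A \<phi> (\<Lambda> - \<Gamma>) = right_action A \<phi> \<Lambda> - right_action A \<phi> \<Gamma>"
  by (auto simp: fun_eq_iff right_action_def cutoff_def)

lemma right_action_unit:
  assumes \<phi>: "\<phi> \<in> dual A"
  shows "right_action A \<phi> (bidual_unit A) = \<phi>"
proof
  show "right_action A \<phi> (bidual_unit A) a = \<phi> a" for a
  proof (cases "a \<in> A")
    case True
    then have "right_action A \<phi> (bidual_unit A) a = right_mult A \<phi> a id_blinfun"
      using right_mult_in_dual(1)[OF \<phi> True] by (simp add: right_action_def cutoff_apply bidual_unit_def)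
    then show ?thesis
      using id_in by (simp add: right_mult_def cutoff_apply compose_id)
  qed (simp add: right_action_def cutoff_def dual_space_outside[OF \<phi>])
qed

lemma second_arens_in_bidual:
  assumes \<Lambda>: "\<Lambda> \<in> bidual A" and \<Gamma>: "\<Gamma> \<in> bidual A"
  shows "cutoff (dual A) (\<lambda>\<phi>. \<Gamma> (right_action A \<phi> \<Lambda>)) \<in> bidual A"
  by (rule transpose_in_dual(1)[OF seminormed1 seminormed1 \<Gamma> right_action_linear[OF \<Lambda>]];
      rule right_action_in_dual[OF \<Lambda>] dual_norm_nonneg[OF seminormed1 \<Lambda>])

end

section \<open>Density of the positive functionals and Arens regularity\<close>

context star_operator_algebra
begin

lemma positive_conjugate:
  assumes "positive p" and f: "f \<in> W"
  shows "positive (cutoff W (\<lambda>x. p ((f o\<^sub>L x) o\<^sub>L f\<^sup>\<star>)))"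
  unfolding positive_def
proof (intro conjI ballI)
  note pd = positive_dual[OF assms(1)]
  show "cutoff W (\<lambda>x. p ((f o\<^sub>L x) o\<^sub>L f\<^sup>\<star>)) \<in> dual W"
  proof (rule transpose_in_dual(1)[OF seminormed seminormed pd])
    show "clinear_on W (\<lambda>x. (f o\<^sub>L x) o\<^sub>L f\<^sup>\<star>)"
      by (simp add: clinear_on_def compose_add_left compose_add_right scaleC_compose_left
          scaleC_compose_right[OF bounded[OF f]])
    show "norm ((f o\<^sub>L x) o\<^sub>L f\<^sup>\<star>) \<le> (norm f * norm (f\<^sup>\<star>)) * norm x" for x
      using norm_blinfun_compose[of "f o\<^sub>L x" "f\<^sup>\<star>"]
        mult_right_mono[OF norm_blinfun_compose[of f x] norm_ge_zero[of "f\<^sup>\<star>"]]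
      by (simp add: mult_ac)
  qed (use f W_intros in auto)
  show "cutoff W (\<lambda>x. p ((f o\<^sub>L x) o\<^sub>L f\<^sup>\<star>)) (x o\<^sub>L x\<^sup>\<star>) \<in> \<real>\<^sub>\<ge>\<^sub>0" if "x \<in> W" for x
  proof -
    have "(f o\<^sub>L (x o\<^sub>L x\<^sup>\<star>)) o\<^sub>L f\<^sup>\<star> = (f o\<^sub>L x) o\<^sub>L (f o\<^sub>L x)\<^sup>\<star>"
      using f that by (simp add: star_mult compose_assoc)
    then show ?thesis
      using assms(1) f that W_intros by (simp add: cutoff_def positive_def)
  qed
qed

text \<open>A functional dominated by the positive \<open>p\<close> is a norm limit of functionals \<open>x \<mapsto> p (x f\<^sup>\<star>)\<close>, and these are
  linear combinations of positive functionals.\<close>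

theorem bidual_zero_of_positive:
  assumes \<Phi>: "\<Phi> \<in> bidual W" and zero: "\<And>p. positive p \<Longrightarrow> \<Phi> p = 0" and \<psi>: "\<psi> \<in> dual W"
  shows "\<Phi> \<psi> = 0"
proof -
  have M: "0 \<le> norm1 W \<psi>"
    by (rule dual_norm_nonneg[OF seminormed \<psi>])
  obtain p where p: "positive p" and dom: "\<And>x. x \<in> W \<Longrightarrow> (cmod (\<psi> x))\<^sup>2 \<le> Re (p (x o\<^sub>L x\<^sup>\<star>))"
    using exists_dominating_positive[OF \<psi> dual_apply_bound[OF \<psi>] M] by blast
  define K where "K = sqrt (norm1 W p)"
  interpret bounded_form W "\<lambda>x y. p (x o\<^sub>L y\<^sup>\<star>)" norm K
    unfolding K_def by (rule positive_bounded_form[OF p])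
  have \<psi>_len: "cmod (\<psi> x) \<le> 1 * len x" if "x \<in> W" for x
    using dom[OF that] real_le_rsqrt by (simp add: len_def)
  \<comment> \<open>Polarisation: \<open>4 p(x y\<^sup>\<star>)\<close> is the sum of \<open>\<alpha> p((1 + \<alpha> y) x (1 + \<alpha> y)\<^sup>\<star>)\<close> over the fourth roots of unity \<open>\<alpha>\<close>.\<close>
  have rep_zero: "\<Phi> (rep y) = 0" if y: "y \<in> W" for y
  proof -
    define u where "u \<alpha> = id_blinfun + \<alpha> *\<^sub>C y" for \<alpha>
    define q where "q \<alpha> = cutoff W (\<lambda>x. p ((u \<alpha> o\<^sub>L x) o\<^sub>L (u \<alpha>)\<^sup>\<star>))" for \<alpha>
    have u: "u \<alpha> \<in> W" for \<alpha>
      using y W_intros by (simp add: u_def)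
    have q: "positive (q \<alpha>)" for \<alpha>
      unfolding q_def by (rule positive_conjugate[OF p u])
    have q_expand: "q \<alpha> x = p (x o\<^sub>L id_blinfun\<^sup>\<star>) + cnj \<alpha> * p (x o\<^sub>L y\<^sup>\<star>)
        + \<alpha> * p ((y o\<^sub>L x) o\<^sub>L id_blinfun\<^sup>\<star>) + \<alpha> * cnj \<alpha> * p ((y o\<^sub>L x) o\<^sub>L y\<^sup>\<star>)"
      if x: "x \<in> W" for \<alpha> x
    proof -
      have "q \<alpha> x = p ((x + \<alpha> *\<^sub>C (y o\<^sub>L x)) o\<^sub>L (id_blinfun + \<alpha> *\<^sub>C y)\<^sup>\<star>)"
        using x by (simp add: q_def cutoff_def u_def compose_add_left scaleC_compose_left compose_id)
      also have "\<dots> = p (x o\<^sub>L (id_blinfun + \<alpha> *\<^sub>C y)\<^sup>\<star>) + \<alpha> * p ((y o\<^sub>L x) o\<^sub>L (id_blinfun + \<alpha> *\<^sub>C y)\<^sup>\<star>)"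
        using x y W_intros by (simp add: left_add left_scale)
      also have "p (x o\<^sub>L (id_blinfun + \<alpha> *\<^sub>C y)\<^sup>\<star>) = p (x o\<^sub>L id_blinfun\<^sup>\<star>) + cnj \<alpha> * p (x o\<^sub>L y\<^sup>\<star>)"
        using x y W_intros by (simp add: right_add right_scale)
      also have "p ((y o\<^sub>L x) o\<^sub>L (id_blinfun + \<alpha> *\<^sub>C y)\<^sup>\<star>)
          = p ((y o\<^sub>L x) o\<^sub>L id_blinfun\<^sup>\<star>) + cnj \<alpha> * p ((y o\<^sub>L x) o\<^sub>L y\<^sup>\<star>)"
        using x y W_intros by (simp add: right_add right_scale)
      finally show ?thesis
        by (simp add: algebra_simps)
    qed
    have "4 *\<^sub>C rep y = (q 1 + (- 1) *\<^sub>C q (- 1)) + (\<i> *\<^sub>C q \<i> + (- \<i>) *\<^sub>C q (- \<i>))"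
    proof
      show "(4 *\<^sub>C rep y) x = ((q 1 + (- 1) *\<^sub>C q (- 1)) + (\<i> *\<^sub>C q \<i> + (- \<i>) *\<^sub>C q (- \<i>))) x" for x
      proof (cases "x \<in> W")
        case True
        then show ?thesis
          by (simp add: q_expand rep_def cutoff_def) (simp add: algebra_simps)
      qed (simp add: rep_def cutoff_def q_def)
    qed
    then have "\<Phi> (4 *\<^sub>C rep y) = \<Phi> ((q 1 + (- 1) *\<^sub>C q (- 1)) + (\<i> *\<^sub>C q \<i> + (- \<i>) *\<^sub>C q (- \<i>)))"
      by (rule arg_cong)
    also have "\<dots> = 0"
      using positive_dual[OF q] dual_intros
      by (simp only: bidual_lin[OF \<Phi>] zero[OF q]) simp
    finally show ?thesis
      using bidual_lin(2)[OF \<Phi> rep_dual(1)[OF y]] by simp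
  qed
  have "cmod (\<Phi> \<psi>) \<le> \<epsilon> * (norm2 W \<Phi> * K)" if "\<epsilon> > 0" for \<epsilon>
  proof -
    obtain f where f: "f \<in> W" "\<And>x. x \<in> W \<Longrightarrow> cmod (\<psi> x - p (x o\<^sub>L f\<^sup>\<star>)) \<le> \<epsilon> * len x"
      using riesz_approx[OF dual_space_linear(1)[OF \<psi>] \<psi>_len \<open>\<epsilon> > 0\<close>] by blast
    have "norm1 W (\<psi> - rep f) \<le> \<epsilon> * K"
    proof (rule dual_norm_le[OF seminormed])
      show "cmod ((\<psi> - rep f) x) \<le> \<epsilon> * K * norm x" if "x \<in> W" for x
        using order_trans[OF f(2)[OF that] mult_left_mono[OF len_le[OF that], of \<epsilon>]] \<open>\<epsilon> > 0\<close> that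
        by (simp add: rep_def cutoff_def mult.assoc)
    qed (use \<open>\<epsilon> > 0\<close> K_nonneg in simp)
    then have "norm2 W \<Phi> * norm1 W (\<psi> - rep f) \<le> norm2 W \<Phi> * (\<epsilon> * K)"
      by (intro mult_left_mono dual_norm_nonneg[OF seminormed1 \<Phi>])
    moreover have "cmod (\<Phi> (\<psi> - rep f)) \<le> norm2 W \<Phi> * norm1 W (\<psi> - rep f)"
      using \<psi> rep_dual(1)[OF f(1)] dual_intros by (intro bidual_apply_bound[OF \<Phi>]) auto
    moreover have "\<Phi> (\<psi> - rep f) = \<Phi> \<psi>"
      using bidual_lin(3)[OF \<Phi> \<psi> rep_dual(1)[OF f(1)]] rep_zero[OF f(1)] by simp
    ultimately show ?thesis
      by (simp add: mult_ac)
  qed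
  moreover have "0 \<le> norm2 W \<Phi> * K"
    using K_nonneg dual_norm_nonneg[OF seminormed1 \<Phi>] by simp
  ultimately have "cmod (\<Phi> \<psi>) \<le> 0"
    by (rule nonpos_of_le_eps)
  then show ?thesis by simp
qed

text \<open>Both sides are bounded and linear in \<open>\<psi>\<close>, so a positive \<open>\<psi> = p\<close> may be assumed. Replacing \<open>\<Lambda>\<close> by an approximating
  element \<open>f\<close> of \<open>W\<close> as in \<open>bidual_approx\<close>, both sides become \<open>\<Gamma> (c \<mapsto> p (f c))\<close>, because
  \<open>\<Gamma> (c \<mapsto> p (b c))\<close> as a function of \<open>b\<close>, and \<open>b \<mapsto> p (b c)\<close> for each \<open>c\<close>, are bounded by the form.\<close>

theorem arens_regular:
  assumes \<Lambda>: "\<Lambda> \<in> bidual W" and \<Gamma>: "\<Gamma> \<in> bidual W" and \<psi>: "\<psi> \<in> dual W"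
  shows "arens_mult W \<Lambda> \<Gamma> \<psi> = \<Gamma> (right_action W \<psi> \<Lambda>)"
proof -
  define \<Phi> where "\<Phi> = arens_mult W \<Lambda> \<Gamma> - cutoff (dual W) (\<lambda>\<phi>. \<Gamma> (right_action W \<phi> \<Lambda>))"
  have \<Phi>: "\<Phi> \<in> bidual W"
    unfolding \<Phi>_def using arens_in_bidual(1)[OF \<Lambda> \<Gamma>] second_arens_in_bidual[OF \<Lambda> \<Gamma>] bidual_intros by simp
  have "\<Phi> p = 0" if p: "positive p" for p
  proof -
    note pd = positive_dual[OF p]
    define K where "K = sqrt (norm1 W p)"
    interpret bounded_form W "\<lambda>x y. p (x o\<^sub>L y\<^sup>\<star>)" norm K
      unfolding K_def by (rule positive_bounded_form[OF p])
    define h where "h = bidual_action W \<Gamma> p"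
    define C where "C = norm2 W \<Gamma> * K"
    have C: "C \<ge> 0"
      using K_nonneg dual_norm_nonneg[OF seminormed1 \<Gamma>] by (simp add: C_def)
    have h_len: "cmod (h b) \<le> C * len b" if b: "b \<in> W" for b
    proof -
      have "norm1 W (functional_mult W p b) \<le> len b * K"
      proof (rule dual_norm_le[OF seminormed])
        show "cmod (functional_mult W p b c) \<le> len b * K * norm c" if c: "c \<in> W" for c
        proof -
          have "cmod (p (b o\<^sub>L c)) \<le> len b * len (c\<^sup>\<star>)"
            using cauchy_schwarz[OF b star_in[OF c]] by (simp add: star_star c)
          also have "\<dots> \<le> len b * (K * norm (c\<^sup>\<star>))"
            using len_le[OF star_in[OF c]] len_nonneg[OF b] by (rule mult_left_mono)
          finally show ?thesis
            using c by (simp add: functional_mult_def norm_star mult.assoc)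
        qed
      qed (use len_nonneg[OF b] K_nonneg in simp)
      then have "norm2 W \<Gamma> * norm1 W (functional_mult W p b) \<le> norm2 W \<Gamma> * (len b * K)"
        by (intro mult_left_mono dual_norm_nonneg[OF seminormed1 \<Gamma>])
      moreover have "cmod (h b) \<le> norm2 W \<Gamma> * norm1 W (functional_mult W p b)"
        unfolding h_def action_apply[OF b] by (intro bidual_apply_bound[OF \<Gamma>] functional_mult_in_dual pd b)
      ultimately show ?thesis
        by (simp add: C_def mult_ac)
    qed
    have right_mult_rep: "right_mult W p c = rep (c\<^sup>\<star>)" if "c \<in> W" for c
      using that by (simp add: right_mult_def rep_def star_star)
    have "cmod (\<Phi> p) \<le> \<epsilon> * (2 * C)" if "\<epsilon> > 0" for \<epsilon>
    proof -
      obtain f where f: "f \<in> W" and approx: "\<And>h c. h \<in> dual W \<Longrightarrow> c \<ge> 0 \<Longrightarrow>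
          (\<And>x. x \<in> W \<Longrightarrow> cmod (h x) \<le> c * len x) \<Longrightarrow> cmod (\<Lambda> h - h f) \<le> \<epsilon> * c"
        using bidual_approx[OF \<Lambda> \<open>\<epsilon> > 0\<close>] by metis
      have hd: "h \<in> dual W"
        unfolding h_def by (rule action_in_dual(1)[OF \<Gamma> pd])
      have 1: "cmod (\<Lambda> h - h f) \<le> \<epsilon> * C"
        by (rule approx[OF hd C h_len])
      have "norm1 W (right_action W p \<Lambda> - functional_mult W p f) \<le> \<epsilon> * K"
      proof (rule dual_norm_le[OF seminormed])
        show "cmod ((right_action W p \<Lambda> - functional_mult W p f) c) \<le> \<epsilon> * K * norm c" if c: "c \<in> W" for c
        proof -
          have "cmod (\<Lambda> (rep (c\<^sup>\<star>)) - rep (c\<^sup>\<star>) f) \<le> \<epsilon> * len (c\<^sup>\<star>)"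
            using cauchy_schwarz[OF _ star_in[OF c]]
            by (intro approx rep_dual len_nonneg star_in c) (auto simp: rep_def cutoff_def mult.commute)
          also have "\<dots> \<le> \<epsilon> * (K * norm (c\<^sup>\<star>))"
            using len_le[OF star_in[OF c]] \<open>\<epsilon> > 0\<close> by (intro mult_left_mono) auto
          finally show ?thesis
            using c f by (simp add: right_action_def cutoff_def right_mult_rep functional_mult_def norm_star
                mult.assoc star_star rep_def)
        qed
      qed (use \<open>\<epsilon> > 0\<close> K_nonneg in simp)
      then have "norm2 W \<Gamma> * norm1 W (right_action W p \<Lambda> - functional_mult W p f) \<le> norm2 W \<Gamma> * (\<epsilon> * K)"
        by (intro mult_left_mono dual_norm_nonneg[OF seminormed1 \<Gamma>])
      moreover have "cmod (\<Gamma> (right_action W p \<Lambda> - functional_mult W p f))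
          \<le> norm2 W \<Gamma> * norm1 W (right_action W p \<Lambda> - functional_mult W p f)"
        by (intro bidual_apply_bound[OF \<Gamma>] dual_intros right_action_in_dual functional_mult_in_dual \<Lambda> pd f)
      moreover have "\<Gamma> (right_action W p \<Lambda> - functional_mult W p f) = \<Gamma> (right_action W p \<Lambda>) - h f"
        unfolding h_def action_apply[OF f]
        by (intro bidual_lin(3)[OF \<Gamma>] right_action_in_dual functional_mult_in_dual \<Lambda> pd f)
      ultimately have 2: "cmod (\<Gamma> (right_action W p \<Lambda>) - h f) \<le> \<epsilon> * C"
        by (simp add: C_def mult_ac)
      have "\<Phi> p = (\<Lambda> h - h f) - (\<Gamma> (right_action W p \<Lambda>) - h f)"
        using pd by (simp add: \<Phi>_def h_def arens_apply cutoff_def)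
      then have "cmod (\<Phi> p) \<le> cmod (\<Lambda> h - h f) + cmod (\<Gamma> (right_action W p \<Lambda>) - h f)"
        by (simp only: norm_triangle_ineq4)
      with 1 2 show ?thesis
        by linarith
    qed
    moreover have "0 \<le> 2 * C"
      using C by simp
    ultimately have "cmod (\<Phi> p) \<le> 0"
      by (rule nonpos_of_le_eps)
    then show ?thesis by simp
  qed
  then have "\<Phi> \<psi> = 0"
    using bidual_zero_of_positive[OF \<Phi> _ \<psi>] by blast
  then show ?thesis
    using \<psi> by (simp add: \<Phi>_def cutoff_def)
qed

section \<open>The C*-inequality in the bidual\<close>

lemma functional_star_linear:
  "functional_star W (\<phi> + \<psi>) = functional_star W \<phi> + functional_star W \<psi>"
  "functional_star W (c *\<^sub>C \<phi>) = cnj c *\<^sub>C functional_star W \<phi>"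
  by (auto simp: fun_eq_iff functional_star_def)

lemma functional_star_star: "\<psi> \<in> dual W \<Longrightarrow> functional_star W (functional_star W \<psi>) = \<psi>"
  by (auto simp: fun_eq_iff functional_star_def star_in star_star dual_space_outside)

lemma functional_star_positive: "positive p \<Longrightarrow> functional_star W p = p"
  by (auto simp: fun_eq_iff functional_star_def positive_star dual_space_outside[OF positive_dual])

lemma bidual_star_apply: "\<psi> \<in> dual W \<Longrightarrow> bidual_star W \<Lambda> \<psi> = cnj (\<Lambda> (functional_star W \<psi>))"
  by (simp add: bidual_star_def)

lemma bidual_star_in_bidual:
  assumes \<Lambda>: "\<Lambda> \<in> bidual W"
  shows "bidual_star W \<Lambda> \<in> bidual W"
proof (rule dual_spaceI[of _ _ "norm2 W \<Lambda>"])
  show "clinear_on (dual W) (bidual_star W \<Lambda>)"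
    using dual_intros functional_star_in_dual(1)
    by (simp add: clinear_on_def bidual_star_apply functional_star_linear bidual_lin[OF \<Lambda>])
  show "cmod (bidual_star W \<Lambda> \<psi>) \<le> norm2 W \<Lambda> * norm1 W \<psi>" if "\<psi> \<in> dual W" for \<psi>
    using order_trans[OF bidual_apply_bound[OF \<Lambda> functional_star_in_dual(1)[OF that]]
        mult_left_mono[OF functional_star_in_dual(2)[OF that] dual_norm_nonneg[OF seminormed1 \<Lambda>]]] that
    by (simp add: bidual_star_apply)
qed (simp add: bidual_star_def)

text \<open>For \<open>\<phi>\<close> dominated by the positive functional \<open>p\<close>, Cauchy--Schwarz for the form \<open>p (x y\<^sup>\<star>)\<close> extends to
  \<open>\<bar>\<Lambda> \<phi>\<bar>\<^sup>2 \<le> \<bar>(\<Lambda> \<Lambda>\<^sup>\<star>) p\<bar>\<close>, and \<open>\<parallel>p\<parallel> \<le> \<parallel>\<phi>\<parallel>\<^sup>2\<close>.\<close>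

theorem cstar_inequality:
  assumes \<Lambda>: "\<Lambda> \<in> bidual W"
  shows "(norm2 W \<Lambda>)\<^sup>2 \<le> norm2 W (arens_mult W \<Lambda> (bidual_star W \<Lambda>))"
proof -
  define S where "S = bidual_star W \<Lambda>"
  define n where "n = norm2 W (arens_mult W \<Lambda> S)"
  have S: "S \<in> bidual W"
    unfolding S_def by (rule bidual_star_in_bidual[OF \<Lambda>])
  have n: "0 \<le> n"
    unfolding n_def by (rule dual_norm_nonneg[OF seminormed1 arens_in_bidual(1)[OF \<Lambda> S]])
  have "cmod (\<Lambda> \<phi>) \<le> sqrt n * norm1 W \<phi>" if \<phi>: "\<phi> \<in> dual W" for \<phi>
  proof (rule power2_le_imp_le)
    show nonneg: "0 \<le> sqrt n * norm1 W \<phi>"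
      using n dual_norm_nonneg[OF seminormed \<phi>] by simp
    obtain p where p: "positive p" and norm_p: "norm1 W p \<le> (norm1 W \<phi>)\<^sup>2"
      and dom: "\<And>x. x \<in> W \<Longrightarrow> (cmod (\<phi> x))\<^sup>2 \<le> Re (p (x o\<^sub>L x\<^sup>\<star>))"
      using exists_dominating_positive[OF \<phi> dual_apply_bound[OF \<phi>] dual_norm_nonneg[OF seminormed \<phi>]] by blast
    note pd = positive_dual[OF p]
    interpret bounded_form W "\<lambda>x y. p (x o\<^sub>L y\<^sup>\<star>)" norm "sqrt (norm1 W p)"
      by (rule positive_bounded_form[OF p])
    have "cmod (\<phi> x) \<le> len x" if "x \<in> W" for x
      using dom[OF that] real_le_rsqrt by (simp add: len_def)
    then have "(cmod (\<Lambda> \<phi>))\<^sup>2 \<le> cmod (\<Lambda> (cutoff W (\<lambda>y. cnj (\<Lambda> (rep y)))))"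
      by (rule bidual_cauchy_schwarz[OF \<Lambda> \<phi>])
    also have "cutoff W (\<lambda>y. cnj (\<Lambda> (rep y))) = bidual_action W S p"
    proof
      have "functional_star W (functional_mult W p y) = rep y" if "y \<in> W" for y
      proof
        show "functional_star W (functional_mult W p y) x = rep y x" for x
          using that W_intros positive_star[OF p, of "y o\<^sub>L x\<^sup>\<star>"]
          by (cases "x \<in> W")
             (simp_all add: functional_star_def functional_mult_def rep_def cutoff_def star_mult star_star)
      qed
      then show "cutoff W (\<lambda>y. cnj (\<Lambda> (rep y))) y = bidual_action W S p y" for y
        using functional_mult_in_dual(1)[OF pd, of y]
        by (simp add: cutoff_def bidual_action_def S_def bidual_star_apply)
    qed
    also have "cmod (\<Lambda> (bidual_action W S p)) = cmod (arens_mult W \<Lambda> S p)"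
      using pd by (simp add: arens_apply)
    also have "\<dots> \<le> n * norm1 W p"
      unfolding n_def by (rule bidual_apply_bound[OF arens_in_bidual(1)[OF \<Lambda> S] pd])
    also have "\<dots> \<le> n * (norm1 W \<phi>)\<^sup>2"
      using norm_p n by (rule mult_left_mono)
    also have "\<dots> = (sqrt n * norm1 W \<phi>)\<^sup>2"
      using n by (simp add: power_mult_distrib)
    finally show "(cmod (\<Lambda> \<phi>))\<^sup>2 \<le> (sqrt n * norm1 W \<phi>)\<^sup>2" .
  qed
  then have "norm2 W \<Lambda> \<le> sqrt n"
    using n by (intro dual_norm_le[OF seminormed1]) auto
  then have "(norm2 W \<Lambda>)\<^sup>2 \<le> (sqrt n)\<^sup>2"
    by (intro power_mono dual_norm_nonneg[OF seminormed1 \<Lambda>])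
  then show ?thesis
    using n by (simp add: n_def S_def)
qed

lemma bidual_star_star: "\<Lambda> \<in> bidual W \<Longrightarrow> bidual_star W (bidual_star W \<Lambda>) = \<Lambda>"
  by (auto simp: fun_eq_iff bidual_star_def functional_star_in_dual functional_star_star dual_space_outside)

lemma bidual_star_add: "bidual_star W (\<Lambda> + \<Gamma>) = bidual_star W \<Lambda> + bidual_star W \<Gamma>"
  and bidual_star_diff: "bidual_star W (\<Lambda> - \<Gamma>) = bidual_star W \<Lambda> - bidual_star W \<Gamma>"
  by (auto simp: fun_eq_iff bidual_star_def)

lemma bidual_star_unit: "bidual_star W (bidual_unit W) = bidual_unit W"
  using functional_star_in_dual(1) id_in
  by (auto simp: fun_eq_iff bidual_star_def bidual_unit_def functional_star_def star_id)

lemma bidual_star_mult_evaluation: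
  assumes \<Lambda>: "\<Lambda> \<in> bidual W" and c: "c \<in> W"
  shows "bidual_star W (arens_mult W \<Lambda> (evaluation W c)) = arens_mult W (evaluation W (c\<^sup>\<star>)) (bidual_star W \<Lambda>)"
proof
  fix \<psi>
  show "bidual_star W (arens_mult W \<Lambda> (evaluation W c)) \<psi>
      = arens_mult W (evaluation W (c\<^sup>\<star>)) (bidual_star W \<Lambda>) \<psi>"
  proof (cases "\<psi> \<in> dual W")
    case True
    note \<psi>' = functional_star_in_dual(1)[OF True]
    have "bidual_action W (evaluation W c) (functional_star W \<psi>) = functional_star W (functional_mult W \<psi> (c\<^sup>\<star>))"
    proof
      show "bidual_action W (evaluation W c) (functional_star W \<psi>) x
          = functional_star W (functional_mult W \<psi> (c\<^sup>\<star>)) x" for x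
        using c W_intros functional_mult_in_dual(1)[OF \<psi>', of x]
        by (cases "x \<in> W")
           (simp_all add: action_apply evaluation_apply,
            simp_all add: functional_mult_def functional_star_def bidual_action_def star_mult)
    qed
    then show ?thesis
      using True \<psi>' c W_intros functional_mult_in_dual(1)[OF True star_in[OF c]]
        action_in_dual(1)[OF bidual_star_in_bidual[OF \<Lambda>] True]
      by (simp add: bidual_star_apply arens_apply evaluation_apply action_apply)
  qed (simp add: bidual_star_def arens_mult_def)
qed

text \<open>Since \<open>z\<close> is self-adjoint, the elements of \<open>W\<close> commuting with it form a \<open>\<star>\<close>-algebra. Hence
  \<open>F c d = z c + (1 - z) d\<close> satisfies \<open>F c d (F c d)\<^sup>\<star> = F (c c\<^sup>\<star>) (d d\<^sup>\<star>)\<close> for commuting contractions \<open>c\<close> and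
  \<open>d\<close>, and the norms of all these elements are at most \<open>\<parallel>z\<parallel> + \<parallel>1 - z\<parallel>\<close>. Iterating the C*-inequality improves
  this bound to 1.\<close>

lemma norm_split_le_one:
  assumes z: "z \<in> bidual W" and idem: "arens_mult W z z = z" and self_adjoint: "bidual_star W z = z"
    and a: "a \<in> W" "norm a \<le> 1" "arens_mult W z (evaluation W a) = arens_mult W (evaluation W a) z"
    and b: "b \<in> W" "norm b \<le> 1" "arens_mult W z (evaluation W b) = arens_mult W (evaluation W b) z"
  shows "norm2 W (arens_mult W z (evaluation W a) + arens_mult W (bidual_unit W - z) (evaluation W b)) \<le> 1"
proof -
  define ev where "ev = evaluation W"
  define mul (infixl "\<odot>" 70) where "mul = arens_mult W"
  define w where "w = bidual_unit W - z"
  define Z where "Z = {c \<in> W. z \<odot> ev c = ev c \<odot> z}"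
  define F where "F c d = z \<odot> ev c + w \<odot> ev d" for c d
  have ev: "ev c \<in> bidual W" "norm2 W (ev c) \<le> norm c" if "c \<in> W" for c
    using evaluation_in_bidual that by (auto simp: ev_def)
  have mul: "\<Lambda> \<odot> \<Gamma> \<in> bidual W" "norm2 W (\<Lambda> \<odot> \<Gamma>) \<le> norm2 W \<Lambda> * norm2 W \<Gamma>"
    if "\<Lambda> \<in> bidual W" "\<Gamma> \<in> bidual W" for \<Lambda> \<Gamma>
    using arens_in_bidual that by (auto simp: mul_def)
  have assoc: "(\<Lambda> \<odot> \<Gamma>) \<odot> \<Delta> = \<Lambda> \<odot> (\<Gamma> \<odot> \<Delta>)" if "\<Gamma> \<in> bidual W" "\<Delta> \<in> bidual W" for \<Lambda> \<Gamma> \<Delta>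
    using arens_assoc that by (auto simp: mul_def)
  have w: "w \<in> bidual W"
    unfolding w_def using bidual_unit_in z bidual_intros by blast
  have zz: "z \<odot> z = z" and zw: "z \<odot> w = 0" and wz: "w \<odot> z = 0" and ww: "w \<odot> w = w"
    using idem z bidual_unit_in bidual_intros
    by (simp_all add: mul_def w_def arens_diff_left arens_diff_right arens_unit_left arens_unit_right)
  have star_w: "bidual_star W w = w"
    by (simp add: w_def bidual_star_diff bidual_star_unit self_adjoint)
  have ZW: "c \<in> W" and Zz: "z \<odot> ev c = ev c \<odot> z" and Zw: "w \<odot> ev c = ev c \<odot> w" if "c \<in> Z" for c
    using that z bidual_unit_in ev(1)[of c]
    by (auto simp: Z_def w_def mul_def arens_diff_left arens_diff_right arens_unit_left arens_unit_right)
  have Z_star: "c\<^sup>\<star> \<in> Z" if "c \<in> Z" for c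
  proof -
    have "ev (c\<^sup>\<star>) \<odot> z = bidual_star W (z \<odot> ev c)"
      using bidual_star_mult_evaluation[OF z ZW[OF that]] by (simp add: mul_def ev_def self_adjoint)
    also have "\<dots> = bidual_star W (bidual_star W (z \<odot> ev (c\<^sup>\<star>)))"
      using bidual_star_mult_evaluation[OF z star_in[OF ZW[OF that]]] ZW[OF that] Zz[OF that]
      by (simp add: mul_def ev_def self_adjoint star_star)
    also have "\<dots> = z \<odot> ev (c\<^sup>\<star>)"
      using mul(1)[OF z ev(1)[OF star_in[OF ZW[OF that]]]] by (rule bidual_star_star)
    finally show ?thesis
      using ZW[OF that] star_in by (simp add: Z_def)
  qed
  have ev_mult: "ev c \<odot> ev d = ev (c o\<^sub>L d)" if "c \<in> W" "d \<in> W" for c d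
    using evaluation_mult that by (simp add: ev_def mul_def)
  have Z_mult: "c o\<^sub>L d \<in> Z" if "c \<in> Z" "d \<in> Z" for c d
  proof -
    have cd: "c \<in> W" "d \<in> W" "z \<odot> ev c = ev c \<odot> z" "z \<odot> ev d = ev d \<odot> z"
      using that ZW Zz by auto
    have "z \<odot> (ev c \<odot> ev d) = (z \<odot> ev c) \<odot> ev d"
      using ev(1) cd by (intro assoc[symmetric])
    also have "\<dots> = ev c \<odot> (z \<odot> ev d)"
      unfolding cd(3) using ev(1) cd z by (intro assoc)
    also have "\<dots> = (ev c \<odot> ev d) \<odot> z"
      unfolding cd(4) using ev(1) cd z by (intro assoc[symmetric])
    finally show ?thesis
      using cd mult_closed by (simp add: Z_def ev_mult)
  qed
  have F_in: "F c d \<in> bidual W" if "c \<in> W" "d \<in> W" for c d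
    unfolding F_def using that by (intro bidual_intros(1) mul(1) ev(1) z w)
  have F_star: "bidual_star W (F c d) = F (c\<^sup>\<star>) (d\<^sup>\<star>)" if "c \<in> Z" "d \<in> Z" for c d
    using bidual_star_mult_evaluation[OF z ZW[OF that(1)]] bidual_star_mult_evaluation[OF w ZW[OF that(2)]]
      Zz[OF Z_star[OF that(1)]] Zw[OF Z_star[OF that(2)]]
    by (simp add: F_def bidual_star_add self_adjoint star_w mul_def ev_def)
  have F_mult: "F c d \<odot> F c' d' = F (c o\<^sub>L c') (d o\<^sub>L d')" if "c \<in> Z" "d \<in> Z" "c' \<in> W" "d' \<in> W" for c d c' d'
  proof -
    have one: "(u \<odot> ev e) \<odot> (v \<odot> ev e') = (u \<odot> v) \<odot> ev (e o\<^sub>L e')"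
      if "u \<in> bidual W" "v \<in> bidual W" "e \<in> W" "e' \<in> W" "v \<odot> ev e = ev e \<odot> v" for u v e e'
    proof -
      have "(u \<odot> ev e) \<odot> (v \<odot> ev e') = u \<odot> (ev e \<odot> (v \<odot> ev e'))"
        using that ev(1) mul(1) by (intro assoc) auto
      also have "ev e \<odot> (v \<odot> ev e') = (v \<odot> ev e) \<odot> ev e'"
        unfolding that(5) using that ev(1) by (intro assoc[symmetric]) auto
      also have "\<dots> = v \<odot> ev (e o\<^sub>L e')"
        unfolding ev_mult[OF that(3,4), symmetric] using that ev(1) by (intro assoc) auto
      also have "u \<odot> (v \<odot> ev (e o\<^sub>L e')) = (u \<odot> v) \<odot> ev (e o\<^sub>L e')"
        using that ev(1) mult_closed by (intro assoc[symmetric]) auto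
      finally show ?thesis .
    qed
    have add_left: "(\<Lambda> + \<Lambda>') \<odot> \<Gamma> = \<Lambda> \<odot> \<Gamma> + \<Lambda>' \<odot> \<Gamma>" for \<Lambda> \<Lambda>' \<Gamma>
      by (simp add: mul_def arens_add_left)
    have add_right: "\<Lambda> \<odot> (\<Gamma> + \<Gamma>') = \<Lambda> \<odot> \<Gamma> + \<Lambda> \<odot> \<Gamma>'"
      if "\<Lambda> \<in> bidual W" "\<Gamma> \<in> bidual W" "\<Gamma>' \<in> bidual W" for \<Lambda> \<Gamma> \<Gamma>'
      using arens_add_right[OF that] by (simp add: mul_def)
    have zero: "0 \<odot> \<Gamma> = 0" for \<Gamma>
      by (auto simp: mul_def arens_mult_def fun_eq_iff)
    show ?thesis
    proof -
      have cd: "c \<in> W" "d \<in> W"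
        using that ZW by auto
      have "F c d \<odot> F c' d' = ((z \<odot> ev c) \<odot> (z \<odot> ev c') + (z \<odot> ev c) \<odot> (w \<odot> ev d'))
          + ((w \<odot> ev d) \<odot> (z \<odot> ev c') + (w \<odot> ev d) \<odot> (w \<odot> ev d'))"
      proof -
        have m: "z \<odot> ev c \<in> bidual W" "w \<odot> ev d \<in> bidual W" "z \<odot> ev c' \<in> bidual W" "w \<odot> ev d' \<in> bidual W"
          using that cd z w ev(1) mul(1) by auto
        show ?thesis
          by (simp only: F_def add_left add_right[OF m(1,3,4)] add_right[OF m(2-4)])
      qed
      also have "\<dots> = F (c o\<^sub>L c') (d o\<^sub>L d')"
        using one[OF z z cd(1) that(3) Zz[OF that(1)]] one[OF z w cd(1) that(4) Zw[OF that(1)]]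
          one[OF w z cd(2) that(3) Zz[OF that(2)]] one[OF w w cd(2) that(4) Zw[OF that(2)]]
        by (simp only: zz zw wz ww zero F_def add_0_left add_0_right)
      finally show ?thesis .
    qed
  qed
  define s where "s n y = ((\<lambda>y. y o\<^sub>L y\<^sup>\<star>) ^^ n) y" for n and y :: "'h op"
  have s: "s n y \<in> Z \<and> norm (s n y) \<le> 1" if "y \<in> Z" "norm y \<le> 1" for n y
    by (induction n) (auto simp: s_def that intro: Z_mult Z_star norm_mult_star_le ZW)
  have ab: "a \<in> Z" "b \<in> Z"
    using a b by (auto simp: Z_def mul_def ev_def)
  note sa = s[OF ab(1) a(2)] and sb = s[OF ab(2) b(2)]
  have "norm2 W (F (s 0 a) (s 0 b)) \<le> 1"
  proof (rule bounded_doubling_sequence[where u = "\<lambda>n. norm2 W (F (s n a) (s n b))"])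
    show "(norm2 W (F (s n a) (s n b)))\<^sup>2 \<le> 1 * norm2 W (F (s (Suc n) a) (s (Suc n) b))" for n
    proof -
      have "F (s n a) (s n b) \<odot> bidual_star W (F (s n a) (s n b)) = F (s (Suc n) a) (s (Suc n) b)"
        using sa[of n] sb[of n] ZW Z_star by (simp add: F_star F_mult s_def)
      then show ?thesis
        using cstar_inequality[OF F_in[of "s n a" "s n b"]] sa[of n] sb[of n] ZW by (simp add: mul_def)
    qed
    show "norm2 W (F (s n a) (s n b)) \<le> norm2 W z + norm2 W w" for n
    proof -
      have one: "norm2 W (u \<odot> ev e) \<le> norm2 W u" if "u \<in> bidual W" "e \<in> W" "norm e \<le> 1" for u e
      proof -
        have "norm2 W (u \<odot> ev e) \<le> norm2 W u * norm2 W (ev e)"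
          by (rule mul(2)[OF that(1) ev(1)[OF that(2)]])
        also have "\<dots> \<le> norm2 W u * 1"
          using ev(2)[OF that(2)] that(3) dual_norm_nonneg[OF seminormed1 that(1)] by (intro mult_left_mono) auto
        finally show ?thesis by simp
      qed
      have "norm2 W (F (s n a) (s n b)) \<le> norm2 W (z \<odot> ev (s n a)) + norm2 W (w \<odot> ev (s n b))"
        unfolding F_def using sa[of n] sb[of n] ZW ev(1) z w mul(1) by (intro seminormedD(2)[OF seminormed2]) auto
      also have "\<dots> \<le> norm2 W z + norm2 W w"
        using sa[of n] sb[of n] ZW z w by (intro add_mono one) auto
      finally show ?thesis .
    qed
  qed simp
  then show ?thesis
    by (simp add: s_def F_def mul_def ev_def w_def)
qed

end

section \<open>Central projections and norm-additive idempotents\<close>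

lemma eq_zero_of_diff_eq_self: "(x :: 'a::ab_group_add) - y = x \<Longrightarrow> y = 0"
  by simp

locale operator_subalgebra = W: star_operator_algebra W + A: operator_algebra A
  for W A :: "'h::complex_hilbert op set" +
  assumes subset: "A \<subseteq> W"
begin

lemma restrict_in_dual:
  assumes \<psi>: "\<psi> \<in> dual W"
  shows "cutoff A \<psi> \<in> dual A" and "norm1 A (cutoff A \<psi>) \<le> norm1 W \<psi>"
  using transpose_in_dual[OF A.seminormed W.seminormed \<psi>, of "\<lambda>a. a" 1] subset
  by (auto simp: clinear_on_def)

lemma extend_from_subalgebra:
  assumes \<phi>: "\<phi> \<in> dual A"
  shows "\<exists>\<psi>\<in>dual W. cutoff A \<psi> = \<phi> \<and> norm1 W \<psi> \<le> norm1 A \<phi>"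
proof -
  note pos = dual_norm_nonneg[OF A.seminormed \<phi>]
  obtain \<psi> where \<psi>: "\<psi> \<in> dual W" "\<And>a. a \<in> A \<Longrightarrow> \<psi> a = \<phi> a"
    "\<And>x. x \<in> W \<Longrightarrow> cmod (\<psi> x) \<le> norm1 A \<phi> * norm x"
    using hahn_banach_extension[OF W.seminormed A.cspace subset dual_space_linear(1)[OF \<phi>]
        A.dual_apply_bound[OF \<phi>] pos] by blast
  have "cutoff A \<psi> = \<phi>"
    using \<psi>(2) by (auto simp: fun_eq_iff cutoff_def dual_space_outside[OF \<phi>])
  moreover have "norm1 W \<psi> \<le> norm1 A \<phi>"
    by (rule dual_norm_le[OF W.seminormed pos \<psi>(3)])
  ultimately show ?thesis
    using \<psi>(1) by blast
qed

abbreviation incl :: "(('h op \<Rightarrow> complex) \<Rightarrow> complex) \<Rightarrow> (('h op \<Rightarrow> complex) \<Rightarrow> complex)" where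
  "incl \<equiv> bidual_inclusion W A"

lemma incl_apply: "\<psi> \<in> dual W \<Longrightarrow> incl \<Lambda> \<psi> = \<Lambda> (cutoff A \<psi>)"
  by (simp add: bidual_inclusion_def cutoff_def)

lemma incl_in_bidual:
  assumes \<Lambda>: "\<Lambda> \<in> bidual A"
  shows "incl \<Lambda> \<in> bidual W" and "norm2 W (incl \<Lambda>) \<le> norm2 A \<Lambda>"
proof -
  have "incl \<Lambda> = cutoff (dual W) (\<lambda>\<psi>. \<Lambda> (cutoff A \<psi>))"
    by (simp add: bidual_inclusion_def cutoff_def)
  moreover have "clinear_on (dual W) (cutoff A)"
    by (auto simp: clinear_on_def cutoff_def fun_eq_iff)
  ultimately show "incl \<Lambda> \<in> bidual W" "norm2 W (incl \<Lambda>) \<le> norm2 A \<Lambda>"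
    using transpose_in_dual[OF W.seminormed1 A.seminormed1 \<Lambda>, of "cutoff A" 1]
    by (simp_all add: restrict_in_dual)
qed

lemma restrict_functional_mult: "a \<in> A \<Longrightarrow> cutoff A (functional_mult W \<psi> a) = functional_mult A (cutoff A \<psi>) a"
  using subset A.mult_closed by (auto simp: fun_eq_iff cutoff_def functional_mult_def)

lemma restrict_right_mult: "a \<in> A \<Longrightarrow> cutoff A (right_mult W \<psi> a) = right_mult A (cutoff A \<psi>) a"
  using subset A.mult_closed by (auto simp: fun_eq_iff cutoff_def right_mult_def)

lemma restrict_action:
  assumes "\<psi> \<in> dual W"
  shows "cutoff A (bidual_action W (incl \<Lambda>) \<psi>) = bidual_action A \<Lambda> (cutoff A \<psi>)"
proof
  show "cutoff A (bidual_action W (incl \<Lambda>) \<psi>) a = bidual_action A \<Lambda> (cutoff A \<psi>) a" for a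
  proof (cases "a \<in> A")
    case True
    then show ?thesis
      using subset W.functional_mult_in_dual(1)[OF assms, of a]
      by (auto simp: cutoff_apply W.action_apply A.action_apply incl_apply restrict_functional_mult)
  qed (simp add: cutoff_def bidual_action_def)
qed

lemma restrict_right_action:
  assumes "\<psi> \<in> dual W"
  shows "cutoff A (right_action W \<psi> (incl \<Lambda>)) = right_action A (cutoff A \<psi>) \<Lambda>"
proof
  show "cutoff A (right_action W \<psi> (incl \<Lambda>)) a = right_action A (cutoff A \<psi>) \<Lambda> a" for a
  proof (cases "a \<in> A")
    case True
    then have "a \<in> W"
      using subset by auto
    with True show ?thesis
      using W.right_mult_in_dual(1)[OF assms, of a]
      by (simp add: right_action_def cutoff_apply incl_apply restrict_right_mult)
  qed (simp add: cutoff_def right_action_def)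
qed

lemma incl_arens:
  assumes "\<Gamma> \<in> bidual A"
  shows "incl (arens_mult A \<Lambda> \<Gamma>) = arens_mult W (incl \<Lambda>) (incl \<Gamma>)"
proof
  show "incl (arens_mult A \<Lambda> \<Gamma>) \<psi> = arens_mult W (incl \<Lambda>) (incl \<Gamma>) \<psi>" for \<psi>
  proof (cases "\<psi> \<in> dual W")
    case True
    then show ?thesis
      using restrict_in_dual(1)[OF True] W.action_in_dual(1)[OF incl_in_bidual(1)[OF assms] True]
      by (simp add: incl_apply A.arens_apply W.arens_apply restrict_action)
  qed (simp add: bidual_inclusion_def arens_mult_def)
qed

lemma incl_evaluation:
  assumes "a \<in> A"
  shows "incl (evaluation A a) = evaluation W a"
proof
  show "incl (evaluation A a) \<psi> = evaluation W a \<psi>" for \<psi>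
    using assms restrict_in_dual(1)[of \<psi>]
    by (cases "\<psi> \<in> dual W")
       (simp_all add: incl_apply A.evaluation_apply W.evaluation_apply cutoff_apply,
        simp_all add: bidual_inclusion_def evaluation_def cutoff_def)
qed

text \<open>The density of the positive functionals, transported from \<open>W\<close> to \<open>A\<close>: functionals on \<open>A\<close> extend to \<open>W\<close>.\<close>

lemma operator_zero_of_positive:
  assumes T: "clinear_on (dual A) T" "\<And>\<phi>. \<phi> \<in> dual A \<Longrightarrow> T \<phi> \<in> dual A"
    and bound: "\<And>\<phi>. \<phi> \<in> dual A \<Longrightarrow> norm1 A (T \<phi>) \<le> C * norm1 A \<phi>" "0 \<le> C"
    and zero: "\<And>p. W.positive p \<Longrightarrow> T (cutoff A p) = 0" and \<phi>: "\<phi> \<in> dual A"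
  shows "T \<phi> = 0"
proof
  fix a
  show "T \<phi> a = 0 a"
  proof (cases "a \<in> A")
    case True
    define \<Phi> where "\<Phi> = cutoff (dual A) (\<lambda>\<phi>. evaluation A a (T \<phi>))"
    have "\<Phi> \<in> bidual A"
      unfolding \<Phi>_def
      by (rule transpose_in_dual(1)[OF A.seminormed1 A.seminormed1 A.evaluation_in_bidual(1)[OF True] T(1)];
          rule T(2) bound)
    then have \<Phi>: "incl \<Phi> \<in> bidual W"
      by (rule incl_in_bidual)
    have "incl \<Phi> p = 0" if "W.positive p" for p
      using zero[OF that] W.positive_dual[OF that] restrict_in_dual(1)
        dual_space_zero[OF A.seminormed1 A.evaluation_in_bidual(1)[OF True]]
      by (simp add: incl_apply \<Phi>_def cutoff_apply)
    moreover obtain \<psi> where \<psi>: "\<psi> \<in> dual W" "cutoff A \<psi> = \<phi>"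
      using extend_from_subalgebra[OF \<phi>] by blast
    ultimately have "incl \<Phi> \<psi> = 0"
      using W.bidual_zero_of_positive[OF \<Phi>] by blast
    then show ?thesis
      using \<psi> \<phi> by (simp add: incl_apply \<Phi>_def cutoff_apply A.evaluation_apply T(2))
  qed (use dual_space_outside[OF T(2)[OF \<phi>]] in simp)
qed

lemma arens_regular_subalgebra:
  assumes \<Lambda>: "\<Lambda> \<in> bidual A" and \<Gamma>: "\<Gamma> \<in> bidual A" and \<phi>: "\<phi> \<in> dual A"
  shows "arens_mult A \<Lambda> \<Gamma> \<phi> = \<Gamma> (right_action A \<phi> \<Lambda>)"
proof -
  obtain \<psi> where \<psi>: "\<psi> \<in> dual W" "cutoff A \<psi> = \<phi>"
    using extend_from_subalgebra[OF \<phi>] by blast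
  have "arens_mult A \<Lambda> \<Gamma> \<phi> = incl (arens_mult A \<Lambda> \<Gamma>) \<psi>"
    using \<psi> by (simp add: incl_apply)
  also have "\<dots> = incl \<Gamma> (right_action W \<psi> (incl \<Lambda>))"
    unfolding incl_arens[OF \<Gamma>] by (rule W.arens_regular[OF incl_in_bidual(1)[OF \<Lambda>] incl_in_bidual(1)[OF \<Gamma>] \<psi>(1)])
  also have "\<dots> = \<Gamma> (right_action A \<phi> \<Lambda>)"
    using W.right_action_in_dual(1)[OF incl_in_bidual(1)[OF \<Lambda>] \<psi>(1)] \<psi>
    by (simp add: incl_apply restrict_right_action)
  finally show ?thesis .
qed

text \<open>A norm-preserving extension \<open>q\<close> of \<open>f\<close> to \<open>W\<close> attains its norm at 1, hence it is positive. So
  \<open>\<Lambda>\<close> attains the extremal value at the functional represented by 1 under the forms \<open>q (x y\<^sup>\<star>)\<close> and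
  \<open>q (y\<^sup>\<star> x)\<close>, and \<open>bidual_rep_of_attains\<close> determines its values at the functionals represented by the
  other elements; these are the right and left translates of \<open>q\<close>.\<close>

lemma fixed_of_attains:
  assumes \<Lambda>: "\<Lambda> \<in> bidual A" "norm2 A \<Lambda> \<le> 1" and f: "f \<in> dual A"
    and f_id: "f id_blinfun = complex_of_real (norm1 A f)" and attains: "\<Lambda> f = complex_of_real (norm1 A f)"
  shows "bidual_action A \<Lambda> f = f" and "right_action A f \<Lambda> = f"
proof -
  obtain q where q: "q \<in> dual W" "cutoff A q = f" "norm1 W q \<le> norm1 A f"
    using extend_from_subalgebra[OF f] by blast
  have q_id: "q id_blinfun = complex_of_real (norm1 A f)"
    using q(2) f_id A.id_in by (metis cutoff_apply)
  have pos: "W.positive q"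
  proof (rule W.positive_of_attains_at_id[OF q(1) _ _ q_id])
    show "cmod (q x) \<le> norm1 A f * norm x" if "x \<in> W" for x
      by (rule dual_norm_bound[OF W.seminormed q(1,3) that])
  qed (rule dual_norm_nonneg[OF A.seminormed f])
  note I = incl_in_bidual(1)[OF \<Lambda>(1)]
  have norm_le: "norm2 W (incl \<Lambda>) * sqrt (norm1 W q) \<le> sqrt (norm1 A f)"
    using incl_in_bidual(2)[OF \<Lambda>(1)] \<Lambda>(2) q(3) dual_norm_nonneg[OF W.seminormed q(1)]
      dual_norm_nonneg[OF W.seminormed1 I] mult_mono[of "norm2 W (incl \<Lambda>)" 1 "sqrt (norm1 W q)" "sqrt (norm1 A f)"]
    by simp
  have attains': "incl \<Lambda> q = q id_blinfun"
    using q q_id attains by (simp add: incl_apply)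
  interpret R: bounded_form W "\<lambda>x y. q (x o\<^sub>L y\<^sup>\<star>)" norm "sqrt (norm1 W q)"
    by (rule W.positive_bounded_form[OF pos])
  interpret O: bounded_form W "\<lambda>x y. q (y\<^sup>\<star> o\<^sub>L x)" norm "sqrt (norm1 W q)"
    by (rule W.positive_opposite_form[OF pos])
  have rep_id: "R.rep id_blinfun = q" "O.rep id_blinfun = q"
    by (auto simp: R.rep_def O.rep_def W.star_id compose_id fun_eq_iff cutoff_def dual_space_outside[OF q(1)])
  have len_id: "R.len id_blinfun = sqrt (norm1 A f)" "O.len id_blinfun = sqrt (norm1 A f)"
    by (simp_all add: R.len_def O.len_def W.star_id compose_id q_id)
  have R: "incl \<Lambda> (R.rep y) = q (id_blinfun o\<^sub>L y\<^sup>\<star>)" if "y \<in> W" for y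
    by (rule R.bidual_rep_of_attains[OF I W.id_in that])
       (use norm_le attains' in \<open>simp_all add: rep_id len_id W.star_id compose_id\<close>)
  have O: "incl \<Lambda> (O.rep y) = q (y\<^sup>\<star> o\<^sub>L id_blinfun)" if "y \<in> W" for y
    by (rule O.bidual_rep_of_attains[OF I W.id_in that])
       (use norm_le attains' in \<open>simp_all add: rep_id len_id W.star_id compose_id\<close>)
  show "bidual_action A \<Lambda> f = f"
  proof
    show "bidual_action A \<Lambda> f a = f a" for a
    proof (cases "a \<in> A")
      case True
      then have a: "a \<in> W" using subset by auto
      have "functional_mult W q a = O.rep (a\<^sup>\<star>)"
        using a by (simp add: functional_mult_def O.rep_def cutoff_def W.star_star)
      then have "\<Lambda> (functional_mult A f a) = q a"
        using O[OF W.star_in[OF a]] restrict_functional_mult[OF True, of q] a q(2)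
          incl_apply[OF O.rep_dual(1)[OF W.star_in[OF a]]] by (simp add: W.star_star compose_id)
      then show ?thesis
        using True q(2) by (simp add: A.action_apply) (metis cutoff_apply)
    qed (simp add: bidual_action_def dual_space_outside[OF f])
  qed
  show "right_action A f \<Lambda> = f"
  proof
    show "right_action A f \<Lambda> a = f a" for a
    proof (cases "a \<in> A")
      case True
      then have a: "a \<in> W" using subset by auto
      have "right_mult W q a = R.rep (a\<^sup>\<star>)"
        using a by (simp add: right_mult_def R.rep_def cutoff_def W.star_star)
      then have "\<Lambda> (right_mult A f a) = q a"
        using R[OF W.star_in[OF a]] restrict_right_mult[OF True, of q] a q(2)
          incl_apply[OF R.rep_dual(1)[OF W.star_in[OF a]]] by (simp add: W.star_star compose_id)
      then show ?thesis
        using True q(2) by (simp add: right_action_def cutoff_apply) (metis cutoff_apply)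
    qed (simp add: right_action_def cutoff_def dual_space_outside[OF f])
  qed
qed

definition L_projection :: "(('h op \<Rightarrow> complex) \<Rightarrow> ('h op \<Rightarrow> complex)) \<Rightarrow> bool" where
  "L_projection L \<longleftrightarrow> L \<in> dual A \<rightarrow> dual A \<and> clinear_on (dual A) L \<and> (\<forall>\<phi>\<in>dual A. L (L \<phi>) = L \<phi>) \<and>
     (\<forall>\<phi>\<in>dual A. norm1 A \<phi> = norm1 A (L \<phi>) + norm1 A (\<phi> - L \<phi>))"

text \<open>The projection is \<open>e \<phi> = (L \<phi>) 1\<close>, the image of the unit under the adjoint of \<open>L\<close>. On restrictions of
  positive functionals \<open>L\<close> agrees with both actions of \<open>e\<close> by \<open>fixed_of_attains\<close>, hence it does so
  everywhere; with \<open>(e \<Lambda>) \<phi> = \<Lambda> (\<phi> \<cdot> e)\<close> and \<open>(\<Lambda> e) \<phi> = \<Lambda> (e \<cdot> \<phi>)\<close> the element \<open>e\<close> is central. It is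
  self-adjoint because its values at positive functionals are real.\<close>

theorem exists_central_projection_of_L_projection:
  assumes L: "L_projection L"
  shows "\<exists>z. central_projection W A z \<and> (\<forall>\<phi>\<in>dual A. L \<phi> = bidual_action A z \<phi>)"
proof -
  have Ld: "L \<phi> \<in> dual A" and LL: "L (L \<phi>) = L \<phi>"
    and split: "norm1 A \<phi> = norm1 A (L \<phi>) + norm1 A (\<phi> - L \<phi>)" if "\<phi> \<in> dual A" for \<phi>
    using L that by (auto simp: L_projection_def)
  have lin: "clinear_on (dual A) L"
    using L by (simp add: L_projection_def)
  note diff = clinear_on_diff[OF seminormedD(1)[OF A.seminormed1] lin]
  have Dd: "\<phi> - L \<phi> \<in> dual A" if "\<phi> \<in> dual A" for \<phi>
    using that Ld A.dual_intros by blast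
  have norm_L: "norm1 A (L \<phi>) \<le> 1 * norm1 A \<phi>" and norm_D: "norm1 A (\<phi> - L \<phi>) \<le> norm1 A \<phi>"
    if "\<phi> \<in> dual A" for \<phi>
    using split[OF that] dual_norm_nonneg[OF A.seminormed Dd[OF that]]
      dual_norm_nonneg[OF A.seminormed Ld[OF that]] by simp_all
  have at_id: "cmod (\<phi> id_blinfun) \<le> norm1 A \<phi>" if "\<phi> \<in> dual A" for \<phi>
    using A.dual_apply_bound[OF that A.id_in] norm_blinfun_id_le
      mult_left_le[of "norm (id_blinfun :: 'h op)" "norm1 A \<phi>"] dual_norm_nonneg[OF A.seminormed that]
    by (meson order_trans)
  define e where "e = cutoff (dual A) (\<lambda>\<phi>. L \<phi> id_blinfun)"
  have e_apply: "e \<phi> = L \<phi> id_blinfun" if "\<phi> \<in> dual A" for \<phi>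
    using that by (simp add: e_def cutoff_apply)
  have e_le: "cmod (L \<phi> id_blinfun) \<le> 1 * norm1 A \<phi>" if "\<phi> \<in> dual A" for \<phi>
    using at_id[OF Ld[OF that]] norm_L[OF that] by simp
  have e: "e \<in> bidual A"
    unfolding e_def using clinear_onD[OF lin]
    by (intro cutoff_in_dual_space[OF A.seminormed1 _ e_le]) (auto simp: clinear_on_def)
  have norm_e: "norm2 A e \<le> 1"
    by (rule dual_norm_le[OF A.seminormed1]) (use e_le in \<open>auto simp: e_apply\<close>)
  define e' where "e' = bidual_unit A - e"
  have e': "e' \<in> bidual A"
    unfolding e'_def using e A.bidual_unit_in A.bidual_intros by blast
  have e'_apply: "e' \<phi> = (\<phi> - L \<phi>) id_blinfun" if "\<phi> \<in> dual A" for \<phi>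
    using that by (simp add: e'_def e_apply bidual_unit_def)
  have norm_e': "norm2 A e' \<le> 1"
  proof (rule dual_norm_le[OF A.seminormed1])
    show "cmod (e' \<phi>) \<le> 1 * norm1 A \<phi>" if "\<phi> \<in> dual A" for \<phi>
      using at_id[OF Dd[OF that]] norm_D[OF that] unfolding e'_apply[OF that] by simp
  qed simp
  have pos_case: "bidual_action A e (cutoff A p) = L (cutoff A p) \<and> right_action A (cutoff A p) e = L (cutoff A p) \<and>
      L (cutoff A p) id_blinfun = complex_of_real (norm1 A (L (cutoff A p)))"
    if p: "W.positive p" for p
  proof -
    note pd = W.positive_dual[OF p]
    define f where "f = cutoff A p"
    have f: "f \<in> dual A"
      unfolding f_def by (rule restrict_in_dual(1)[OF pd])
    define g h where "g = L f" and "h = f - L f"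
    have gh: "g \<in> dual A" "h \<in> dual A" "f = g + h"
      unfolding g_def h_def using Ld[OF f] Dd[OF f] by auto
    \<comment> \<open>\<open>f\<close> attains its norm at 1; as norms add up, so do the two summands.\<close>
    have "norm1 A f \<le> Re (p id_blinfun)"
      by (rule dual_norm_le[OF A.seminormed])
         (use W.positive_bound[OF p] W.positive_id[OF p] subset in \<open>auto simp: f_def cutoff_def\<close>)
    moreover have "f id_blinfun = p id_blinfun"
      by (simp add: f_def cutoff_apply A.id_in)
    moreover have "norm1 A f = norm1 A g + norm1 A h"
      unfolding g_def h_def by (rule split[OF f])
    moreover have "Re (f id_blinfun) = Re (g id_blinfun) + Re (h id_blinfun)"
      by (subst gh(3)) simp
    ultimately have "norm1 A g + norm1 A h \<le> Re (g id_blinfun) + Re (h id_blinfun)"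
      by simp
    moreover have g_le: "cmod (g id_blinfun) \<le> norm1 A g" and h_le: "cmod (h id_blinfun) \<le> norm1 A h"
      using at_id gh by auto
    ultimately have "Re (g id_blinfun) = norm1 A g" "Re (h id_blinfun) = norm1 A h"
      using complex_Re_le_cmod[of "g id_blinfun"] complex_Re_le_cmod[of "h id_blinfun"] by linarith+
    moreover have real: "w = complex_of_real r" if "Re w = r" "cmod w \<le> r" for w r
    proof -
      have "(cmod w)\<^sup>2 \<le> r\<^sup>2"
        using that(2) by (intro power_mono) auto
      then show ?thesis
        using that(1) by (simp add: cmod_power2 complex_eq_iff)
    qed
    ultimately have g_id: "g id_blinfun = complex_of_real (norm1 A g)"
      and h_id: "h id_blinfun = complex_of_real (norm1 A h)"
      using g_le h_le by blast+
    have Lg: "L g = g" and Lh: "L h = 0"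
      using LL[OF f] diff[OF f Ld[OF f]] by (simp_all add: g_def h_def)
    have "e g = complex_of_real (norm1 A g)"
      using e_apply[OF gh(1)] g_id by (simp add: Lg)
    from fixed_of_attains[OF e norm_e gh(1) g_id this]
    have eg: "bidual_action A e g = g" "right_action A g e = g" .
    have "e' h = complex_of_real (norm1 A h)"
      using e'_apply[OF gh(2)] h_id by (simp add: Lh)
    note h_fixed = fixed_of_attains[OF e' norm_e' gh(2) h_id this, unfolded e'_def A.action_diff_left
        A.right_action_diff_right A.action_unit[OF gh(2)] A.right_action_unit[OF gh(2)]]
    have "bidual_action A e h = 0" "right_action A h e = 0"
      by (rule eq_zero_of_diff_eq_self[OF h_fixed(1)], rule eq_zero_of_diff_eq_self[OF h_fixed(2)])
    then have "bidual_action A e f = g" "right_action A f e = g"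
      unfolding gh(3) using eg A.action_add[OF e gh(1,2)]
        clinear_onD(1)[OF A.right_action_linear[OF e] gh(1,2)] by simp_all
    with g_id show ?thesis
      by (simp add: f_def g_def)
  qed
  have agree: "T \<phi> = L \<phi>"
    if T: "clinear_on (dual A) T" "\<And>\<phi>. \<phi> \<in> dual A \<Longrightarrow> T \<phi> \<in> dual A"
      "\<And>\<phi>. \<phi> \<in> dual A \<Longrightarrow> norm1 A (T \<phi>) \<le> norm2 A e * norm1 A \<phi>"
      "\<And>p. W.positive p \<Longrightarrow> T (cutoff A p) = L (cutoff A p)" and \<phi>: "\<phi> \<in> dual A" for T \<phi>
  proof -
    have "T \<phi> - L \<phi> = 0"
    proof (rule operator_zero_of_positive[where T = "\<lambda>\<phi>. T \<phi> - L \<phi>", OF _ _ _ _ _ \<phi>])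
      show "clinear_on (dual A) (\<lambda>\<phi>. T \<phi> - L \<phi>)"
        using clinear_onD[OF lin] clinear_onD[OF T(1)]
        by (simp add: clinear_on_def complex_vector.scale_right_diff_distrib)
      show "norm1 A (T \<phi> - L \<phi>) \<le> (norm2 A e + 1) * norm1 A \<phi>" if \<phi>: "\<phi> \<in> dual A" for \<phi>
      proof -
        have "norm1 A (T \<phi> + - L \<phi>) \<le> norm1 A (T \<phi>) + norm1 A (- L \<phi>)"
          by (intro seminormedD(2)[OF A.seminormed1] T(2) A.dual_intros(4) Ld \<phi>)
        then show ?thesis
          using T(3)[OF \<phi>] norm_L[OF \<phi>] seminormed_neg[OF A.seminormed1 Ld[OF \<phi>]]
          by (simp add: distrib_right)
      qed
    qed (use T(2,4) Ld A.dual_intros dual_norm_nonneg[OF A.seminormed1 e] in auto)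
    then show ?thesis by simp
  qed
  have eL: "bidual_action A e \<phi> = L \<phi>" if "\<phi> \<in> dual A" for \<phi>
    by (rule agree[OF A.action_linear[OF e] A.action_in_dual[OF e] _ that]) (use pos_case in auto)
  have Le: "right_action A \<phi> e = L \<phi>" if "\<phi> \<in> dual A" for \<phi>
    by (rule agree[OF A.right_action_linear[OF e] A.right_action_in_dual[OF e] _ that]) (use pos_case in auto)
  have "central_projection W A e"
    unfolding central_projection_def
  proof (intro conjI ballI)
    show "e \<in> bidual A" by (rule e)
    show "arens_mult A e \<Lambda> = arens_mult A \<Lambda> e" if \<Lambda>: "\<Lambda> \<in> bidual A" for \<Lambda>
    proof (rule dual_space_eqI[OF A.arens_in_bidual(1)[OF e \<Lambda>] A.arens_in_bidual(1)[OF \<Lambda> e]])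
      show "arens_mult A e \<Lambda> \<phi> = arens_mult A \<Lambda> e \<phi>" if "\<phi> \<in> dual A" for \<phi>
        using arens_regular_subalgebra[OF e \<Lambda> that] that by (simp add: A.arens_apply[of \<phi> \<Lambda>] eL Le)
    qed
    show "arens_mult A e e = e"
    proof (rule dual_space_eqI[OF A.arens_in_bidual(1)[OF e e] e])
      show "arens_mult A e e \<phi> = e \<phi>" if "\<phi> \<in> dual A" for \<phi>
        using that Ld[OF that] LL[OF that] by (simp add: A.arens_apply eL e_apply)
    qed
    note I = incl_in_bidual(1)[OF e]
    note S = W.bidual_star_in_bidual[OF I]
    show "bidual_star W (incl e) = incl e"
    proof (rule dual_space_eqI[OF S I])
      fix \<psi> assume \<psi>: "\<psi> \<in> dual W"
      have "(bidual_star W (incl e) - incl e) \<psi> = 0"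
      proof (rule W.bidual_zero_of_positive[OF _ _ \<psi>])
        show "bidual_star W (incl e) - incl e \<in> bidual W"
          using S I W.bidual_intros by blast
        show "(bidual_star W (incl e) - incl e) p = 0" if p: "W.positive p" for p
          using pos_case[OF p] W.positive_dual[OF p] restrict_in_dual(1)[OF W.positive_dual[OF p]]
          by (simp add: W.bidual_star_apply W.functional_star_positive[OF p] incl_apply e_apply)
      qed
      then show "bidual_star W (incl e) \<psi> = incl e \<psi>" by simp
    qed
  qed
  with eL show ?thesis by auto
qed

text \<open>The values \<open>(z \<phi>) a\<close> and \<open>(\<phi> - z \<phi>) b\<close> add up to the value of \<open>z a + (1 - z) b\<close> at an extension of
  \<open>\<phi>\<close> of the same norm, because \<open>z\<close> commutes with \<open>a\<close> and \<open>b\<close>.\<close>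

theorem L_projection_of_central_projection:
  assumes z: "central_projection W A z"
  shows "L_projection (bidual_action A z)"
proof -
  have zA: "z \<in> bidual A" and zz: "arens_mult A z z = z"
    and star: "bidual_star W (incl z) = incl z"
    and central: "\<And>\<Lambda>. \<Lambda> \<in> bidual A \<Longrightarrow> arens_mult A z \<Lambda> = arens_mult A \<Lambda> z"
    using z by (auto simp: central_projection_def)
  note w = incl_in_bidual(1)[OF zA]
  have ww: "arens_mult W (incl z) (incl z) = incl z"
    using zz by (simp flip: incl_arens[OF zA])
  have comm: "arens_mult W (incl z) (evaluation W a) = arens_mult W (evaluation W a) (incl z)" if "a \<in> A" for a
    using central[OF A.evaluation_in_bidual(1)[OF that]] incl_arens[OF A.evaluation_in_bidual(1)[OF that], of z]
      incl_arens[OF zA, of "evaluation A a"] by (simp add: incl_evaluation[OF that])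
  have split: "norm1 A \<phi> = norm1 A (bidual_action A z \<phi>) + norm1 A (\<phi> - bidual_action A z \<phi>)"
    if \<phi>: "\<phi> \<in> dual A" for \<phi>
  proof (rule antisym)
    note z\<phi> = A.action_in_dual(1)[OF zA \<phi>]
    have d: "\<phi> - bidual_action A z \<phi> \<in> dual A"
      using \<phi> z\<phi> A.dual_intros by blast
    show "norm1 A \<phi> \<le> norm1 A (bidual_action A z \<phi>) + norm1 A (\<phi> - bidual_action A z \<phi>)"
      using seminormedD(2)[OF A.seminormed1 z\<phi> d] by simp
    obtain \<psi> where \<psi>: "\<psi> \<in> dual W" "cutoff A \<psi> = \<phi>" "norm1 W \<psi> \<le> norm1 A \<phi>"
      using extend_from_subalgebra[OF \<phi>] by blast
    show "norm1 A (bidual_action A z \<phi>) + norm1 A (\<phi> - bidual_action A z \<phi>) \<le> norm1 A \<phi>"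
    proof (rule dual_norm_add_le[OF A.seminormed dual_space_linear(1)[OF z\<phi>] dual_space_linear(1)[OF d]])
      fix a b assume a: "a \<in> A" "norm a \<le> 1" and b: "b \<in> A" "norm b \<le> 1"
      have aW: "a \<in> W" and bW: "b \<in> W"
        using a b subset by auto
      let ?F = "arens_mult W (incl z) (evaluation W a) + arens_mult W (bidual_unit W - incl z) (evaluation W b)"
      have F_in: "?F \<in> bidual W"
        by (intro W.bidual_intros(1) W.arens_in_bidual(1) w W.evaluation_in_bidual(1) aW bW
            W.bidual_intros(3) W.bidual_unit_in)
      have action: "bidual_action W (incl z) \<psi> x = bidual_action A z \<phi> x" if "x \<in> A" for x
        using restrict_action[OF \<psi>(1), of z] \<psi>(2) that by (metis cutoff_apply)
      have "arens_mult W (incl z) (evaluation W a) \<psi> = bidual_action A z \<phi> a"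
        unfolding comm[OF a(1)] W.evaluation_arens_apply[OF w \<psi>(1) aW] by (rule action[OF a(1)])
      moreover have "arens_mult W (bidual_unit W - incl z) (evaluation W b) \<psi> = \<phi> b - bidual_action A z \<phi> b"
      proof -
        have "arens_mult W (bidual_unit W - incl z) (evaluation W b) \<psi>
            = evaluation W b \<psi> - arens_mult W (evaluation W b) (incl z) \<psi>"
          using comm[OF b(1)] W.evaluation_in_bidual(1)[OF bW]
          by (simp add: W.arens_diff_left W.arens_unit_left)
        also have "evaluation W b \<psi> = \<phi> b"
          using \<psi> b(1) by (metis W.evaluation_apply cutoff_apply)
        finally show ?thesis
          unfolding W.evaluation_arens_apply[OF w \<psi>(1) bW] action[OF b(1)] .
      qed
      ultimately have F: "bidual_action A z \<phi> a + (\<phi> - bidual_action A z \<phi>) b = ?F \<psi>"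
        by simp
      have "cmod (?F \<psi>) \<le> norm2 W ?F * norm1 W \<psi>"
        by (rule W.bidual_apply_bound[OF F_in \<psi>(1)])
      moreover have "norm2 W ?F * norm1 W \<psi> \<le> 1 * norm1 W \<psi>"
        using W.norm_split_le_one[OF w ww star aW a(2) comm[OF a(1)] bW b(2) comm[OF b(1)]]
          dual_norm_nonneg[OF W.seminormed \<psi>(1)] by (rule mult_right_mono)
      ultimately show "cmod (bidual_action A z \<phi> a + (\<phi> - bidual_action A z \<phi>) b) \<le> norm1 A \<phi>"
        unfolding F using \<psi>(3) by linarith
    qed
  qed
  have "bidual_action A z (bidual_action A z \<phi>) = bidual_action A z \<phi>" if "\<phi> \<in> dual A" for \<phi>
    using A.action_arens[OF zA that, of z] zz by simp
  moreover have "bidual_action A z \<in> dual A \<rightarrow> dual A"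
    using A.action_in_dual(1)[OF zA] by blast
  ultimately show ?thesis
    unfolding L_projection_def using split A.action_linear[OF zA] by blast
qed

end

section \<open>Annihilators and absolutely continuous functionals\<close>

lemma continuous_map_cmult:
  fixes f :: "'a \<Rightarrow> complex"
  assumes "continuous_map X euclidean f"
  shows "continuous_map X euclidean (\<lambda>x. c * f x)"
proof -
  have "continuous_map euclidean euclidean (\<lambda>y::complex. c * y)"
    by (simp add: continuous_on_mult_left continuous_map_iff_continuous2)
  from continuous_map_compose[OF assms this] show ?thesis
    by (simp add: o_def)
qed

text \<open>Separation from \<open>AC W A\<close> by a functional requires that it be a linear space.\<close>

lemma csubspace_AC:
  assumes "seminormed (A :: 'h::complex_hilbert op set) norm"
  shows "csubspace (AC W A)"
proof (rule complex_vector.subspaceI)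
  note dual_intros = seminormedD(4-6)[OF seminormed_dual[OF assms]]
  show "0 \<in> AC W A"
    using dual_intros(1) unfolding AC_def
    by (auto intro!: exI[of _ "\<lambda>_. 0"] simp: clinear_on_def)
  show "\<phi> + \<psi> \<in> AC W A" if \<phi>: "\<phi> \<in> AC W A" and \<psi>: "\<psi> \<in> AC W A" for \<phi> \<psi>
  proof -
    from \<phi> obtain f where f: "\<phi> \<in> dual A" "clinear_on W f"
      "continuous_map (weak_star_topology W) euclidean f" "\<forall>a\<in>A. f a = \<phi> a"
      by (auto simp: AC_def)
    from \<psi> obtain g where g: "\<psi> \<in> dual A" "clinear_on W g"
      "continuous_map (weak_star_topology W) euclidean g" "\<forall>a\<in>A. g a = \<psi> a"
      by (auto simp: AC_def)
    have "clinear_on W (\<lambda>x. f x + g x)"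
      using clinear_onD[OF f(2)] clinear_onD[OF g(2)] by (simp add: clinear_on_def distrib_left)
    moreover have "continuous_map (weak_star_topology W) euclidean (\<lambda>x. f x + g x)"
      by (rule continuous_map_add[OF f(3) g(3)])
    ultimately show ?thesis
      unfolding AC_def using f(1,4) g(1,4) dual_intros(2)[OF f(1) g(1)]
      by (intro CollectI conjI exI[of _ "\<lambda>x. f x + g x"]) simp_all
  qed
  show "c *\<^sub>C \<phi> \<in> AC W A" if \<phi>: "\<phi> \<in> AC W A" for c \<phi>
  proof -
    from \<phi> obtain f where f: "\<phi> \<in> dual A" "clinear_on W f"
      "continuous_map (weak_star_topology W) euclidean f" "\<forall>a\<in>A. f a = \<phi> a"
      by (auto simp: AC_def)
    have "clinear_on W (\<lambda>x. c * f x)"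
      using clinear_onD[OF f(2)] by (simp add: clinear_on_def distrib_left)
    then show ?thesis
      unfolding AC_def using f(1,4) dual_intros(3)[OF f(1)] continuous_map_cmult[OF f(3)]
      by (intro CollectI conjI exI[of _ "\<lambda>x. c * f x"]) simp_all
  qed
qed

context operator_algebra
begin

lemma norm1_eq_zero: "\<phi> \<in> dual A \<Longrightarrow> norm1 A \<phi> \<le> 0 \<Longrightarrow> \<phi> = 0"
  using dual_apply_bound[of \<phi>] dual_norm_nonneg[OF seminormed, of \<phi>] dual_space_outside[of \<phi> A norm]
  by (fastforce simp: fun_eq_iff)

lemma action_range:
  assumes z: "z \<in> bidual A" "arens_mult A z z = z"
  shows "bidual_action A z ` dual A = {\<phi> \<in> dual A. bidual_action A z \<phi> = \<phi>}"
proof -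
  have "bidual_action A z (bidual_action A z \<phi>) = bidual_action A z \<phi>" if "\<phi> \<in> dual A" for \<phi>
    using action_arens[OF z(1) that, of z] z(2) by simp
  then show ?thesis
    using action_in_dual(1)[OF z(1)] by (auto simp: image_iff) metis
qed

text \<open>The range is the set of fixed points of a bounded operator.\<close>

lemma action_range_closed:
  assumes z: "z \<in> bidual A" "arens_mult A z z = z"
  shows "norm_closed_in_dual A (bidual_action A z ` dual A)"
  unfolding norm_closed_in_dual_def action_range[OF z]
proof (intro ballI impI)
  fix \<phi> assume \<phi>: "\<phi> \<in> dual A"
    and approx: "\<forall>\<epsilon>>0. \<exists>\<psi>\<in>{\<phi> \<in> dual A. bidual_action A z \<phi> = \<phi>}. norm1 A (\<phi> - \<psi>) < \<epsilon>"
  note z\<phi> = action_in_dual(1)[OF z(1) \<phi>]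
  have d: "\<phi> - bidual_action A z \<phi> \<in> dual A"
    by (rule dual_intros(3)[OF \<phi> z\<phi>])
  have "norm1 A (\<phi> - bidual_action A z \<phi>) \<le> \<epsilon> * (1 + norm2 A z)" if "\<epsilon> > 0" for \<epsilon>
  proof -
    obtain \<psi> where \<psi>: "\<psi> \<in> dual A" "bidual_action A z \<psi> = \<psi>" "norm1 A (\<phi> - \<psi>) < \<epsilon>"
      using approx \<open>\<epsilon> > 0\<close> by blast
    have \<phi>\<psi>: "\<phi> - \<psi> \<in> dual A"
      by (rule dual_intros(3)[OF \<phi> \<psi>(1)])
    note z\<phi>\<psi> = action_in_dual[OF z(1) \<phi>\<psi>]
    have "\<phi> - bidual_action A z \<phi> = (\<phi> - \<psi>) + - bidual_action A z (\<phi> - \<psi>)"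
      unfolding action_diff[OF z(1) \<phi> \<psi>(1)] \<psi>(2) by simp
    then have "norm1 A (\<phi> - bidual_action A z \<phi>) \<le> norm1 A (\<phi> - \<psi>) + norm1 A (- bidual_action A z (\<phi> - \<psi>))"
      using seminormedD(2)[OF seminormed1 \<phi>\<psi> dual_intros(4)[OF z\<phi>\<psi>(1)]] by (simp only:)
    also have "norm1 A (- bidual_action A z (\<phi> - \<psi>)) = norm1 A (bidual_action A z (\<phi> - \<psi>))"
      by (rule seminormed_neg[OF seminormed1 z\<phi>\<psi>(1)])
    finally have "norm1 A (\<phi> - bidual_action A z \<phi>) \<le> norm1 A (\<phi> - \<psi>) + norm2 A z * norm1 A (\<phi> - \<psi>)"
      using z\<phi>\<psi>(2) by linarith
    also have "\<dots> = norm1 A (\<phi> - \<psi>) * (1 + norm2 A z)"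
      by (simp only: distrib_left mult_1_right mult.commute)
    also have "\<dots> \<le> \<epsilon> * (1 + norm2 A z)"
      using \<psi>(3) dual_norm_nonneg[OF seminormed1 z(1)] by (intro mult_right_mono) auto
    finally show ?thesis .
  qed
  then have "norm1 A (\<phi> - bidual_action A z \<phi>) \<le> 0"
    by (rule nonpos_of_le_eps) (use dual_norm_nonneg[OF seminormed1 z(1)] in auto)
  from norm1_eq_zero[OF d this] show "\<phi> \<in> {\<phi> \<in> dual A. bidual_action A z \<phi> = \<phi>}"
    using \<phi> by simp
qed

text \<open>By centrality the left multiple \<open>(1 - z) \<Lambda>\<close> is \<open>\<Lambda> - \<Lambda> z\<close>, which is what vanishing on \<open>z \<phi>\<close> is about.\<close>

lemma annihilator_action_range:
  assumes z: "z \<in> bidual A" "arens_mult A z z = z"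
    and central: "\<And>\<Lambda>. \<Lambda> \<in> bidual A \<Longrightarrow> arens_mult A z \<Lambda> = arens_mult A \<Lambda> z"
  shows "annihilator A (bidual_action A z ` dual A) = arens_mult A (bidual_unit A - z) ` bidual A"
proof -
  have complement: "arens_mult A (bidual_unit A - z) \<Lambda> = \<Lambda> - arens_mult A \<Lambda> z" if "\<Lambda> \<in> bidual A" for \<Lambda>
    using that by (simp only: arens_diff_left arens_unit_left central)
  show ?thesis
  proof (intro equalityI subsetI)
    fix \<Lambda> assume "\<Lambda> \<in> annihilator A (bidual_action A z ` dual A)"
    then have \<Lambda>: "\<Lambda> \<in> bidual A" and zero: "\<And>\<phi>. \<phi> \<in> dual A \<Longrightarrow> \<Lambda> (bidual_action A z \<phi>) = 0"
      by (auto simp: annihilator_def)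
    have "arens_mult A \<Lambda> z = 0"
      using zero by (auto simp: arens_mult_def fun_eq_iff)
    then have "arens_mult A (bidual_unit A - z) \<Lambda> = \<Lambda>"
      unfolding complement[OF \<Lambda>] by simp
    with \<Lambda> show "\<Lambda> \<in> arens_mult A (bidual_unit A - z) ` bidual A"
      by (metis image_eqI)
  next
    fix \<Gamma> assume "\<Gamma> \<in> arens_mult A (bidual_unit A - z) ` bidual A"
    then obtain \<Lambda> where \<Lambda>: "\<Lambda> \<in> bidual A" "\<Gamma> = \<Lambda> - arens_mult A \<Lambda> z"
      using complement by blast
    have "\<Gamma> \<in> bidual A"
      unfolding \<Lambda>(2) using arens_in_bidual(1)[OF \<Lambda>(1) z(1)] by (rule bidual_intros(3)[OF \<Lambda>(1)])
    moreover have "\<Gamma> (bidual_action A z \<phi>) = 0" if "\<phi> \<in> dual A" for \<phi>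
      using action_in_dual(1)[OF z(1) that] action_arens[OF z(1) that, of z] z(2)
      by (simp add: \<Lambda>(2) arens_apply)
    ultimately show "\<Gamma> \<in> annihilator A (bidual_action A z ` dual A)"
      by (auto simp: annihilator_def)
  qed
qed

text \<open>A closed subspace consists of the functionals at which its annihilator vanishes, so it is determined by
  its annihilator.\<close>

lemma action_range_of_annihilator:
  assumes z: "z \<in> bidual A" "arens_mult A z z = z"
    and central: "\<And>\<Lambda>. \<Lambda> \<in> bidual A \<Longrightarrow> arens_mult A z \<Lambda> = arens_mult A \<Lambda> z"
    and S: "csubspace S" "S \<subseteq> dual A" "norm_closed_in_dual A S"
    and ann: "annihilator A S = arens_mult A (bidual_unit A - z) ` bidual A"
  shows "S = bidual_action A z ` dual A"
proof -
  have kills: "\<Lambda> \<phi> = 0" if "\<Lambda> \<in> annihilator A S" "\<phi> \<in> bidual_action A z ` dual A" for \<Lambda> \<phi>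
  proof -
    have "annihilator A (bidual_action A z ` dual A) = annihilator A S"
      unfolding ann by (rule annihilator_action_range[OF z]) (rule central)
    with that(1) have "\<Lambda> \<in> annihilator A (bidual_action A z ` dual A)"
      by (simp only:)
    with that(2) show ?thesis
      unfolding annihilator_def by blast
  qed
  show ?thesis
  proof (intro equalityI subsetI)
    fix \<phi> assume "\<phi> \<in> S"
    then have \<phi>: "\<phi> \<in> dual A"
      using S(2) by auto
    note z\<phi> = action_in_dual(1)[OF z(1) \<phi>]
    \<comment> \<open>Testing \<open>\<phi> = z \<phi>\<close> at \<open>a\<close>: the element \<open>(1 - z) a\<close> of the annihilator vanishes at \<open>\<phi>\<close>.\<close>
    have "\<phi> a = bidual_action A z \<phi> a" if a: "a \<in> A" for a
    proof -
      note ev = evaluation_in_bidual(1)[OF a]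
      have "arens_mult A (bidual_unit A - z) (evaluation A a) \<in> annihilator A S"
        unfolding ann using ev by (rule imageI)
      then have "arens_mult A (bidual_unit A - z) (evaluation A a) \<phi> = 0"
        using \<open>\<phi> \<in> S\<close> by (simp add: annihilator_def)
      moreover have "arens_mult A (bidual_unit A - z) (evaluation A a) = evaluation A a - arens_mult A (evaluation A a) z"
        unfolding arens_diff_left arens_unit_left[OF ev] central[OF ev] ..
      ultimately show ?thesis
        using evaluation_arens_apply[OF z(1) \<phi> a] by (simp add: evaluation_apply[OF \<phi>])
    qed
    from dual_space_eqI[OF \<phi> z\<phi> this] show "\<phi> \<in> bidual_action A z ` dual A"
      using \<phi> by blast
  next
    fix \<phi> assume range: "\<phi> \<in> bidual_action A z ` dual A"
    then have \<phi>: "\<phi> \<in> dual A"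
      using action_in_dual(1)[OF z(1)] by auto
    show "\<phi> \<in> S"
    proof (rule ccontr)
      assume "\<phi> \<notin> S"
      then obtain d where "d > 0" "\<And>\<psi>. \<psi> \<in> S \<Longrightarrow> d \<le> norm1 A (\<phi> - \<psi>)"
        using S(3) \<phi> unfolding norm_closed_in_dual_def by (meson not_le)
      then obtain \<Lambda> where "\<Lambda> \<in> bidual A" "\<forall>\<psi>\<in>S. \<Lambda> \<psi> = 0" "\<Lambda> \<phi> \<noteq> 0"
        using hahn_banach_separation[OF seminormed1 S(1,2) \<phi>] by blast
      then show False
        using kills[OF _ range] by (auto simp: annihilator_def)
    qed
  qed
qed

text \<open>If the range of \<open>u\<close> is contained in that of \<open>v\<close>, then \<open>v\<close> fixes \<open>u \<phi>\<close>, and evaluation at 1 gives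
  \<open>v u = u\<close>.\<close>

lemma idempotent_unique:
  assumes z: "z \<in> bidual A" "arens_mult A z z = z"
    and w: "w \<in> bidual A" "arens_mult A w w = w"
    and commute: "arens_mult A z w = arens_mult A w z"
    and range: "bidual_action A z ` dual A = bidual_action A w ` dual A"
  shows "z = w"
proof -
  have absorb: "arens_mult A v u = u"
    if u: "u \<in> bidual A" and v: "v \<in> bidual A" "arens_mult A v v = v"
      and sub: "bidual_action A u ` dual A \<subseteq> bidual_action A v ` dual A" for u v
  proof (rule dual_space_eqI[OF arens_in_bidual(1)[OF v(1) u] u])
    fix \<phi> assume \<phi>: "\<phi> \<in> dual A"
    then have "bidual_action A u \<phi> \<in> {\<phi> \<in> dual A. bidual_action A v \<phi> = \<phi>}"
      using sub unfolding action_range[OF v] by blast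
    then show "arens_mult A v u \<phi> = u \<phi>"
      using action_id[of "bidual_action A u \<phi>" v] action_id[OF \<phi>, of u] \<phi> by (simp add: arens_apply)
  qed
  have "arens_mult A w z = z" "arens_mult A z w = w"
    using absorb[OF z(1) w] absorb[OF w(1) z] range by simp_all
  with commute show ?thesis by simp
qed

end

context operator_subalgebra
begin

text \<open>Additivity of the norms makes \<open>L\<close> a contraction, which is the boundedness demanded of a Lebesgue projection.\<close>

lemma lebesgue_projection_iff:
  "lebesgue_projection W A L \<longleftrightarrow> L_projection L \<and> L ` dual A = AC W A"
proof
  assume "L_projection L \<and> L ` dual A = AC W A"
  then have L: "L_projection L" and range: "L ` dual A = AC W A"
    by auto
  have "norm1 A (L \<phi>) \<le> 1 * norm1 A \<phi>" if \<phi>: "\<phi> \<in> dual A" for \<phi>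
  proof -
    have "\<phi> - L \<phi> \<in> dual A"
      using L \<phi> A.dual_intros(3) unfolding L_projection_def by blast
    then show ?thesis
      using L \<phi> dual_norm_nonneg[OF A.seminormed, of "\<phi> - L \<phi>"] unfolding L_projection_def by force
  qed
  with L range show "lebesgue_projection W A L"
    unfolding lebesgue_projection_def L_projection_def by blast
qed (auto simp only: lebesgue_projection_def L_projection_def)

end

theorem theorem3p3:
  fixes W A :: "('h::complex_hilbert \<Rightarrow>\<^sub>L 'h) set"
  assumes "von_neumann_algebra W" and "unital_subalgebra A W"
  shows
    "(admits_lebesgue_decomposition W A \<longleftrightarrow>
        (\<exists>z. central_projection W A z \<and> AC W A = bidual_action A z ` dual A)) \<and>
     (admits_lebesgue_decomposition W A \<longleftrightarrow>
        norm_closed_in_dual A (AC W A) \<and>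
        (\<exists>z. central_projection W A z \<and>
             annihilator A (AC W A) = arens_mult A (bidual_unit A - z) ` bidual A)) \<and>
     (admits_lebesgue_decomposition W A \<longrightarrow>
        (\<forall>z z'. central_projection W A z \<and> AC W A = bidual_action A z ` dual A \<and>
                central_projection W A z' \<and>
                annihilator A (AC W A) = arens_mult A (bidual_unit A - z') ` bidual A \<longrightarrow> z = z') \<and>
        (\<forall>z L. central_projection W A z \<and> AC W A = bidual_action A z ` dual A \<and>
               lebesgue_projection W A L \<longrightarrow>
               SG A L = bidual_action A (bidual_unit A - z) ` dual A \<and>
               (\<forall>\<phi>\<in>dual A. L \<phi> = bidual_action A z \<phi> \<and>
                            \<phi> - L \<phi> = bidual_action A (bidual_unit A - z) \<phi> \<and>
                            \<phi> = bidual_action A z \<phi> + bidual_action A (bidual_unit A - z) \<phi>)))"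
proof -
  have unital: "unital_subalgebra W bounded_operators" "unital_subalgebra A bounded_operators" "A \<subseteq> W"
    using assms by (auto simp: von_neumann_algebra_def unital_subalgebra_def)
  interpret operator_subalgebra W A
    using assms unital by unfold_locales (auto simp: von_neumann_algebra_def)
  define ii where "ii z \<longleftrightarrow> central_projection W A z \<and> AC W A = bidual_action A z ` dual A" for z
  define iii where "iii z \<longleftrightarrow> central_projection W A z \<and>
    annihilator A (AC W A) = arens_mult A (bidual_unit A - z) ` bidual A" for z
  have centralD: "z \<in> bidual A" "arens_mult A z z = z"
    "\<And>\<Lambda>. \<Lambda> \<in> bidual A \<Longrightarrow> arens_mult A z \<Lambda> = arens_mult A \<Lambda> z"
    if "central_projection W A z" for z
    using that by (simp_all add: central_projection_def)
  have i_ii: "\<exists>z. ii z \<and> (\<forall>\<phi>\<in>dual A. L \<phi> = bidual_action A z \<phi>)" if "lebesgue_projection W A L" for L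
  proof -
    have L: "L_projection L" "L ` dual A = AC W A"
      using that by (auto simp: lebesgue_projection_iff)
    then obtain z where z: "central_projection W A z" "\<forall>\<phi>\<in>dual A. L \<phi> = bidual_action A z \<phi>"
      using exists_central_projection_of_L_projection by blast
    then have "L ` dual A = bidual_action A z ` dual A"
      by (intro image_cong) auto
    with z L(2) show ?thesis
      by (auto simp: ii_def)
  qed
  have ii_i: "lebesgue_projection W A (bidual_action A z)" if "ii z" for z
    using that L_projection_of_central_projection by (simp add: ii_def lebesgue_projection_iff)
  have ii_iii: "norm_closed_in_dual A (AC W A)" "iii z" if "ii z" for z
    using that A.action_range_closed[OF centralD(1,2)] A.annihilator_action_range[OF centralD]
    by (auto simp: ii_def iii_def)
  have iii_ii: "ii z" if "norm_closed_in_dual A (AC W A)" "iii z" for z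
  proof -
    have z: "central_projection W A z"
      using that(2) by (simp add: iii_def)
    have "AC W A \<subseteq> dual A"
      by (auto simp: AC_def)
    then show ?thesis
      using A.action_range_of_annihilator[OF centralD[OF z] csubspace_AC[OF A.seminormed] _ that(1)] that(2) z
      by (simp add: ii_def iii_def)
  qed
  have unique: "z = z'" if "ii z" "ii z'" for z z'
  proof -
    have z: "central_projection W A z" and z': "central_projection W A z'"
      using that by (simp_all add: ii_def)
    show ?thesis
      by (rule A.idempotent_unique[OF centralD(1,2)[OF z] centralD(1,2)[OF z'] centralD(3)[OF z centralD(1)[OF z']]])
         (use that in \<open>simp add: ii_def\<close>)
  qed
  have 1: "admits_lebesgue_decomposition W A \<longleftrightarrow> (\<exists>z. ii z)"
    using i_ii ii_i unfolding admits_lebesgue_decomposition_def by blast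
  have 2: "admits_lebesgue_decomposition W A \<longleftrightarrow> norm_closed_in_dual A (AC W A) \<and> (\<exists>z. iii z)"
    using 1 ii_iii iii_ii by blast
  have 3: "z = z'" if "ii z" "iii z'" for z z'
    using unique that ii_iii(1) iii_ii by blast
  have 4: "SG A L = bidual_action A (bidual_unit A - z) ` dual A \<and>
      (\<forall>\<phi>\<in>dual A. L \<phi> = bidual_action A z \<phi> \<and> \<phi> - L \<phi> = bidual_action A (bidual_unit A - z) \<phi> \<and>
         \<phi> = bidual_action A z \<phi> + bidual_action A (bidual_unit A - z) \<phi>)"
    if "ii z" "lebesgue_projection W A L" for z L
  proof -
    have L: "L \<phi> = bidual_action A z \<phi>" if "\<phi> \<in> dual A" for \<phi>
      using i_ii[OF \<open>lebesgue_projection W A L\<close>] unique[OF \<open>ii z\<close>] that by blast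
    have complement: "bidual_action A (bidual_unit A - z) \<phi> = \<phi> - bidual_action A z \<phi>" if "\<phi> \<in> dual A" for \<phi>
      unfolding A.action_diff_left A.action_unit[OF that] ..
    have "SG A L = bidual_action A (bidual_unit A - z) ` dual A"
      unfolding SG_def by (rule image_cong) (simp_all only: L complement)
    moreover have "\<phi> = bidual_action A z \<phi> + bidual_action A (bidual_unit A - z) \<phi>" if "\<phi> \<in> dual A" for \<phi>
      unfolding complement[OF that] by simp
    ultimately show ?thesis
      using L complement by metis
  qed
  show ?thesis
  proof (intro conjI impI allI)
    show "admits_lebesgue_decomposition W A \<longleftrightarrow>
        (\<exists>z. central_projection W A z \<and> AC W A = bidual_action A z ` dual A)"
      using 1 unfolding ii_def .
    show "admits_lebesgue_decomposition W A \<longleftrightarrow>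
        norm_closed_in_dual A (AC W A) \<and>
        (\<exists>z. central_projection W A z \<and>
             annihilator A (AC W A) = arens_mult A (bidual_unit A - z) ` bidual A)"
      using 2 unfolding iii_def .
  next
    fix z z' assume "central_projection W A z \<and> AC W A = bidual_action A z ` dual A \<and>
      central_projection W A z' \<and>
      annihilator A (AC W A) = arens_mult A (bidual_unit A - z') ` bidual A"
    then have "ii z" "iii z'"
      unfolding ii_def iii_def by blast+
    then show "z = z'"
      by (rule 3)
  next
    fix z L assume "central_projection W A z \<and> AC W A = bidual_action A z ` dual A \<and>
      lebesgue_projection W A L"
    then have "ii z" "lebesgue_projection W A L"
      by (simp_all only: ii_def)
    note decomposition = 4[OF this]
    show "SG A L = bidual_action A (bidual_unit A - z) ` dual A"
      using decomposition by (rule conjunct1)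
    show "\<forall>\<phi>\<in>dual A. L \<phi> = bidual_action A z \<phi> \<and> \<phi> - L \<phi> = bidual_action A (bidual_unit A - z) \<phi> \<and>
        \<phi> = bidual_action A z \<phi> + bidual_action A (bidual_unit A - z) \<phi>"
      using decomposition by (rule conjunct2)
  qed
qed

end
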